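(* Let $p>1$, $\alpha\ge 0$, and let $\{S_t=u_tC_{\phi_t} : t\in\,]0,1[\}$ be an admissible family of weighted composition operators on $A^p_\alpha$ with direction $\xi\in\partial\mathbb D$. If $\arg u_t(\xi)$ is constant for all $t\in\,]0,1[$, then all of the following quantities are equal: $$\sup_{(f_n)\in\mathcal{AE}}\limsup_n\Big\|\int_0^1S_tf_n\,dt\Big\|_{A^p_\alpha},\qquad \sup_{(f_n)\in\mathcal{AE}}\limsup_n\int_0^1\|S_tf_n\|_{A^p_\alpha}\,dt,$$ $$\lim_c\Big\|\int_0^1S_tf_{c,\xi}\,dt\Big\|_{A^p_\alpha},\qquad \lim_c\int_0^1\|S_tf_{c,\xi}\|_{A^p_\alpha}\,dt,\qquad \int_0^1\frac{|u_t(\xi)|}{\phi_t'(\xi)^{(2+\alpha)/p}}\,dt .$$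
   Context: $\mathbb D$ is the open unit disk in $\mathbb C$, $\mathcal H(\mathbb D)$ the holomorphic functions on $\mathbb D$, $B(z,r)$ the open disk with center $z$ and radius $r$, $dA(x+iy)=dx\,dy/\pi$, $dA_\alpha(z)=(1+\alpha)(1-|z|^2)^\alpha dA(z)$. For $p>1$, $\alpha\ge0$, $A^p_\alpha=\{f\in\mathcal H(\mathbb D):\|f\|^p_{A^p_\alpha}=\int_{\mathbb D}|f|^p\,dA_\alpha<\infty\}$. $\mathcal L(X)$ denotes the bounded linear operators on $X$ and $\partial B_X$ the unit sphere of $X$. For holomorphic $\phi_t:\mathbb D\to\mathbb D$ and $u_t\in A^p_\alpha$, $S_t=u_tC_{\phi_t}:A^p_\alpha\to A^p_\alpha$, $f\mapsto u_t\,(f\circ\phi_t)$. Integrals $\int_0^1S_tf\,dt$ are vector-valued integrals in $A^p_\alpha$. The family $\{u_tC_{\phi_t}:t\in\,]0,1[\}$ has direction $\xi\in\partial\mathbb D$ if for every $t\in\,]0,1[$: (a) $\phi_t\in\mathcal H(\mathbb D)$ and $\phi_t'$ extends continuously to $\overline{\mathbb D}\cap B(\xi,\epsilon)$ for some $\epsilon=\epsilon(t)>0$; (b) $\phi_t(\xi)=\xi$; (c) $\overline{\phi_t(\mathbb D\setminus B(\xi,\epsilon))}\cap\partial\mathbb D=\emptyset$ for every $\epsilon>0$; (d) for every $\epsilon>0$ the set $\overline{\phi_t(B(\xi,\epsilon)\cap\mathbb D)}$ contains a horocycle touching $\xi$ (a circle in $\overline{\mathbb D}$ internally tangent to $\partial\mathbb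 D$ at $\xi$); (e) $u_t$ extends continuously to $\overline{\mathbb D}\cap B(\xi,\epsilon)$ for some $\epsilon=\epsilon(t)>0$. Values of $\phi_t,\phi_t',u_t$ at $\xi$ are those of the continuous extensions; one has $\phi_t'(\xi)>0$. The family is admissible (with direction $\xi$) if it has direction $\xi$, $\int_0^1\|S_t\|_{\mathcal L(A^p_\alpha)}\,dt<\infty$, and for every $t_0\in\,]0,1[$: (i) $\lim_{t\to t_0}\sup_{z\in\mathbb D}|\phi_t(z)-\phi_{t_0}(z)|=0$; (ii) for every $\epsilon'>0$, $\lim_{t\to t_0}\int_{\mathbb D\setminus B(\xi,\epsilon')}|u_t-u_{t_0}|^p\,dA_\alpha=0$; (iii) for some $\epsilon'>0$, $\sup_{|t-t_0|<\epsilon'}\sup_{z\in B(\xi,\epsilon')\cap\mathbb D}|u_t(z)|<\infty$; (iv) for some $\epsilon'>0$, $\inf_{|t-t_0|<\epsilon'}\inf_{z\in B(\xi,\epsilon')\cap\mathbb D}|\phi_t'(z)|>0$. For $\eta\in\partial\mathbb D$, $\mathcal{AE}(\eta)$ is the set of sequences $(f_n)\subset\partial B_{A^p_\alpha}$ such that $\lim_n\sup_{z\in\mathbb D\setminus B(\eta,\epsilon)}|f_n(z)|=0$ for every $\epsilon>0$, and $\mathcal{AE}=\bigcup_{\eta\in\partial\mathbb D}\mathcal{AE}(\eta)$ (approximate evaluation maps). For $c<(2+\alpha)/p$, $f_{c,\xi}=\hat f_{c,\xi}/\|\hat f_{c,\xi}\|_{A^p_\alpha}$ with $\hat f_{c,\xi}(z)=(\xi-z)^{-c}$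 (a holomorphic branch on $\mathbb D$), and $\lim_c$ denotes the limit along sequences $c=c_n<(2+\alpha)/p$ with $c_n\to(2+\alpha)/p$. *)

theory Defs
  imports "HOL-Complex_Analysis.Complex_Analysis"
begin

section \<open>Weighted Bergman spaces\<close>

abbreviation unit_disc :: "complex set" ("\<bbbD>")
  where "\<bbbD> \<equiv> ball 0 1"

text \<open>The factor \<open>1 / pi\<close> comes from the normalised area measure \<open>dA = dx dy / pi\<close>.\<close>

definition bergman_measure :: "real \<Rightarrow> complex measure"
  where "bergman_measure \<alpha> =
    density (lebesgue_on \<bbbD>) (\<lambda>z. ennreal ((1 + \<alpha>) * (1 - (cmod z)\<^sup>2) powr \<alpha> / pi))"

text \<open>Elements of the space are functions on all of \<open>complex\<close>; only their restriction to the
  disc matters, and nothing below depends on their values elsewhere.\<close>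

definition bergman_space :: "real \<Rightarrow> real \<Rightarrow> (complex \<Rightarrow> complex) set"
  where "bergman_space p \<alpha> =
    {f. f holomorphic_on \<bbbD> \<and> integrable (bergman_measure \<alpha>) (\<lambda>z. cmod (f z) powr p)}"

definition bergman_norm :: "real \<Rightarrow> real \<Rightarrow> (complex \<Rightarrow> complex) \<Rightarrow> real"
  where "bergman_norm p \<alpha> f = (LINT z|bergman_measure \<alpha>. cmod (f z) powr p) powr (1 / p)"

definition bergman_sphere :: "real \<Rightarrow> real \<Rightarrow> (complex \<Rightarrow> complex) set"
  where "bergman_sphere p \<alpha> = {f \<in> bergman_space p \<alpha>. bergman_norm p \<alpha> f = 1}"

definition bounded_on_bergman ::
    "real \<Rightarrow> real \<Rightarrow> ((complex \<Rightarrow> complex) \<Rightarrow> complex \<Rightarrow> complex) \<Rightarrow> bool"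
  where "bounded_on_bergman p \<alpha> T \<longleftrightarrow>
    (\<forall>f\<in>bergman_space p \<alpha>. T f \<in> bergman_space p \<alpha>) \<and>
    (\<exists>K. \<forall>f\<in>bergman_space p \<alpha>. bergman_norm p \<alpha> (T f) \<le> K * bergman_norm p \<alpha> f)"

definition bergman_opnorm ::
    "real \<Rightarrow> real \<Rightarrow> ((complex \<Rightarrow> complex) \<Rightarrow> complex \<Rightarrow> complex) \<Rightarrow> ennreal"
  where "bergman_opnorm p \<alpha> T = (SUP f\<in>bergman_sphere p \<alpha>. ennreal (bergman_norm p \<alpha> (T f)))"


section \<open>Bochner integral over the unit interval with values in a Bergman space\<close>

text \<open>The space depends on the real parameters \<open>p\<close> and \<open>\<alpha>\<close>, so it is not a type and the
  library's Bochner integral does not apply. The definitions below follow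
  \<^const>\<open>has_bochner_integral\<close>. Measurability of \<open>F\<close> is expressed through the distances
  to the simple functions: together with their convergence to 0 in \<open>L\<^sup>1\<close> it makes \<open>F\<close> an
  almost everywhere limit of simple functions.\<close>

definition bergman_simple :: "real \<Rightarrow> real \<Rightarrow> (real \<Rightarrow> complex \<Rightarrow> complex) \<Rightarrow> bool"
  where "bergman_simple p \<alpha> s \<longleftrightarrow>
    simple_function (lebesgue_on {0<..<1}) s \<and> s ` {0<..<1} \<subseteq> bergman_space p \<alpha>"

definition bergman_simple_integral :: "(real \<Rightarrow> complex \<Rightarrow> complex) \<Rightarrow> complex \<Rightarrow> complex"
  where "bergman_simple_integral s = (\<lambda>z. \<Sum>g\<in>s ` {0<..<1}.
    complex_of_real (measure (lebesgue_on {0<..<1}) {t \<in> {0<..<1}. s t = g}) * g z)"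

definition has_bergman_integral ::
    "real \<Rightarrow> real \<Rightarrow> (real \<Rightarrow> complex \<Rightarrow> complex) \<Rightarrow> (complex \<Rightarrow> complex) \<Rightarrow> bool"
  where "has_bergman_integral p \<alpha> F g \<longleftrightarrow>
    (\<forall>t\<in>{0<..<1}. F t \<in> bergman_space p \<alpha>) \<and> g \<in> bergman_space p \<alpha> \<and>
    (\<exists>s. (\<forall>i. bergman_simple p \<alpha> (s i)) \<and>
      (\<forall>i. (\<lambda>t. bergman_norm p \<alpha> (\<lambda>z. F t z - s i t z)) \<in> borel_measurable (lebesgue_on {0<..<1})) \<and>
      (\<lambda>i. \<integral>\<^sup>+t. ennreal (bergman_norm p \<alpha> (\<lambda>z. F t z - s i t z)) \<partial>lebesgue_on {0<..<1})
        \<longlonglongrightarrow> 0 \<and>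
      (\<lambda>i. bergman_norm p \<alpha> (\<lambda>z. bergman_simple_integral (s i) z - g z)) \<longlonglongrightarrow> 0)"

text \<open>The value is determined on the disc. As in the library, the integral of a
  non-integrable function is 0.\<close>

definition bergman_integral ::
    "real \<Rightarrow> real \<Rightarrow> (real \<Rightarrow> complex \<Rightarrow> complex) \<Rightarrow> complex \<Rightarrow> complex"
  where "bergman_integral p \<alpha> F =
    (if \<exists>g. has_bergman_integral p \<alpha> F g then SOME g. has_bergman_integral p \<alpha> F g else (\<lambda>_. 0))"


section \<open>Admissible families of weighted composition operators\<close>

definition weighted_comp ::
    "(complex \<Rightarrow> complex) \<Rightarrow> (complex \<Rightarrow> complex) \<Rightarrow> (complex \<Rightarrow> complex) \<Rightarrow> complex \<Rightarrow> complex"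
  where "weighted_comp u \<phi> f = (\<lambda>z. u z * f (\<phi> z))"

definition weighted_comp_family ::
    "real \<Rightarrow> real \<Rightarrow> (real \<Rightarrow> complex \<Rightarrow> complex) \<Rightarrow> (real \<Rightarrow> complex \<Rightarrow> complex) \<Rightarrow> bool"
  where "weighted_comp_family p \<alpha> u \<phi> \<longleftrightarrow>
    (\<forall>t\<in>{0<..<1}. \<phi> t holomorphic_on \<bbbD> \<and> \<phi> t ` \<bbbD> \<subseteq> \<bbbD> \<and> u t \<in> bergman_space p \<alpha> \<and>
      bounded_on_bergman p \<alpha> (weighted_comp (u t) (\<phi> t)))"

definition extends_continuously_near :: "(complex \<Rightarrow> complex) \<Rightarrow> complex \<Rightarrow> bool"
  where "extends_continuously_near f \<xi> \<longleftrightarrow>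
    (\<exists>\<epsilon>>0. \<exists>g. continuous_on (cball 0 1 \<inter> ball \<xi> \<epsilon>) g \<and> (\<forall>z\<in>\<bbbD> \<inter> ball \<xi> \<epsilon>. g z = f z))"

text \<open>The value at \<open>\<xi>\<close> of the continuous extension of \<open>f\<close> from the disc.\<close>

definition boundary_value :: "(complex \<Rightarrow> complex) \<Rightarrow> complex \<Rightarrow> complex"
  where "boundary_value f \<xi> = Lim (at \<xi> within \<bbbD>) f"

text \<open>The sphere in the last but one condition is a horocycle: the circle of radius \<open>r < 1\<close>
  internally tangent to the unit circle at \<open>\<xi>\<close>.\<close>

definition has_direction ::
    "(real \<Rightarrow> complex \<Rightarrow> complex) \<Rightarrow> (real \<Rightarrow> complex \<Rightarrow> complex) \<Rightarrow> complex \<Rightarrow> bool"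
  where "has_direction u \<phi> \<xi> \<longleftrightarrow> \<xi> \<in> sphere 0 1 \<and>
    (\<forall>t\<in>{0<..<1}.
      \<phi> t holomorphic_on \<bbbD> \<and> extends_continuously_near (deriv (\<phi> t)) \<xi> \<and>
      (\<phi> t \<longlongrightarrow> \<xi>) (at \<xi> within \<bbbD>) \<and>
      (\<forall>\<epsilon>>0. closure (\<phi> t ` (\<bbbD> - ball \<xi> \<epsilon>)) \<inter> sphere 0 1 = {}) \<and>
      (\<forall>\<epsilon>>0. \<exists>r. 0 < r \<and> r < 1 \<and>
        sphere (complex_of_real (1 - r) * \<xi>) r \<subseteq> closure (\<phi> t ` (ball \<xi> \<epsilon> \<inter> \<bbbD>))) \<and>
      extends_continuously_near (u t) \<xi>)"

definition admissible ::
    "real \<Rightarrow> real \<Rightarrow> (real \<Rightarrow> complex \<Rightarrow> complex) \<Rightarrow> (real \<Rightarrow> complex \<Rightarrow> complex) \<Rightarrow> complex \<Rightarrow> bool"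
  where "admissible p \<alpha> u \<phi> \<xi> \<longleftrightarrow> has_direction u \<phi> \<xi> \<and>
    (\<integral>\<^sup>+t. bergman_opnorm p \<alpha> (weighted_comp (u t) (\<phi> t)) \<partial>lebesgue_on {0<..<1}) < \<infinity> \<and>
    (\<forall>t0\<in>{0<..<1}.
      ((\<lambda>t. SUP z\<in>\<bbbD>. ennreal (cmod (\<phi> t z - \<phi> t0 z))) \<longlongrightarrow> 0) (at t0) \<and>
      (\<forall>\<epsilon>>0. ((\<lambda>t. \<integral>\<^sup>+z\<in>\<bbbD> - ball \<xi> \<epsilon>. ennreal (cmod (u t z - u t0 z) powr p) \<partial>bergman_measure \<alpha>)
        \<longlongrightarrow> 0) (at t0)) \<and>
      (\<exists>\<epsilon>>0. (SUP t\<in>{t\<in>{0<..<1}. \<bar>t - t0\<bar> < \<epsilon>}. SUP z\<in>ball \<xi> \<epsilon> \<inter> \<bbbD>. ennreal (cmod (u t z))) < \<infinity>) \<and>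
      (\<exists>\<epsilon>>0. (INF t\<in>{t\<in>{0<..<1}. \<bar>t - t0\<bar> < \<epsilon>}.
        INF z\<in>ball \<xi> \<epsilon> \<inter> \<bbbD>. ennreal (cmod (deriv (\<phi> t) z))) > 0))"


section \<open>Approximate evaluation maps\<close>

definition AE_at :: "real \<Rightarrow> real \<Rightarrow> complex \<Rightarrow> (nat \<Rightarrow> complex \<Rightarrow> complex) set"
  where "AE_at p \<alpha> \<eta> = {f. (\<forall>n. f n \<in> bergman_sphere p \<alpha>) \<and>
    (\<forall>\<epsilon>>0. (\<lambda>n. SUP z\<in>\<bbbD> - ball \<eta> \<epsilon>. ennreal (cmod (f n z))) \<longlonglongrightarrow> 0)}"

definition approx_evals :: "real \<Rightarrow> real \<Rightarrow> (nat \<Rightarrow> complex \<Rightarrow> complex) set"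
  where "approx_evals p \<alpha> = (\<Union>\<eta>\<in>sphere 0 1. AE_at p \<alpha> \<eta>)"

text \<open>\<open>h\<close> is a holomorphic branch of \<open>(\<xi> - z) ^ a\<close> on the disc. The principal branch of
  \<open>powr\<close> cannot be used for this: its cut meets \<open>\<xi> - \<bbbD>\<close> when \<open>Re \<xi> < 0\<close>.\<close>

definition power_branch :: "complex \<Rightarrow> real \<Rightarrow> (complex \<Rightarrow> complex) \<Rightarrow> bool"
  where "power_branch \<xi> a h \<longleftrightarrow>
    (\<exists>l. l holomorphic_on \<bbbD> \<and> (\<forall>z\<in>\<bbbD>. exp (l z) = \<xi> - z \<and> h z = exp (complex_of_real a * l z)))"

definition bergman_normalize :: "real \<Rightarrow> real \<Rightarrow> (complex \<Rightarrow> complex) \<Rightarrow> complex \<Rightarrow> complex"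
  where "bergman_normalize p \<alpha> f = (\<lambda>z. f z / complex_of_real (bergman_norm p \<alpha> f))"

end

theory Submission
  imports Defs
begin

text \<open>Put \<open>\<gamma> = (2 + \<alpha>) / p\<close> and let \<open>\<lambda>\<^sub>t\<close> be the value of \<open>u\<^sub>t\<close> at \<open>\<xi>\<close> divided by the power
  \<open>\<gamma>\<close> of the angular derivative of \<open>\<phi>\<^sub>t\<close> at \<open>\<xi>\<close>.

  Upper bound: away from \<open>\<xi>\<close> the symbol \<open>\<phi>\<^sub>t\<close> takes values in a compact subset of the disc, on which
  an approximate evaluation map tends to 0 uniformly. Near \<open>\<xi>\<close> it is injective, and a change of
  variables combined with the Schwarz--Pick inequality bounds the upper limit of
  \<open>\<parallel>S\<^sub>t f\<^sub>n\<parallel>\<close> by \<open>\<bar>\<lambda>\<^sub>t\<bar>\<close>. Integrate over \<open>t\<close> with the reverse Fatou lemma.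

  Lower bound: since \<open>(\<xi> - \<phi>\<^sub>t z) / (\<xi> - z)\<close> tends to the angular derivative, \<open>S\<^sub>t f\<^sub>c - \<lambda>\<^sub>t f\<^sub>c\<close> tends
  to 0 in norm for every \<open>t\<close>. By dominated convergence the integral of \<open>S\<^sub>t f\<^sub>c\<close> is asymptotic to
  \<open>(\<integral>\<lambda>\<^sub>t dt) f\<^sub>c\<close>, and since the argument of \<open>\<lambda>\<^sub>t\<close> is constant, \<open>\<bar>\<integral>\<lambda>\<^sub>t dt\<bar> = \<integral>\<bar>\<lambda>\<^sub>t\<bar> dt\<close>.

  The operator norm is not known to be measurable in \<open>t\<close>, so the dominating function is the
  supremum of the functions \<open>\<parallel>S\<^sub>t f\<^sub>n\<parallel>\<close> over \<open>n\<close>; these are measurable because \<open>S\<^sub>t f z\<close> is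
  jointly continuous in \<open>(t, z)\<close>.\<close>

section \<open>Minkowski's integral inequality\<close>

text \<open>The number \<open>\<gamma>\<close> occurs for two reasons. In the p-th power of the
  norm, stretching by \<open>d\<close> near \<xi> costs \<open>d powr (-2)\<close> for area and
  \<open>d powr (-\<alpha>)\<close> for the weight, hence \<open>d powr (-\<gamma>)\<close> in the
  norm. It is also the exponent at which \<open>(\<xi> - z) powr (-c)\<close> leaves the space, so
  that normalising for \<open>c\<close> close to \<open>\<gamma>\<close> pushes all the mass into
  \<xi>. Elements of the space are plain functions, so vector-valued integrals are controlled
  pointwise: a norm estimate for an integral is Minkowski's integral inequality applied to point
  evaluations. What the hypotheses give is joint continuity of \<open>S t f z\<close> on the open
  disc, hence uniformity on compact parts only. Dilations by \<open>r < 1\<close> trade this for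
  uniformity on the whole disc, which is what step functions in t need. All changes of variables are
  one-sided: if a map multiplies distances by at least \<open>k\<close>, preimages have at most
  \<open>1 / k\<^sup>2\<close> times the area. This one estimate handles the symbols near \<xi>, the
  dilations, and the rotations behind the mean value inequality.\<close>

lemma powr_ge_tangent:
  fixes x m p :: real
  assumes "p \<ge> 1" "x \<ge> 0" "m \<ge> 0"
  shows "p * m powr (p - 1) * x \<le> x powr p + (p - 1) * m powr p"
proof (cases "x = 0 \<or> m = 0")
  case True
  then show ?thesis using assms by auto
next
  case False
  then have pos: "x > 0" "m > 0" using assms by auto
  \<comment> \<open>The convex function \<open>x powr p\<close> lies above its tangent at
    \<open>m\<close>. Convexity is used on the open half-line, which is why vanishing
    \<open>x\<close> or \<open>m\<close> was split off.\<close>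
  have "x powr p - m powr p \<ge> (p * m powr (p - 1)) * (x - m)"
  proof (rule convex_on_imp_above_tangent[where A = "{0<..}"])
    show "convex_on {0<..} (\<lambda>x. x powr p)" using powr_convex assms by blast
    show "m \<in> interior {0<..}" using pos by (simp add: interior_open)
    show "((\<lambda>x. x powr p) has_real_derivative p * m powr (p - 1)) (at m within {0<..})"
      using pos by (auto intro!: derivative_eq_intros)
  qed (use pos in \<open>auto simp: convex_connected\<close>)
  moreover have "m powr (p - 1) * m = m powr p"
    using pos by (simp add: powr_diff)
  then have "p * m powr (p - 1) * (x - m) = p * m powr (p - 1) * x - p * m powr p"
    by (simp add: right_diff_distrib mult.assoc)
  ultimately show ?thesis by (simp add: left_diff_distrib)
qed

text \<open>Jensen's inequality for the measure with density \<open>b / k\<close>, integrated over the second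
  variable; \<open>b\<close> is slightly larger than \<open>n\<close> so that it never vanishes.\<close>

lemma Minkowski_integral_inequality:
  fixes H :: "'a \<Rightarrow> 'b \<Rightarrow> real" and n :: "'a \<Rightarrow> real" and I :: "'b \<Rightarrow> real"
  assumes "finite_measure M" "sigma_finite_measure N" and p: "p > 1"
    and H: "(\<lambda>(t, z). H t z) \<in> borel_measurable (M \<Otimes>\<^sub>M N)"
    and H0: "\<And>t z. H t z \<ge> 0"
    and n: "n \<in> borel_measurable M" and n0: "\<And>t. n t \<ge> 0"
    and nH: "\<And>t. t \<in> space M \<Longrightarrow> (\<integral>\<^sup>+z. ennreal (H t z powr p) \<partial>N) \<le> ennreal (n t powr p)"
    and I: "I \<in> borel_measurable N" and I0: "\<And>z. I z \<ge> 0"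
    and IH: "\<And>z. z \<in> space N \<Longrightarrow> ennreal (I z) \<le> (\<integral>\<^sup>+t. ennreal (H t z) \<partial>M)"
    and K: "(\<integral>\<^sup>+t. ennreal (n t) \<partial>M) \<le> ennreal K" and K0: "K \<ge> 0"
  shows "(\<integral>\<^sup>+z. ennreal (I z powr p) \<partial>N) \<le> ennreal (K powr p)"
proof -
  interpret M: finite_measure M by fact
  interpret N: sigma_finite_measure N by fact
  interpret pair_sigma_finite M N by unfold_locales
  define m where "m = measure M (space M)"
  have m0: "m \<ge> 0" by (simp add: m_def)
  \<comment> \<open>The bound is proved for every \<open>k > K\<close>, and \<open>k\<close> tends
    to \<open>K\<close> at the end. The slack \<open>k - K\<close> pays for replacing
    \<open>n\<close> by the positive function \<open>b\<close>: adding the constant \<open>d\<close>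
    raises the integral by \<open>d * m\<close>, and the 1 in \<open>d\<close> covers a space of
    mass 0.\<close>
  have step: "(\<integral>\<^sup>+z. ennreal (I z powr p) \<partial>N) \<le> ennreal (k powr p)" if k: "k > K" for k
  proof -
    have k0: "k > 0" using k K0 by linarith
    define d where "d = (k - K) / (m + 1)"
    have d0: "d > 0" using k m0 by (simp add: d_def)
    define b where "b t = n t + d" for t
    have b0: "b t > 0" for t using d0 n0[of t] by (simp add: b_def)
    have [measurable]: "b \<in> borel_measurable M" using n unfolding b_def by measurable
    have "(\<integral>\<^sup>+t. ennreal (b t) \<partial>M) = (\<integral>\<^sup>+t. ennreal (n t) + ennreal d \<partial>M)"
      using n0 d0 by (simp add: b_def)
    also have "\<dots> = (\<integral>\<^sup>+t. ennreal (n t) \<partial>M) + ennreal d * emeasure M (space M)"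
      using n by (subst nn_integral_add) auto
    also have "\<dots> \<le> ennreal K + ennreal (d * m)"
      using K d0 m0 by (intro add_mono) (auto simp: m_def M.emeasure_eq_measure ennreal_mult)
    also have "\<dots> = ennreal (K + d * m)" using K0 d0 m0 by simp
    also have "\<dots> \<le> ennreal k"
    proof (rule ennreal_leI)
      have "d * m \<le> d * (m + 1)" using d0 by simp
      also have "\<dots> = k - K" using m0 by (simp add: d_def)
      finally show "K + d * m \<le> k" by simp
    qed
    finally have bk: "(\<integral>\<^sup>+t. ennreal (b t) \<partial>M) \<le> ennreal k" .
    have pt: "ennreal ((I z / k) powr p * k) \<le> (\<integral>\<^sup>+t. ennreal (b t powr (1 - p) * H t z powr p) \<partial>M)"
      if z: "z \<in> space N" for z
    proof -
      define a where "a = I z / k"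
      have a0: "a \<ge> 0" using I0[of z] k0 by (simp add: a_def)
      have Hz [measurable]: "(\<lambda>t. H t z) \<in> borel_measurable M"
        using measurable_Pair1[OF H z] by simp
      \<comment> \<open>Tangent inequality at \<open>a\<close> for the point
        \<open>H t z / b t\<close>, multiplied by \<open>b t\<close>. After integration over
        \<open>t\<close> the left side is at least \<open>p * a powr p * k\<close>, because
        \<open>I z = a * k\<close>, and the last term is at most
        \<open>(p - 1) * a powr p * k\<close>; the difference is
        \<open>a powr p * k\<close>.\<close>
      have "p * a powr (p - 1) * H t z \<le> b t powr (1 - p) * H t z powr p + (p - 1) * a powr p * b t" for t
      proof -
        have "p * a powr (p - 1) * (H t z / b t) * b t \<le> ((H t z / b t) powr p + (p - 1) * a powr p) * b t"
          by (rule mult_right_mono[OF powr_ge_tangent])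
             (use p H0[of t z] b0[of t] a0 in \<open>auto\<close>)
        moreover have "(H t z / b t) powr p * b t = b t powr (1 - p) * H t z powr p"
          using b0[of t] H0[of t z] by (simp add: powr_divide powr_diff)
        ultimately show ?thesis using b0[of t] by (simp add: algebra_simps)
      qed
      then have "(\<integral>\<^sup>+t. ennreal (p * a powr (p - 1) * H t z) \<partial>M)
          \<le> (\<integral>\<^sup>+t. ennreal (b t powr (1 - p) * H t z powr p) + ennreal ((p - 1) * a powr p) * ennreal (b t) \<partial>M)"
        using p b0 by (intro nn_integral_mono) (auto simp: ennreal_mult[symmetric] ennreal_plus[symmetric] less_imp_le simp del: ennreal_plus intro!: ennreal_leI)
      also have "\<dots> = (\<integral>\<^sup>+t. ennreal (b t powr (1 - p) * H t z powr p) \<partial>M) + ennreal ((p - 1) * a powr p) * (\<integral>\<^sup>+t. ennreal (b t) \<partial>M)"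
        by (subst nn_integral_add) (auto simp: nn_integral_cmult)
      also have "\<dots> \<le> (\<integral>\<^sup>+t. ennreal (b t powr (1 - p) * H t z powr p) \<partial>M) + ennreal ((p - 1) * a powr p) * ennreal k"
        using bk by (intro add_left_mono mult_left_mono) auto
      finally have 1: "(\<integral>\<^sup>+t. ennreal (p * a powr (p - 1) * H t z) \<partial>M)
        \<le> (\<integral>\<^sup>+t. ennreal (b t powr (1 - p) * H t z powr p) \<partial>M) + ennreal ((p - 1) * a powr p * k)"
        using p k0 by (simp add: ennreal_mult)
      have "ennreal (a powr p * k) + ennreal ((p - 1) * a powr p * k) = ennreal (a powr p * k + (p - 1) * a powr p * k)"
        using p k0 by (intro ennreal_plus[symmetric]) auto
      also have "a powr p * k + (p - 1) * a powr p * k = p * a powr p * k"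
        by (simp add: left_diff_distrib)
      also have "p * a powr p * k = p * a powr (p - 1) * I z"
      proof -
        have "a * a powr (p - 1) = a powr p" using powr_mult_base[OF a0, of "p - 1"] by simp
        moreover have "I z = a * k" using k0 by (simp add: a_def)
        ultimately show ?thesis by (simp add: mult_ac)
      qed
      also have "ennreal (p * a powr (p - 1) * I z) = ennreal (p * a powr (p - 1)) * ennreal (I z)"
        using p I0 by (simp add: ennreal_mult)
      also have "\<dots> \<le> ennreal (p * a powr (p - 1)) * (\<integral>\<^sup>+t. ennreal (H t z) \<partial>M)"
        using IH[OF z] by (intro mult_left_mono) auto
      also have "\<dots> = (\<integral>\<^sup>+t. ennreal (p * a powr (p - 1) * H t z) \<partial>M)"
        using p H0 by (subst nn_integral_cmult[symmetric]) (auto simp: ennreal_mult)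
      finally have 2: "ennreal (a powr p * k) + ennreal ((p - 1) * a powr p * k)
         \<le> (\<integral>\<^sup>+t. ennreal (b t powr (1 - p) * H t z powr p) \<partial>M) + ennreal ((p - 1) * a powr p * k)"
        using 1 by (rule order_trans)
      then show ?thesis unfolding a_def[symmetric]
        by (simp add: ennreal_add_left_cancel_le add.commute[of _ "ennreal ((p - 1) * a powr p * k)"])
    qed
    have Hm [measurable]: "(\<lambda>x. H (fst x) (snd x)) \<in> borel_measurable (M \<Otimes>\<^sub>M N)"
      using H by (simp add: case_prod_unfold)
    have "ennreal (k powr (1 - p)) * (\<integral>\<^sup>+z. ennreal (I z powr p) \<partial>N) = (\<integral>\<^sup>+z. ennreal ((I z / k) powr p * k) \<partial>N)"
      using I I0 k0 by (subst nn_integral_cmult[symmetric]) (auto simp: ennreal_mult[symmetric] powr_divide powr_diff intro!: nn_integral_cong)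
    also have "\<dots> \<le> (\<integral>\<^sup>+z. \<integral>\<^sup>+t. ennreal (b t powr (1 - p) * H t z powr p) \<partial>M \<partial>N)"
      by (intro nn_integral_mono pt)
    also have "\<dots> = (\<integral>\<^sup>+t. \<integral>\<^sup>+z. ennreal (b t powr (1 - p) * H t z powr p) \<partial>N \<partial>M)"
      using Fubini[of "\<lambda>x. ennreal (b (fst x) powr (1 - p) * H (fst x) (snd x) powr p)"] by simp
    also have "\<dots> \<le> (\<integral>\<^sup>+t. ennreal (b t) \<partial>M)"
    proof (rule nn_integral_mono)
      fix t assume t: "t \<in> space M"
      have [measurable]: "(\<lambda>z. H t z) \<in> borel_measurable N"
        using measurable_Pair2[OF H t] by simp
      have "(\<integral>\<^sup>+z. ennreal (b t powr (1 - p) * H t z powr p) \<partial>N) = ennreal (b t powr (1 - p)) * (\<integral>\<^sup>+z. ennreal (H t z powr p) \<partial>N)"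
        by (subst nn_integral_cmult[symmetric]) (auto simp: ennreal_mult)
      also have "\<dots> \<le> ennreal (b t powr (1 - p)) * ennreal (n t powr p)"
        using nH[OF t] by (intro mult_left_mono) auto
      also have "\<dots> \<le> ennreal (b t powr (1 - p)) * ennreal (b t powr p)"
        using n0[of t] d0 p by (intro mult_left_mono ennreal_leI powr_mono2) (auto simp: b_def)
      also have "\<dots> = ennreal (b t)"
        using b0[of t] by (simp add: ennreal_mult[symmetric] powr_diff)
      finally show "(\<integral>\<^sup>+z. ennreal (b t powr (1 - p) * H t z powr p) \<partial>N) \<le> ennreal (b t)" .
    qed
    also note bk
    \<comment> \<open>The factor \<open>k powr (p - 1)\<close> cancels \<open>k powr (1 - p)\<close>
      on the left and turns \<open>k\<close> into \<open>k powr p\<close> on the right.\<close>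
    finally have "ennreal (k powr (p - 1)) * (ennreal (k powr (1 - p)) * (\<integral>\<^sup>+z. ennreal (I z powr p) \<partial>N)) \<le> ennreal (k powr (p - 1)) * ennreal k"
      by (intro mult_left_mono) auto
    then show ?thesis
      using k0 by (simp add: mult.assoc[symmetric] ennreal_mult[symmetric] powr_add[symmetric] powr_mult_base)
         (simp add: powr_diff)
  qed
  have "eventually (\<lambda>k. 0 \<le> k) (at_right K)"
    using eventually_at_right_less[of K] by eventually_elim (use K0 in linarith)
  then have "((\<lambda>k. ennreal (k powr p)) \<longlongrightarrow> ennreal (K powr p)) (at_right K)"
    using p by (intro tendsto_ennrealI tendsto_powr' tendsto_intros) auto
  then show ?thesis
    by (rule tendsto_lowerbound)
       (auto intro!: eventually_at_right_less[THEN eventually_mono] step)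
qed

section \<open>Bergman spaces\<close>

lemma space_bergman_measure: "space (bergman_measure \<alpha>) = \<bbbD>"
  by (simp add: bergman_measure_def space_restrict_space)

lemma sets_bergman_measure: "sets (bergman_measure \<alpha>) = sets (lebesgue_on \<bbbD>)"
  by (simp add: bergman_measure_def)

definition bergman_weight :: "real \<Rightarrow> complex \<Rightarrow> real"
  where "bergman_weight \<alpha> z = (1 + \<alpha>) * (1 - (cmod z)\<^sup>2) powr \<alpha> / pi"

lemma bergman_weight_nonneg: "\<alpha> \<ge> 0 \<Longrightarrow> bergman_weight \<alpha> z \<ge> 0"
  by (simp add: bergman_weight_def)

lemma borel_measurable_bergman_weight [measurable]: "bergman_weight \<alpha> \<in> borel_measurable borel"
  unfolding bergman_weight_def[abs_def] by measurable

lemma measurable_bergman_measure_iff: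
  "f \<in> measurable (bergman_measure \<alpha>) N \<longleftrightarrow> f \<in> measurable (lebesgue_on \<bbbD>) N"
  using measurable_cong_sets[OF sets_bergman_measure[of \<alpha>] refl[of "sets N"]] by simp

lemma continuous_on_imp_measurable_bergman:
  "continuous_on \<bbbD> f \<Longrightarrow> f \<in> borel_measurable (bergman_measure \<alpha>)"
  unfolding measurable_bergman_measure_iff
  by (rule continuous_imp_measurable_on_sets_lebesgue) auto

lemma measurable_ident_bergman: "(\<lambda>x. x) \<in> measurable (bergman_measure \<alpha>) borel"
  by (intro continuous_on_imp_measurable_bergman continuous_intros)

text \<open>Moves integrals to Borel Lebesgue measure, where the area estimates are stated. The
  integrand is only Lebesgue measurable, but completing a measure does not change the value of a
  nonnegative integral.\<close>

lemma nn_integral_bergman_measure: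
  assumes "f \<in> borel_measurable (bergman_measure \<alpha>)"
  shows "(\<integral>\<^sup>+z. f z \<partial>bergman_measure \<alpha>)
    = (\<integral>\<^sup>+z. ennreal (bergman_weight \<alpha> z) * f z * indicator \<bbbD> z \<partial>lborel)"
proof -
  have [measurable]: "bergman_weight \<alpha> \<in> borel_measurable (lebesgue_on \<bbbD>)"
    using borel_measurable_bergman_weight
    by (auto intro!: measurable_restrict_space1 measurable_completion)
  have "(\<integral>\<^sup>+z. f z \<partial>bergman_measure \<alpha>) = (\<integral>\<^sup>+z. ennreal (bergman_weight \<alpha> z) * f z \<partial>lebesgue_on \<bbbD>)"
    unfolding bergman_measure_def bergman_weight_def[symmetric] using assms
    by (intro nn_integral_density) (auto simp: measurable_bergman_measure_iff)
  also have "\<dots> = (\<integral>\<^sup>+z. ennreal (bergman_weight \<alpha> z) * f z * indicator \<bbbD> z \<partial>lebesgue)"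
    by (subst nn_integral_restrict_space) auto
  finally show ?thesis by (simp add: nn_integral_completion)
qed

lemma finite_measure_bergman:
  assumes "\<alpha> \<ge> 0"
  shows "finite_measure (bergman_measure \<alpha>)"
proof (rule finite_measureI)
  have "emeasure (bergman_measure \<alpha>) \<bbbD> = (\<integral>\<^sup>+z. 1 \<partial>bergman_measure \<alpha>)"
    by (simp add: space_bergman_measure)
  also have "\<dots> = (\<integral>\<^sup>+z. ennreal (bergman_weight \<alpha> z) * indicator \<bbbD> z \<partial>lborel)"
    by (subst nn_integral_bergman_measure) auto
  also have "\<dots> \<le> (\<integral>\<^sup>+z. ennreal ((1 + \<alpha>) / pi) * indicator \<bbbD> (z::complex) \<partial>lborel)"
  proof (rule nn_integral_mono)
    fix z :: complex
    have "bergman_weight \<alpha> z \<le> (1 + \<alpha>) / pi" if "z \<in> \<bbbD>"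
    proof -
      have "(cmod z)\<^sup>2 \<le> 1" using that by (simp add: abs_square_le_1)
      then have "(1 - (cmod z)\<^sup>2) powr \<alpha> \<le> 1"
        using assms by (intro powr_le1) auto
      then show ?thesis using assms unfolding bergman_weight_def
        by (intro divide_right_mono) (auto intro: mult_left_le)
    qed
    then show "ennreal (bergman_weight \<alpha> z) * indicator \<bbbD> z \<le> ennreal ((1 + \<alpha>) / pi) * indicator \<bbbD> z"
      by (auto simp: indicator_def intro: ennreal_leI)
  qed
  also have "\<dots> = ennreal ((1 + \<alpha>) / pi) * emeasure lborel \<bbbD>"
    by (rule nn_integral_cmult_indicator) simp
  also have "\<dots> < \<infinity>"
    using emeasure_lborel_ball_finite[of "0::complex" 1] by (simp add: ennreal_mult_less_top)
  finally show "emeasure (bergman_measure \<alpha>) (space (bergman_measure \<alpha>)) \<noteq> \<infinity>"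
    by (simp add: space_bergman_measure)
qed

text \<open>The p-th power of the norm as an extended number. Its finiteness decides membership in
  the space, whereas \<open>bergman_norm\<close> takes the default value 0 when the integral
  diverges.\<close>

definition bergman_pow :: "real \<Rightarrow> real \<Rightarrow> (complex \<Rightarrow> complex) \<Rightarrow> ennreal"
  where "bergman_pow p \<alpha> f = (\<integral>\<^sup>+z. ennreal (cmod (f z) powr p) \<partial>bergman_measure \<alpha>)"

lemma bergman_norm_nonneg: "bergman_norm p \<alpha> f \<ge> 0"
  by (simp add: bergman_norm_def)

lemma borel_measurable_holomorphic_bergman:
  "f holomorphic_on \<bbbD> \<Longrightarrow> f \<in> borel_measurable (bergman_measure \<alpha>)"
  by (simp add: continuous_on_imp_measurable_bergman holomorphic_on_imp_continuous_on)

lemma bergman_space_iff: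
  "f \<in> bergman_space p \<alpha> \<longleftrightarrow> f holomorphic_on \<bbbD> \<and> bergman_pow p \<alpha> f < \<infinity>"
  using borel_measurable_holomorphic_bergman[of f \<alpha>]
  by (auto simp: bergman_space_def bergman_pow_def integrable_iff_bounded)

lemma bergman_space_holomorphic: "f \<in> bergman_space p \<alpha> \<Longrightarrow> f holomorphic_on \<bbbD>"
  by (simp add: bergman_space_def)

lemma bergman_space_continuous: "f \<in> bergman_space p \<alpha> \<Longrightarrow> continuous_on \<bbbD> f"
  by (simp add: bergman_space_def holomorphic_on_imp_continuous_on)

lemma bergman_space_measurable: "f \<in> bergman_space p \<alpha> \<Longrightarrow> f \<in> borel_measurable (bergman_measure \<alpha>)"
  by (simp add: bergman_space_continuous continuous_on_imp_measurable_bergman)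

lemma bergman_pow_eq_norm:
  assumes "f \<in> bergman_space p \<alpha>" "p > 1"
  shows "bergman_pow p \<alpha> f = ennreal (bergman_norm p \<alpha> f powr p)"
proof -
  have "integrable (bergman_measure \<alpha>) (\<lambda>z. cmod (f z) powr p)"
    using assms by (simp add: bergman_space_def)
  then have "bergman_pow p \<alpha> f = ennreal (LINT z|bergman_measure \<alpha>. cmod (f z) powr p)"
    unfolding bergman_pow_def by (rule nn_integral_eq_integral) auto
  moreover have "(LINT z|bergman_measure \<alpha>. cmod (f z) powr p) \<ge> 0" by simp
  ultimately show ?thesis using assms(2) by (simp add: bergman_norm_def powr_powr)
qed

lemma bergman_norm_eq_pow:
  assumes "f holomorphic_on \<bbbD>"
  shows "bergman_norm p \<alpha> f = enn2real (bergman_pow p \<alpha> f) powr (1 / p)"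
  using borel_measurable_holomorphic_bergman[OF assms, of \<alpha>]
  unfolding bergman_norm_def bergman_pow_def by (subst integral_eq_nn_integral) auto

lemma bergman_leI:
  assumes "f holomorphic_on \<bbbD>" "K \<ge> 0" "p > 1" "bergman_pow p \<alpha> f \<le> ennreal (K powr p)"
  shows "f \<in> bergman_space p \<alpha>" "bergman_norm p \<alpha> f \<le> K"
proof -
  show 1: "f \<in> bergman_space p \<alpha>"
    using assms by (auto simp: bergman_space_iff intro: le_less_trans)
  have "bergman_norm p \<alpha> f powr p \<le> K powr p"
    using bergman_pow_eq_norm[OF 1] assms by simp
  then show "bergman_norm p \<alpha> f \<le> K"
    using assms bergman_norm_nonneg[of p \<alpha> f] powr_less_mono2[of p K "bergman_norm p \<alpha> f"]
    by (meson less_le_trans not_le_imp_less less_irrefl less_trans zero_less_one)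
qed

lemma bergman_zero:
  assumes "p > 1"
  shows "(\<lambda>z. 0) \<in> bergman_space p \<alpha>" "bergman_norm p \<alpha> (\<lambda>z. 0) = 0"
  using assms by (auto simp: bergman_space_iff bergman_norm_def bergman_pow_def)

lemma bergman_scale:
  assumes f: "f \<in> bergman_space p \<alpha>" and p: "p > 1"
  shows "(\<lambda>z. c * f z) \<in> bergman_space p \<alpha>"
    and "bergman_norm p \<alpha> (\<lambda>z. c * f z) = cmod c * bergman_norm p \<alpha> f"
proof -
  note [measurable] = bergman_space_measurable[OF f]
  have hol: "(\<lambda>z. c * f z) holomorphic_on \<bbbD>"
    using bergman_space_holomorphic[OF f] by (intro holomorphic_intros)
  have pow: "bergman_pow p \<alpha> (\<lambda>z. c * f z) = ennreal ((cmod c * bergman_norm p \<alpha> f) powr p)"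
  proof -
    have "bergman_pow p \<alpha> (\<lambda>z. c * f z) = ennreal (cmod c powr p) * bergman_pow p \<alpha> f"
      unfolding bergman_pow_def
      by (subst nn_integral_cmult[symmetric]) (auto simp: norm_mult powr_mult ennreal_mult[symmetric])
    then show ?thesis
      using bergman_pow_eq_norm[OF f p] by (simp add: ennreal_mult[symmetric] powr_mult bergman_norm_nonneg)
  qed
  show 1: "(\<lambda>z. c * f z) \<in> bergman_space p \<alpha>"
    using hol pow by (simp add: bergman_space_iff)
  show "bergman_norm p \<alpha> (\<lambda>z. c * f z) = cmod c * bergman_norm p \<alpha> f"
    using p pow unfolding bergman_norm_eq_pow[OF hol] by (simp add: powr_powr bergman_norm_nonneg)
qed

text \<open>The triangle inequality is Minkowski's integral inequality for counting measure on the
  two-point set \<open>bool\<close>.\<close>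

lemma bergman_add:
  assumes f: "f \<in> bergman_space p \<alpha>" and g: "g \<in> bergman_space p \<alpha>" and p: "p > 1" and a: "\<alpha> \<ge> 0"
  shows "(\<lambda>z. f z + g z) \<in> bergman_space p \<alpha>"
    and "bergman_norm p \<alpha> (\<lambda>z. f z + g z) \<le> bergman_norm p \<alpha> f + bergman_norm p \<alpha> g"
proof -
  note [measurable] = bergman_space_measurable[OF f] bergman_space_measurable[OF g]
  interpret finite_measure "bergman_measure \<alpha>" by (rule finite_measure_bergman[OF a])
  let ?M = "count_space (UNIV :: bool set)"
  interpret M: finite_measure ?M by (rule finite_measure_count_space) simp
  define H where "H t z = cmod (if t then f z else g z)" for t z
  define n where "n t = bergman_norm p \<alpha> (if t then f else g)" for t
  have "(\<integral>\<^sup>+z. ennreal (cmod (f z + g z) powr p) \<partial>bergman_measure \<alpha>)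
    \<le> ennreal ((bergman_norm p \<alpha> f + bergman_norm p \<alpha> g) powr p)"
  proof (rule Minkowski_integral_inequality[where M = ?M and H = H and n = n])
    show "(\<lambda>(t, z). H t z) \<in> borel_measurable (?M \<Otimes>\<^sub>M bergman_measure \<alpha>)"
      by (rule measurable_pair_measure_countable1) (auto simp: H_def)
    show "(\<integral>\<^sup>+z. ennreal (H t z powr p) \<partial>bergman_measure \<alpha>) \<le> ennreal (n t powr p)" for t
      using bergman_pow_eq_norm[OF f p] bergman_pow_eq_norm[OF g p]
      by (cases t) (simp_all add: H_def n_def bergman_pow_def)
    show "ennreal (cmod (f z + g z)) \<le> (\<integral>\<^sup>+t. ennreal (H t z) \<partial>?M)" for z
      using norm_triangle_ineq[of "f z" "g z"]
      by (subst nn_integral_count_space_finite)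
         (auto simp: H_def UNIV_bool add.commute ennreal_plus[symmetric] simp del: ennreal_plus intro!: ennreal_leI)
    show "(\<integral>\<^sup>+t. ennreal (n t) \<partial>?M) \<le> ennreal (bergman_norm p \<alpha> f + bergman_norm p \<alpha> g)"
      by (subst nn_integral_count_space_finite)
         (auto simp: n_def UNIV_bool bergman_norm_nonneg add.commute)
  qed (use p in \<open>auto simp: n_def H_def bergman_norm_nonneg M.sigma_finite_measure_axioms sigma_finite_measure_axioms M.finite_measure_axioms\<close>)
  then have *: "bergman_pow p \<alpha> (\<lambda>z. f z + g z) \<le> ennreal ((bergman_norm p \<alpha> f + bergman_norm p \<alpha> g) powr p)"
    by (simp add: bergman_pow_def)
  have hol: "(\<lambda>z. f z + g z) holomorphic_on \<bbbD>"
    using f g by (intro holomorphic_intros bergman_space_holomorphic)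
  show "(\<lambda>z. f z + g z) \<in> bergman_space p \<alpha>"
    and "bergman_norm p \<alpha> (\<lambda>z. f z + g z) \<le> bergman_norm p \<alpha> f + bergman_norm p \<alpha> g"
    using bergman_leI[OF hol _ p *] by (auto simp: bergman_norm_nonneg)
qed

lemma bergman_diff:
  assumes f: "f \<in> bergman_space p \<alpha>" and g: "g \<in> bergman_space p \<alpha>" and p: "p > 1" and a: "\<alpha> \<ge> 0"
  shows "(\<lambda>z. f z - g z) \<in> bergman_space p \<alpha>"
    and "bergman_norm p \<alpha> (\<lambda>z. f z - g z) \<le> bergman_norm p \<alpha> f + bergman_norm p \<alpha> g"
    and "bergman_norm p \<alpha> f \<le> bergman_norm p \<alpha> (\<lambda>z. f z - g z) + bergman_norm p \<alpha> g"
proof -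
  have m: "(\<lambda>z. - 1 * g z) \<in> bergman_space p \<alpha>" "bergman_norm p \<alpha> (\<lambda>z. - 1 * g z) = bergman_norm p \<alpha> g"
    using bergman_scale[OF g p, of "-1"] by auto
  show 1: "(\<lambda>z. f z - g z) \<in> bergman_space p \<alpha>"
    and "bergman_norm p \<alpha> (\<lambda>z. f z - g z) \<le> bergman_norm p \<alpha> f + bergman_norm p \<alpha> g"
    using bergman_add[OF f m(1) p a] m(2) by simp_all
  show "bergman_norm p \<alpha> f \<le> bergman_norm p \<alpha> (\<lambda>z. f z - g z) + bergman_norm p \<alpha> g"
    using bergman_add(2)[OF 1 g p a] by simp
qed

lemma bergman_norm_diff_commute:
  "bergman_norm p \<alpha> (\<lambda>z. f z - g z) = bergman_norm p \<alpha> (\<lambda>z. g z - f z)"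
  by (simp add: bergman_norm_def norm_minus_commute)

section \<open>Expansive maps and area\<close>

text \<open>Countable subadditivity with the sum written as an integral over
  \<open>count_space I\<close>, so that a covering can be indexed directly by its pairs of centre
  and radius.\<close>

lemma emeasure_UN_countable_le:
  assumes I: "countable I" and X: "\<And>i. i \<in> I \<Longrightarrow> X i \<in> sets M"
  shows "emeasure M (\<Union>(X ` I)) \<le> (\<integral>\<^sup>+i. emeasure M (X i) \<partial>count_space I)"
proof -
  have "\<Union>(X ` I) \<in> sets M" using I X by auto
  then have "emeasure M (\<Union>(X ` I)) = (\<integral>\<^sup>+x. indicator (\<Union>(X ` I)) x \<partial>M)" by simp
  also have "\<dots> \<le> (\<integral>\<^sup>+x. \<integral>\<^sup>+i. indicator (X i) x \<partial>count_space I \<partial>M)"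
  proof (rule nn_integral_mono)
    fix x show "indicator (\<Union>(X ` I)) x \<le> (\<integral>\<^sup>+i. indicator (X i) x \<partial>count_space I :: ennreal)"
    proof (cases "x \<in> \<Union>(X ` I)")
      case True
      then obtain i where i: "i \<in> I" "x \<in> X i" by blast
      then show ?thesis using nn_integral_ge_point[OF i(1), of "\<lambda>i. indicator (X i) x"] True by simp
    qed simp
  qed
  also have "\<dots> = (\<integral>\<^sup>+i. \<integral>\<^sup>+x. indicator (X i) x \<partial>M \<partial>count_space I)"
    by (rule nn_integral_count_space_nn_integral) (use I X in auto)
  also have "\<dots> = (\<integral>\<^sup>+i. emeasure M (X i) \<partial>count_space I)"
    using X by (intro nn_integral_cong) auto
  finally show ?thesis .
qed

text \<open>The inverse of \<phi> on the image of \<open>B\<close> is Lipschitz with constant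
  \<open>1 / k\<close>, and Lipschitz maps carry null sets to null sets.\<close>

lemma negligible_expansive_vimage:
  fixes \<phi> :: "complex \<Rightarrow> complex"
  assumes k: "k > 0" and low: "\<And>z w. z \<in> B \<Longrightarrow> w \<in> B \<Longrightarrow> k * cmod (z - w) \<le> cmod (\<phi> z - \<phi> w)"
    and N: "negligible N"
  shows "negligible (B \<inter> \<phi> -` N)"
proof -
  have inj: "inj_on \<phi> B"
    using k low by (auto simp: inj_on_def) (metis diff_self mult_le_0_iff norm_eq_zero norm_le_zero_iff norm_zero not_le right_minus_eq)
  define \<psi> where "\<psi> = the_inv_into B \<phi>"
  have inv: "\<psi> (\<phi> z) = z" if "z \<in> B" for z
    using the_inv_into_f_f[OF inj that] by (simp add: \<psi>_def)
  have eq: "B \<inter> \<phi> -` N = \<psi> ` (N \<inter> \<phi> ` B)"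
    using inv by force
  show ?thesis unfolding eq
  proof (rule negligible_locally_Lipschitz_image)
    show "negligible (N \<inter> \<phi> ` B)" using N by (auto intro: negligible_subset)
    show "\<exists>T K. open T \<and> x \<in> T \<and> (\<forall>y\<in>N \<inter> \<phi> ` B \<inter> T. norm (\<psi> y - \<psi> x) \<le> K * norm (y - x))"
      if "x \<in> N \<inter> \<phi> ` B" for x
    proof (intro exI conjI ballI)
      show "open (UNIV :: complex set)" "x \<in> UNIV" by auto
      fix y assume "y \<in> N \<inter> \<phi> ` B \<inter> UNIV"
      then obtain a b where "a \<in> B" "b \<in> B" "x = \<phi> a" "y = \<phi> b" using \<open>x \<in> N \<inter> \<phi> ` B\<close> by auto
      then show "norm (\<psi> y - \<psi> x) \<le> (1 / k) * norm (y - x)"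
        using low[of b a] k inv by (simp add: field_simps)
    qed
  qed simp
qed

lemma emeasure_ball_scale:
  assumes "k > 0" "r \<ge> 0"
  shows "emeasure lborel (ball (c::complex) (r / k)) = ennreal (1 / k\<^sup>2) * emeasure lborel (ball (d::complex) r)"
  using assms by (simp add: emeasure_ball unit_ball_vol_2 ennreal_mult[symmetric] power_divide field_simps)

text \<open>By Vitali's theorem the open set \<open>U \<inter> \<phi> ` B\<close> is a disjoint union of balls up to a null set,
  and the preimage of a ball of radius \<open>r\<close> lies in a ball of radius \<open>r / k\<close>.\<close>

lemma emeasure_expansive_vimage_open:
  fixes \<phi> :: "complex \<Rightarrow> complex"
  assumes B: "open B" and cont: "continuous_on B \<phi>" and im: "open (\<phi> ` B)"
    and k: "k > 0" and low: "\<And>z w. z \<in> B \<Longrightarrow> w \<in> B \<Longrightarrow> k * cmod (z - w) \<le> cmod (\<phi> z - \<phi> w)"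
    and U: "open U"
  shows "emeasure lborel (B \<inter> \<phi> -` U) \<le> ennreal (1 / k\<^sup>2) * emeasure lborel U"
proof -
  define V where "V = U \<inter> \<phi> ` B"
  have V: "open V" using U im by (auto simp: V_def)
  let ?K = "{(c, r). 0 < r \<and> ball c r \<subseteq> V}"
  obtain C where C: "countable C" "C \<subseteq> ?K"
     and disj: "pairwise (\<lambda>i j. disjnt (ball (fst i) (snd i)) (ball (fst j) (snd j))) C"
     and neg: "negligible (V - (\<Union>i \<in> C. ball (fst i) (snd i)))"
  proof (rule Vitali_covering_theorem_balls[of V ?K fst snd])
    fix x and d :: real assume x: "x \<in> V" and d: "0 < d"
    obtain e where e: "e > 0" "ball x e \<subseteq> V" using V x by (meson openE)
    \<comment> \<open>Vitali's theorem asks for members of the family around each point of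
      \<open>V\<close> with radius below any given \<open>d\<close>.\<close>
    show "\<exists>i. i \<in> ?K \<and> x \<in> ball (fst i) (snd i) \<and> snd i < d"
    proof (intro exI conjI)
      have "ball x (min e (d/2)) \<subseteq> ball x e" by auto
      then have "ball x (min e (d/2)) \<subseteq> V" using e(2) by blast
      then show "(x, min e (d/2)) \<in> ?K" using d e by auto
    qed (use d e in auto)
  qed blast
  define N where "N = V - (\<Union>i \<in> C. ball (fst i) (snd i))"
  \<comment> \<open>The centre of a ball of the covering lies in \<open>V\<close>, hence is
    \<open>\<phi> a\<close> for some \<open>a\<close> in \<open>B\<close>; expansion confines the
    preimage to a ball around \<open>a\<close>.\<close>
  have "\<exists>a. B \<inter> \<phi> -` ball (fst i) (snd i) \<subseteq> ball a (snd i / k)" if "i \<in> C" for i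
  proof -
    have "0 < snd i" "ball (fst i) (snd i) \<subseteq> V" using that C by (cases i; auto)+
    then have "fst i \<in> V" by auto
    then obtain a where a: "a \<in> B" "fst i = \<phi> a" by (auto simp: V_def)
    have "z \<in> ball a (snd i / k)" if "z \<in> B" "\<phi> z \<in> ball (fst i) (snd i)" for z
      using low[OF a(1) that(1)] that a k by (auto simp: dist_norm field_simps)
    then show ?thesis by blast
  qed
  then obtain a where a: "\<And>i. i \<in> C \<Longrightarrow> B \<inter> \<phi> -` ball (fst i) (snd i) \<subseteq> ball (a i) (snd i / k)" by metis
  have negN: "negligible (B \<inter> \<phi> -` N)"
    using negligible_expansive_vimage[OF k low] neg unfolding N_def by blast
  have sub: "B \<inter> \<phi> -` U \<subseteq> (B \<inter> \<phi> -` N) \<union> (\<Union>i\<in>C. ball (a i) (snd i / k))"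
  proof
    fix z assume z: "z \<in> B \<inter> \<phi> -` U"
    show "z \<in> (B \<inter> \<phi> -` N) \<union> (\<Union>i\<in>C. ball (a i) (snd i / k))"
    proof (cases "\<phi> z \<in> N")
      case False
      then obtain i where "i \<in> C" "\<phi> z \<in> ball (fst i) (snd i)"
        using z by (auto simp: N_def V_def)
      then show ?thesis using a z by blast
    qed (use z in auto)
  qed
  have pre: "open (B \<inter> \<phi> -` U)" by (rule continuous_open_preimage[OF cont B U])
  have UN: "open (\<Union>i\<in>C. ball (a i) (snd i / k))" by auto
  have "emeasure lborel (B \<inter> \<phi> -` U) = emeasure lebesgue (B \<inter> \<phi> -` U)"
    using pre by simp
  also have "\<dots> \<le> emeasure lebesgue ((B \<inter> \<phi> -` N) \<union> (\<Union>i\<in>C. ball (a i) (snd i / k)))"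
    using negligible_imp_sets[OF negN] UN by (intro emeasure_mono[OF sub]) auto
  also have "\<dots> \<le> emeasure lebesgue (B \<inter> \<phi> -` N) + emeasure lebesgue (\<Union>i\<in>C. ball (a i) (snd i / k))"
    using negligible_imp_sets[OF negN] UN by (intro emeasure_subadditive) auto
  also have "emeasure lebesgue (B \<inter> \<phi> -` N) = 0"
    using negN by (simp add: negligible_iff_null_sets null_setsD1)
  also have "0 + emeasure lebesgue (\<Union>i\<in>C. ball (a i) (snd i / k)) = emeasure lborel (\<Union>i\<in>C. ball (a i) (snd i / k))"
    using UN by simp
  \<comment> \<open>The balls around the points \<open>a i\<close> may overlap, so only
    subadditivity applies to them. The balls of the covering are disjoint, which gives the equality
    further down.\<close>
  also have "\<dots> \<le> (\<integral>\<^sup>+i. emeasure lborel (ball (a i) (snd i / k)) \<partial>count_space C)"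
    by (rule emeasure_UN_countable_le) (auto simp: C)
  also have "\<dots> = (\<integral>\<^sup>+i. ennreal (1 / k\<^sup>2) * emeasure lborel (ball (fst i) (snd i)) \<partial>count_space C)"
    using C(2) k by (intro nn_integral_cong emeasure_ball_scale) auto
  also have "\<dots> = ennreal (1 / k\<^sup>2) * (\<integral>\<^sup>+i. emeasure lborel (ball (fst i) (snd i)) \<partial>count_space C)"
    by (rule nn_integral_cmult) simp
  also have "(\<integral>\<^sup>+i. emeasure lborel (ball (fst i) (snd i)) \<partial>count_space C) = emeasure lborel (\<Union>i\<in>C. ball (fst i) (snd i))"
  proof (rule emeasure_UN_countable[symmetric])
    show "disjoint_family_on (\<lambda>i. ball (fst i) (snd i)) C"
      using disj by (auto simp: disjoint_family_on_def pairwise_def disjnt_def)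
  qed (auto simp: C)
  also have "\<dots> \<le> emeasure lborel U"
  proof (rule emeasure_mono)
    have "ball (fst i) (snd i) \<subseteq> V" if "i \<in> C" for i using C(2) that by (cases i) auto
    then show "(\<Union>i\<in>C. ball (fst i) (snd i)) \<subseteq> U" unfolding V_def by blast
  qed (use U in simp)
  finally show ?thesis by (simp add: mult_left_mono)
qed

text \<open>Outer regularity carries the estimate from open sets to Borel sets.\<close>

lemma emeasure_expansive_vimage:
  fixes \<phi> :: "complex \<Rightarrow> complex"
  assumes B: "open B" and cont: "continuous_on B \<phi>" and im: "open (\<phi> ` B)"
    and k: "k > 0" and low: "\<And>z w. z \<in> B \<Longrightarrow> w \<in> B \<Longrightarrow> k * cmod (z - w) \<le> cmod (\<phi> z - \<phi> w)"
    and E: "E \<in> sets borel"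
  shows "emeasure lborel (B \<inter> \<phi> -` E) \<le> ennreal (1 / k\<^sup>2) * emeasure lborel E"
proof (rule ennreal_le_epsilon)
  fix e :: real assume e: "e > 0"
  \<comment> \<open>The tolerance \<open>e * k\<^sup>2\<close> becomes \<open>e\<close> after
    multiplication by \<open>1 / k\<^sup>2\<close>.\<close>
  obtain U where U: "open U" "E \<subseteq> U" "emeasure lborel (U - E) < ennreal (e * k\<^sup>2)"
    using outer_regular_lborel[OF E, of "e * k\<^sup>2"] e k by auto
  have "emeasure lborel (B \<inter> \<phi> -` E) \<le> emeasure lborel (B \<inter> \<phi> -` U)"
    using U(2) continuous_open_preimage[OF cont B U(1)] by (intro emeasure_mono) auto
  also have "\<dots> \<le> ennreal (1 / k\<^sup>2) * emeasure lborel U"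
    by (rule emeasure_expansive_vimage_open[OF B cont im k low U(1)])
  also have "U = E \<union> (U - E)" using U by auto
  also have "ennreal (1 / k\<^sup>2) * emeasure lborel (E \<union> (U - E))
      \<le> ennreal (1 / k\<^sup>2) * (emeasure lborel E + ennreal (e * k\<^sup>2))"
    using U E by (intro mult_left_mono order_trans[OF emeasure_subadditive] add_mono) auto
  also have "\<dots> = ennreal (1 / k\<^sup>2) * emeasure lborel E + ennreal e"
    using e k by (simp add: distrib_left ennreal_mult[symmetric])
  finally show "emeasure lborel (B \<inter> \<phi> -` E) \<le> ennreal (1 / k\<^sup>2) * emeasure lborel E + ennreal e" .
qed

text \<open>A one-sided change of variables: by the estimate for sets, the push-forward of area
  under \<phi> is at most \<open>1 / k\<^sup>2\<close> times area, and an inequality of measures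
  passes to integrals.\<close>

lemma nn_integral_expansive_le:
  fixes \<phi> :: "complex \<Rightarrow> complex" and g :: "complex \<Rightarrow> ennreal"
  assumes B: "open B" and cont: "continuous_on B \<phi>" and im: "open (\<phi> ` B)"
    and k: "k > 0" and low: "\<And>z w. z \<in> B \<Longrightarrow> w \<in> B \<Longrightarrow> k * cmod (z - w) \<le> cmod (\<phi> z - \<phi> w)"
    and g [measurable]: "g \<in> borel_measurable borel"
  shows "(\<integral>\<^sup>+z. g (\<phi> z) * indicator B z \<partial>lborel) \<le> ennreal (1 / k\<^sup>2) * (\<integral>\<^sup>+w. g w \<partial>lborel)"
proof -
  have [measurable]: "\<phi> \<in> borel_measurable (restrict_space lborel B)"
    using borel_measurable_continuous_on_restrict[OF cont]
    by (simp cong: measurable_cong_sets add: sets_restrict_space)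
  let ?N = "distr (restrict_space lborel B) borel \<phi>"
  have em: "emeasure ?N E \<le> ennreal (1 / k\<^sup>2) * emeasure lborel E" if E: "E \<in> sets borel" for E
  proof -
    have "emeasure ?N E = emeasure (restrict_space lborel B) (\<phi> -` E \<inter> B)"
      using E by (subst emeasure_distr) (auto simp: space_restrict_space)
    also have "\<dots> = emeasure lborel (B \<inter> \<phi> -` E)"
      using B by (subst emeasure_restrict_space) (auto simp: Int_commute)
    finally show ?thesis using emeasure_expansive_vimage[OF B cont im k low E] by simp
  qed
  have "(\<integral>\<^sup>+z. g (\<phi> z) * indicator B z \<partial>lborel) = (\<integral>\<^sup>+z. g (\<phi> z) \<partial>restrict_space lborel B)"
    using B by (subst nn_integral_restrict_space) auto
  also have "\<dots> = (\<integral>\<^sup>+w. g w \<partial>?N)"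
    by (subst nn_integral_distr) auto
  also have "\<dots> \<le> (\<integral>\<^sup>+w. g w \<partial>scale_measure (ennreal (1 / k\<^sup>2)) lborel)"
    by (rule nn_integral_mono_measure) (use em in \<open>auto simp: le_measure le_fun_def emeasure_notin_sets\<close>)
  also have "\<dots> = ennreal (1 / k\<^sup>2) * (\<integral>\<^sup>+w. g w \<partial>lborel)"
    by (rule nn_integral_scale_measure) simp
  finally show ?thesis .
qed

section \<open>Point evaluations\<close>

text \<open>Cauchy's formula at the centre. The circle is given by one of its points
  \<open>v\<close>, not by its radius, so that the bound can afterwards be integrated over
  \<open>v\<close> in a disc.\<close>

lemma holomorphic_circle_mean_le:
  assumes h: "h holomorphic_on ball w R" and v: "cmod v < R"
  shows "ennreal (cmod (h w)) \<le> (\<integral>\<^sup>+x. indicator {0..1} x * ennreal (cmod (h (w + v * cis (2 * pi * x)))) \<partial>lborel)"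
proof -
  define h1 where "h1 z = h (w + v * z)" for z
  have hol: "h1 holomorphic_on cball 0 1"
    unfolding h1_def
  proof (rule holomorphic_on_compose_gen[OF _ h, unfolded o_def])
    show "(\<lambda>z. w + v * z) ` cball 0 1 \<subseteq> ball w R"
    proof (rule image_subsetI)
      fix z :: complex assume "z \<in> cball 0 1"
      then have "cmod v * cmod z \<le> cmod v * 1" by (intro mult_left_mono) auto
      then show "w + v * z \<in> ball w R" using v by (simp add: dist_norm norm_mult)
    qed
  qed (intro holomorphic_intros)
  have "((\<lambda>u. h1 u / (u - 0)) has_contour_integral 2 * pi * \<i> * h1 0) (circlepath 0 1)"
    using Cauchy_integral_circlepath_simple[OF hol, of 0] by simp
  moreover have "circlepath 0 1 x = cis (2 * pi * x)" for x
    by (simp add: circlepath cis_conv_exp mult_ac)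
  moreover have "vector_derivative (circlepath 0 1) (at x) = 2 * pi * \<i> * cis (2 * pi * x)" for x
    by (simp add: vector_derivative_circlepath cis_conv_exp mult_ac)
  \<comment> \<open>On the unit circle \<open>du / u\<close> is \<open>2 * pi * \<i> dx\<close>, so
    the constant \<open>c\<close> appears on both sides and divides out.\<close>
  moreover define c where "c = 2 * pi * \<i>"
  moreover have c: "c \<noteq> 0" by (simp add: c_def)
  ultimately have "((\<lambda>x. c * h1 (cis (2 * pi * x))) has_integral c * h1 0) {0..1}"
    by (simp add: has_contour_integral) (simp add: mult_ac)
  from has_integral_mult_right[OF this, of "inverse c"]
  have I: "((\<lambda>x. h1 (cis (2 * pi * x))) has_integral h1 0) {0..1}"
    using c by (simp add: mult.assoc[symmetric])
  have cont: "continuous_on {0..1} (\<lambda>x. h1 (cis (2 * pi * x)))"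
    by (rule continuous_on_compose2[OF holomorphic_on_imp_continuous_on[OF hol]])
       (auto intro!: continuous_intros)
  have int: "(\<lambda>x. cmod (h1 (cis (2 * pi * x)))) integrable_on {0..1}"
    by (intro integrable_continuous_interval continuous_on_norm cont)
  have "cmod (h1 0) \<le> integral {0..1} (\<lambda>x. cmod (h1 (cis (2 * pi * x))))"
    using integral_norm_bound_integral[OF has_integral_integrable[OF I] int] integral_unique[OF I] by simp
  then have "ennreal (cmod (h1 0)) \<le> ennreal (integral {0..1} (\<lambda>x. cmod (h1 (cis (2 * pi * x)))))"
    by (rule ennreal_leI)
  also have "\<dots> = (\<integral>\<^sup>+x. ennreal (indicator {0..1} x * cmod (h1 (cis (2 * pi * x)))) \<partial>lborel)"
    using nn_integral_has_integral_lebesgue[OF _ integrable_integral[OF int]] by simp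
  also have "\<dots> = (\<integral>\<^sup>+x. indicator {0..1} x * ennreal (cmod (h1 (cis (2 * pi * x)))) \<partial>lborel)"
    by (intro nn_integral_cong) (auto simp: indicator_def)
  finally show ?thesis by (simp add: h1_def)
qed

text \<open>Averaging the mean value inequality over the circles centred at \<open>w\<close>: by rotation invariance
  no polar coordinates are needed.\<close>

lemma holomorphic_disc_mean_le:
  assumes h: "h holomorphic_on ball w R" and r: "0 < r" "r < R"
  shows "ennreal (cmod (h w)) * emeasure lborel (ball w r)
    \<le> (\<integral>\<^sup>+z. ennreal (cmod (h z)) * indicator (ball w r) z \<partial>lborel)"
proof -
  define g where "g z = indicator (ball w r) z * ennreal (cmod (h z))" for z
  have cont: "continuous_on (ball w r) h"
    by (rule continuous_on_subset[OF holomorphic_on_imp_continuous_on[OF h]]) (use r in auto)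
  have "(\<lambda>z. indicator (ball w r) z *\<^sub>R h z) \<in> borel_measurable borel"
    by (rule borel_measurable_continuous_on_indicator[OF _ cont]) auto
  then have "(\<lambda>z. ennreal (cmod (indicator (ball w r) z *\<^sub>R h z))) \<in> borel_measurable borel"
    by measurable
  also have "(\<lambda>z. ennreal (cmod (indicator (ball w r) z *\<^sub>R h z))) = g"
    by (auto simp: g_def indicator_def fun_eq_iff)
  finally have [measurable]: "g \<in> borel_measurable borel" .
  have [measurable]: "cis \<in> borel_measurable borel"
    by (intro borel_measurable_continuous_onI continuous_intros)
  have "ennreal (cmod (h w)) * emeasure lborel (ball w r) = ennreal (cmod (h w)) * emeasure lborel (ball (0::complex) r)"
    using r by (simp add: emeasure_ball)
  also have "\<dots> = (\<integral>\<^sup>+(v::complex). ennreal (cmod (h w)) * indicator (ball 0 r) v \<partial>lborel)"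
    by (subst nn_integral_cmult_indicator) auto
  \<comment> \<open>Each \<open>v\<close> in the disc bounds \<open>cmod (h w)\<close> by the mean
    over its own circle. After the integrals are exchanged, every \<open>x\<close> contributes a
    rotated copy of the same area integral.\<close>
  also have "\<dots> \<le> (\<integral>\<^sup>+v. (\<integral>\<^sup>+x. g (w + v * cis (2 * pi * x)) * indicator (ball 0 r) v * indicator {0..1} x \<partial>lborel) \<partial>lborel)"
  proof (rule nn_integral_mono)
    fix v :: complex
    show "ennreal (cmod (h w)) * indicator (ball 0 r) v
      \<le> (\<integral>\<^sup>+x. g (w + v * cis (2 * pi * x)) * indicator (ball 0 r) v * indicator {0..1} x \<partial>lborel)"
    proof (cases "v \<in> ball 0 r")
      case True
      then have v: "cmod v < R" using r by auto
      have "w + v * cis (2 * pi * x) \<in> ball w r" for x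
        using True by (simp add: dist_norm norm_mult)
      then have "(\<integral>\<^sup>+x. g (w + v * cis (2 * pi * x)) * indicator (ball 0 r) v * indicator {0..1} x \<partial>lborel)
        = (\<integral>\<^sup>+x. indicator {0..1} x * ennreal (cmod (h (w + v * cis (2 * pi * x)))) \<partial>lborel)"
        using True by (intro nn_integral_cong) (auto simp: g_def mult_ac)
      then show ?thesis using holomorphic_circle_mean_le[OF h v] True by simp
    qed simp
  qed
  also have "\<dots> = (\<integral>\<^sup>+x. (\<integral>\<^sup>+v. g (w + v * cis (2 * pi * x)) * indicator (ball 0 r) v * indicator {0..1} x \<partial>lborel) \<partial>lborel)"
  proof -
    have [measurable]: "ball (0::complex) r \<in> sets borel" "{0..1::real} \<in> sets borel" by simp_all
    have "(\<lambda>x. g (w + fst x * cis (2 * pi * snd x)) * indicator (ball 0 r) (fst x) * indicator {0..1} (snd x))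
      \<in> borel_measurable (lborel \<Otimes>\<^sub>M lborel)" by measurable
    from lborel_pair.Fubini[OF this, symmetric] show ?thesis by (simp only: fst_conv snd_conv)
  qed
  also have "\<dots> \<le> (\<integral>\<^sup>+x. (\<integral>\<^sup>+z. g z \<partial>lborel) * indicator {0..1::real} x \<partial>lborel)"
  proof (rule nn_integral_mono)
    fix x :: real
    \<comment> \<open>A rotation is an isometry, hence expansive with \<open>k = 1\<close>.\<close>
    have "(\<integral>\<^sup>+v. g (w + v * cis (2 * pi * x)) * indicator (ball 0 r) v \<partial>lborel) \<le> ennreal (1 / 1\<^sup>2) * (\<integral>\<^sup>+z. g z \<partial>lborel)"
    proof (rule nn_integral_expansive_le)
      have "(\<lambda>v. w + v * cis (2 * pi * x)) ` ball 0 r = ball w r"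
      proof safe
        fix z assume z: "z \<in> ball w r"
        show "z \<in> (\<lambda>v. w + v * cis (2 * pi * x)) ` ball 0 r"
          by (rule image_eqI[of _ _ "(z - w) / cis (2 * pi * x)"])
             (use z in \<open>auto simp: norm_divide dist_norm norm_minus_commute\<close>)
      qed (auto simp: dist_norm norm_mult)
      then show "open ((\<lambda>v. w + v * cis (2 * pi * x)) ` ball 0 r)" by simp
      show "1 * cmod (z - y) \<le> cmod (w + z * cis (2 * pi * x) - (w + y * cis (2 * pi * x)))" for z y
        by (simp add: left_diff_distrib[symmetric] norm_mult)
    qed (auto intro!: continuous_intros)
    then show "(\<integral>\<^sup>+v. g (w + v * cis (2 * pi * x)) * indicator (ball 0 r) v * indicator {0..1} x \<partial>lborel)
       \<le> (\<integral>\<^sup>+z. g z \<partial>lborel) * indicator {0..1} x"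
      by (auto simp: indicator_def)
  qed
  also have "\<dots> = (\<integral>\<^sup>+z. g z \<partial>lborel)"
    by (subst nn_integral_cmult_indicator) auto
  finally show ?thesis by (simp add: g_def mult.commute)
qed

text \<open>The mean value inequality on a disc of radius \<open>(1 - R) / 2\<close>, where the
  weight is bounded below; the bound
  \<open>x \<le> \<delta> + \<delta> powr (1 - p) * x powr p\<close> takes the place of Hoelder's
  inequality. The integral is kept over the small disc because differences \<open>u t - u t0\<close>
  are known to be small in mean only away from \<xi>.\<close>

lemma bergman_local_bound:
  assumes R: "0 \<le> R" "R < 1" and p: "p > 1" and a: "\<alpha> \<ge> 0"
  obtains C where "C \<ge> 0" "\<And>h z \<delta>. h holomorphic_on \<bbbD> \<Longrightarrow> cmod z \<le> R \<Longrightarrow> \<delta> > 0 \<Longrightarrow>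
    ennreal (cmod (h z)) \<le> ennreal \<delta> + ennreal (\<delta> powr (1 - p) * C) *
      (\<integral>\<^sup>+y. ennreal (cmod (h y) powr p) * indicator (ball z ((1 - R) / 2)) y \<partial>bergman_measure \<alpha>)"
proof -
  define r where "r = (1 - R) / 2"
  have r: "r > 0" using R by (simp add: r_def)
  \<comment> \<open>A lower bound for the weight on the small disc, whose points have modulus at
    most \<open>(1 + R) / 2\<close>.\<close>
  define m where "m = (1 + \<alpha>) * (1 - ((1 + R) / 2)\<^sup>2) powr \<alpha> / pi"
  have "((1 + R) / 2)\<^sup>2 < 1" using R by (simp add: power_less_one_iff abs_square_less_1)
  then have m: "m > 0" using a by (simp add: m_def)
  define C where "C = 1 / (pi * r\<^sup>2 * m)"
  show thesis
  proof (rule that[of C])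
    show "C \<ge> 0" using m r by (simp add: C_def)
    fix h :: "complex \<Rightarrow> complex" and z \<delta>
    assume h: "h holomorphic_on \<bbbD>" and z: "cmod z \<le> R" and d: "\<delta> > (0::real)"
    have sub: "ball z (2 * r) \<subseteq> \<bbbD>"
      using z by (auto simp: r_def dist_norm) (smt (verit) norm_triangle_sub norm_minus_commute)
    have ball_le: "cmod y \<le> (1 + R) / 2" if "y \<in> ball z r" for y
      using that z norm_triangle_sub[of y z] by (auto simp: r_def dist_norm norm_minus_commute field_simps)
    have hz: "h holomorphic_on ball z (2 * r)" using h sub by (rule holomorphic_on_subset)
    let ?J = "\<integral>\<^sup>+y. ennreal (cmod (h y) powr p) * indicator (ball z r) y \<partial>bergman_measure \<alpha>"
    have [measurable]: "h \<in> borel_measurable (bergman_measure \<alpha>)"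
      using h by (rule borel_measurable_holomorphic_bergman)
    have [measurable]: "ball z r \<in> sets (bergman_measure \<alpha>)"
      using sub r by (auto simp: sets_bergman_measure sets_restrict_space_iff intro!: subset_trans[OF _ sub])
    have [measurable]: "ball z r \<in> sets borel" "\<bbbD> \<in> sets borel" by simp_all
    have J: "?J = (\<integral>\<^sup>+y. ennreal (bergman_weight \<alpha> y) * (ennreal (cmod (h y) powr p) * indicator (ball z r) y) * indicator \<bbbD> y \<partial>lborel)"
      by (rule nn_integral_bergman_measure) measurable
    have hm: "(\<lambda>y. indicator (ball z r) y *\<^sub>R h y) \<in> borel_measurable borel"
      by (rule borel_measurable_continuous_on_indicator)
         (use r in \<open>auto intro!: continuous_on_subset[OF holomorphic_on_imp_continuous_on[OF hz]]\<close>)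
    define g where "g y = cmod (indicator (ball z r) y *\<^sub>R h y)" for y
    have [measurable]: "g \<in> borel_measurable borel" using hm unfolding g_def by measurable
    have "ennreal (cmod (h z)) * ennreal (pi * r\<^sup>2) = ennreal (cmod (h z)) * emeasure lborel (ball z r)"
      using r by (simp add: emeasure_ball unit_ball_vol_2)
    also have "\<dots> \<le> (\<integral>\<^sup>+y. ennreal (cmod (h y)) * indicator (ball z r) y \<partial>lborel)"
      by (rule holomorphic_disc_mean_le[OF hz]) (use r in auto)
    also have "\<dots> \<le> (\<integral>\<^sup>+y. ennreal \<delta> * indicator (ball z r) y + ennreal (\<delta> powr (1 - p)) * ennreal (g y powr p) \<partial>lborel)"
    proof (rule nn_integral_mono)
      fix y
      \<comment> \<open>For values above \<delta> write \<open>x = x powr (1 - p) * x powr p\<close>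
        and use that \<open>1 - p\<close> is negative.\<close>
      have "cmod (h y) \<le> \<delta> + \<delta> powr (1 - p) * cmod (h y) powr p"
      proof (cases "cmod (h y) \<le> \<delta>")
        case False
        then have "cmod (h y) powr (1 - p) \<le> \<delta> powr (1 - p)"
          using d p by (intro powr_mono2') auto
        then have "cmod (h y) powr (1 - p) * cmod (h y) powr p \<le> \<delta> powr (1 - p) * cmod (h y) powr p"
          by (rule mult_right_mono) auto
        then show ?thesis using d False by (simp add: powr_add[symmetric])
      next
        case True
        have "0 \<le> \<delta> powr (1 - p) * cmod (h y) powr p" by simp
        with True show ?thesis by linarith
      qed
      then show "ennreal (cmod (h y)) * indicator (ball z r) y
          \<le> ennreal \<delta> * indicator (ball z r) y + ennreal (\<delta> powr (1 - p)) * ennreal (g y powr p)"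
        using d by (auto simp: g_def indicator_def ennreal_mult[symmetric] ennreal_plus[symmetric] simp del: ennreal_plus intro!: ennreal_leI)
    qed
    also have "\<dots> = ennreal \<delta> * emeasure lborel (ball z r) + ennreal (\<delta> powr (1 - p)) * (\<integral>\<^sup>+y. ennreal (g y powr p) \<partial>lborel)"
      by (subst nn_integral_add) (auto simp: nn_integral_cmult nn_integral_cmult_indicator)
    also have "(\<integral>\<^sup>+y. ennreal (g y powr p) \<partial>lborel) \<le> (\<integral>\<^sup>+y. ennreal (1 / m) * (ennreal (bergman_weight \<alpha> y) * (ennreal (cmod (h y) powr p) * indicator (ball z r) y) * indicator \<bbbD> y) \<partial>lborel)"
    proof (rule nn_integral_mono)
      fix y
      show "ennreal (g y powr p) \<le> ennreal (1 / m) * (ennreal (bergman_weight \<alpha> y) * (ennreal (cmod (h y) powr p) * indicator (ball z r) y) * indicator \<bbbD> y)"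
      proof (cases "y \<in> ball z r")
        case True
        have "(1 - ((1 + R) / 2)\<^sup>2) powr \<alpha> \<le> (1 - (cmod y)\<^sup>2) powr \<alpha>"
          using \<open>((1 + R) / 2)\<^sup>2 < 1\<close> a ball_le[OF True]
          by (intro powr_mono2) (auto intro!: power_mono)
        then have "m \<le> bergman_weight \<alpha> y"
          using a by (auto simp: m_def bergman_weight_def intro!: divide_right_mono mult_left_mono)
        then have "1 \<le> 1 / m * bergman_weight \<alpha> y" using m by (simp add: field_simps)
        then have "1 * cmod (h y) powr p \<le> 1 / m * bergman_weight \<alpha> y * cmod (h y) powr p"
          by (rule mult_right_mono) auto
        moreover have "y \<in> \<bbbD>" using True sub r by (auto dest!: subsetD[where c=y])
        ultimately show ?thesis
          using True m bergman_weight_nonneg[OF a] by (simp add: g_def ennreal_mult[symmetric] mult.assoc ennreal_leI)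
      qed (use p in \<open>simp add: g_def\<close>)
    qed
    also have "\<dots> = ennreal (1 / m) * ?J"
      unfolding J
    proof (rule nn_integral_cmult)
      have "(\<lambda>y. ennreal (bergman_weight \<alpha> y) * (ennreal (g y powr p)) * indicator \<bbbD> y) \<in> borel_measurable lborel"
        by measurable
      also have "(\<lambda>y. ennreal (bergman_weight \<alpha> y) * (ennreal (g y powr p)) * indicator \<bbbD> y)
         = (\<lambda>y. ennreal (bergman_weight \<alpha> y) * (ennreal (cmod (h y) powr p) * indicator (ball z r) y) * indicator \<bbbD> y)"
        using p by (auto simp: g_def indicator_def fun_eq_iff)
      finally show "(\<lambda>y. ennreal (bergman_weight \<alpha> y) * (ennreal (cmod (h y) powr p) * indicator (ball z r) y) * indicator \<bbbD> y) \<in> borel_measurable lborel" .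
    qed
    finally have "ennreal (cmod (h z)) * ennreal (pi * r\<^sup>2)
      \<le> ennreal \<delta> * ennreal (pi * r\<^sup>2) + ennreal (\<delta> powr (1 - p)) * (ennreal (1 / m) * ?J)"
      using r by (simp add: emeasure_ball unit_ball_vol_2 mult_left_mono add_left_mono)
    then have "(ennreal (cmod (h z)) * ennreal (pi * r\<^sup>2)) * ennreal (1 / (pi * r\<^sup>2))
      \<le> (ennreal \<delta> * ennreal (pi * r\<^sup>2) + ennreal (\<delta> powr (1 - p)) * (ennreal (1 / m) * ?J)) * ennreal (1 / (pi * r\<^sup>2))"
      by (rule mult_right_mono) simp
    also have "(ennreal (cmod (h z)) * ennreal (pi * r\<^sup>2)) * ennreal (1 / (pi * r\<^sup>2)) = ennreal (cmod (h z))"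
      using r by (simp add: ennreal_mult[symmetric] mult.assoc)
    also have "(ennreal \<delta> * ennreal (pi * r\<^sup>2) + ennreal (\<delta> powr (1 - p)) * (ennreal (1 / m) * ?J)) * ennreal (1 / (pi * r\<^sup>2))
      = ennreal \<delta> * (ennreal (pi * r\<^sup>2) * ennreal (1 / (pi * r\<^sup>2))) + ennreal (\<delta> powr (1 - p)) * (ennreal (1 / m) * ennreal (1 / (pi * r\<^sup>2))) * ?J"
      by (simp add: distrib_left distrib_right mult_ac)
    also have "\<dots> = ennreal \<delta> + ennreal (\<delta> powr (1 - p) * C) * ?J"
      using r m by (simp add: ennreal_mult[symmetric] C_def mult.assoc) (simp add: mult_ac)
    finally show "ennreal (cmod (h z)) \<le> ennreal \<delta> + ennreal (\<delta> powr (1 - p) * C) *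
      (\<integral>\<^sup>+y. ennreal (cmod (h y) powr p) * indicator (ball z ((1 - R) / 2)) y \<partial>bergman_measure \<alpha>)"
      by (simp add: r_def)
  qed
qed

text \<open>Taking \<delta> equal to the norm makes the local bound homogeneous, since then
  \<open>\<delta> powr (1 - p) * \<delta> powr p = \<delta>\<close>. For norm 0 every positive
  \<delta> is allowed.\<close>

lemma bergman_eval_bound:
  assumes R: "0 \<le> R" "R < 1" and p: "p > 1" and a: "\<alpha> \<ge> 0"
  obtains C where "C > 0" "\<And>f z. f \<in> bergman_space p \<alpha> \<Longrightarrow> cmod z \<le> R \<Longrightarrow> cmod (f z) \<le> C * bergman_norm p \<alpha> f"
proof -
  obtain C where C: "C \<ge> 0" "\<And>h z \<delta>. h holomorphic_on \<bbbD> \<Longrightarrow> cmod z \<le> R \<Longrightarrow> \<delta> > 0 \<Longrightarrow>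
    ennreal (cmod (h z)) \<le> ennreal \<delta> + ennreal (\<delta> powr (1 - p) * C) *
      (\<integral>\<^sup>+y. ennreal (cmod (h y) powr p) * indicator (ball z ((1 - R) / 2)) y \<partial>bergman_measure \<alpha>)"
    using bergman_local_bound[OF assms] by blast
  have *: "cmod (f z) \<le> \<delta> + \<delta> powr (1 - p) * C * bergman_norm p \<alpha> f powr p"
    if f: "f \<in> bergman_space p \<alpha>" and z: "cmod z \<le> R" and d: "\<delta> > 0" for f z \<delta>
  proof -
    have "ennreal (cmod (f z)) \<le> ennreal \<delta> + ennreal (\<delta> powr (1 - p) * C) * bergman_pow p \<alpha> f"
      unfolding bergman_pow_def
      by (rule order_trans[OF C(2)[OF bergman_space_holomorphic[OF f] z d]])
         (auto intro!: add_left_mono mult_left_mono nn_integral_mono simp: indicator_def)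
    also have "\<dots> = ennreal (\<delta> + \<delta> powr (1 - p) * C * bergman_norm p \<alpha> f powr p)"
      using d C(1) by (simp add: bergman_pow_eq_norm[OF f p] ennreal_mult)
    finally show ?thesis
      by (subst (asm) ennreal_le_iff) (use d C(1) in \<open>auto intro!: add_nonneg_nonneg mult_nonneg_nonneg\<close>)
  qed
  show thesis
  proof (rule that[of "1 + C"])
    fix f z assume f: "f \<in> bergman_space p \<alpha>" and z: "cmod z \<le> R"
    let ?N = "bergman_norm p \<alpha> f"
    show "cmod (f z) \<le> (1 + C) * ?N"
    proof (cases "?N = 0")
      case True
      then have "cmod (f z) \<le> \<delta>" if "\<delta> > 0" for \<delta> using *[OF f z that] p by simp
      then have "cmod (f z) \<le> 0" by (rule field_le_epsilon) simp
      then show ?thesis using True by simp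
    next
      case False
      then have N: "?N > 0" using bergman_norm_nonneg[of p \<alpha> f] by linarith
      define n where "n = ?N"
      have n: "n powr (1 - p) * n powr p = n"
        using N by (simp add: n_def powr_add[symmetric])
      have "cmod (f z) \<le> n + C * (n powr (1 - p) * n powr p)"
        using *[OF f z N] unfolding n_def[symmetric] by (simp add: mult_ac)
      then show ?thesis unfolding n n_def[symmetric] by (simp add: distrib_right)
    qed
  qed (use C in auto)
qed

section \<open>Integrals with values in a Bergman space\<close>

abbreviation unit_interval_measure :: "real measure" ("\<L>")
  where "\<L> \<equiv> lebesgue_on {0<..<1}"

lemma finite_measure_unit_interval: "finite_measure \<L>"
  by (rule finite_measureI) (simp add: emeasure_restrict_space space_restrict_space)

text \<open>Both factors carry Lebesgue sets. The identity into the Borel sets of the product is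
  measurable, and a function continuous on the open product is Borel there.\<close>

lemma borel_measurable_pair_bergman:
  fixes F :: "real \<Rightarrow> complex \<Rightarrow> complex"
  assumes "continuous_on ({0<..<1} \<times> \<bbbD>) (\<lambda>(t, z). F t z)"
  shows "(\<lambda>(t, z). F t z) \<in> borel_measurable (\<L> \<Otimes>\<^sub>M bergman_measure \<alpha>)"
proof -
  let ?A = "{0<..<1} \<times> \<bbbD> :: (real \<times> complex) set"
  have "(\<lambda>x. x) \<in> measurable \<L> borel"
    by (intro measurable_restrict_space1 measurable_completion) auto
  with measurable_ident_bergman have "(\<lambda>(t, z). (t, z)) \<in> measurable (\<L> \<Otimes>\<^sub>M bergman_measure \<alpha>) (borel \<Otimes>\<^sub>M borel)"
    by measurable
  then have "(\<lambda>x. x) \<in> measurable (\<L> \<Otimes>\<^sub>M bergman_measure \<alpha>) (borel :: (real \<times> complex) measure)"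
    by (simp add: borel_prod case_prod_unfold)
  then have "(\<lambda>x. x) \<in> measurable (\<L> \<Otimes>\<^sub>M bergman_measure \<alpha>) (restrict_space borel ?A)"
    by (intro measurable_restrict_space2) (auto simp: space_pair_measure space_bergman_measure space_restrict_space)
  from measurable_compose[OF this borel_measurable_continuous_on_restrict[OF assms]]
  show ?thesis by simp
qed

lemma borel_measurable_bergman_norm:
  fixes F :: "real \<Rightarrow> complex \<Rightarrow> complex"
  assumes F: "(\<lambda>(t, z). F t z) \<in> borel_measurable (\<L> \<Otimes>\<^sub>M bergman_measure \<alpha>)" and a: "\<alpha> \<ge> 0"
  shows "(\<lambda>t. bergman_norm p \<alpha> (F t)) \<in> borel_measurable \<L>"
proof -
  interpret finite_measure "bergman_measure \<alpha>" by (rule finite_measure_bergman[OF a])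
  have "(\<lambda>t. LINT z|bergman_measure \<alpha>. cmod (F t z) powr p) \<in> borel_measurable \<L>"
    using F by (intro borel_measurable_lebesgue_integral) (auto simp: case_prod_unfold)
  then show ?thesis unfolding bergman_norm_def by measurable
qed

text \<open>When \<open>J z\<close> is the integral of \<open>H t z\<close>, this bounds the norm of
  an integral by the integral of the norms. Only an inequality between moduli is asked for at each
  point, and membership of \<open>J\<close> in the space comes out as well.\<close>

lemma bergman_Minkowski:
  fixes H :: "real \<Rightarrow> complex \<Rightarrow> complex"
  assumes H: "(\<lambda>(t, z). H t z) \<in> borel_measurable (\<L> \<Otimes>\<^sub>M bergman_measure \<alpha>)"
    and Hb: "\<And>t. t \<in> {0<..<1} \<Longrightarrow> H t \<in> bergman_space p \<alpha>"
    and K: "(\<integral>\<^sup>+t. ennreal (bergman_norm p \<alpha> (H t)) \<partial>\<L>) \<le> ennreal K" "K \<ge> 0"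
    and J: "J holomorphic_on \<bbbD>" "\<And>z. z \<in> \<bbbD> \<Longrightarrow> ennreal (cmod (J z)) \<le> (\<integral>\<^sup>+t. ennreal (cmod (H t z)) \<partial>\<L>)"
    and p: "p > 1" and a: "\<alpha> \<ge> 0"
  shows "J \<in> bergman_space p \<alpha>" "bergman_norm p \<alpha> J \<le> K"
proof -
  interpret finite_measure "bergman_measure \<alpha>" by (rule finite_measure_bergman[OF a])
  interpret L: finite_measure \<L> by (rule finite_measure_unit_interval)
  have "(\<integral>\<^sup>+z. ennreal (cmod (J z) powr p) \<partial>bergman_measure \<alpha>) \<le> ennreal (K powr p)"
  proof (rule Minkowski_integral_inequality[where M = \<L> and H = "\<lambda>t z. cmod (H t z)" and n = "\<lambda>t. bergman_norm p \<alpha> (H t)"])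
    show "(\<lambda>(t, z). cmod (H t z)) \<in> borel_measurable (\<L> \<Otimes>\<^sub>M bergman_measure \<alpha>)"
      using H by (simp add: case_prod_unfold)
    show "(\<lambda>t. bergman_norm p \<alpha> (H t)) \<in> borel_measurable \<L>"
      by (rule borel_measurable_bergman_norm[OF H a])
    show "(\<integral>\<^sup>+z. ennreal (cmod (H t z) powr p) \<partial>bergman_measure \<alpha>) \<le> ennreal (bergman_norm p \<alpha> (H t) powr p)"
      if "t \<in> space \<L>" for t
      using bergman_pow_eq_norm[OF Hb p, of t] that by (simp add: bergman_pow_def space_restrict_space)
    show "(\<lambda>z. cmod (J z)) \<in> borel_measurable (bergman_measure \<alpha>)"
      using borel_measurable_holomorphic_bergman[OF J(1)] by measurable
  qed (use p K J in \<open>auto simp: bergman_norm_nonneg space_bergman_measure sigma_finite_measure_axioms L.sigma_finite_measure_axioms L.finite_measure_axioms\<close>)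
  then show "J \<in> bergman_space p \<alpha>" "bergman_norm p \<alpha> J \<le> K"
    using bergman_leI[OF J(1) K(2) p] by (auto simp: bergman_pow_def)
qed

text \<open>Writing \<open>s\<close> as a finite sum of indicators times functions shows that a
  vector-valued simple integral, evaluated at \<open>z\<close>, is the scalar integral of
  \<open>s t z\<close>.\<close>

lemma bergman_simple_measurable:
  assumes s: "bergman_simple p \<alpha> s" 
  shows "(\<lambda>(t, z). s t z) \<in> borel_measurable (\<L> \<Otimes>\<^sub>M bergman_measure \<alpha>)"
    and "t \<in> {0<..<1} \<Longrightarrow> s t \<in> bergman_space p \<alpha>"
    and "integrable \<L> (\<lambda>t. s t z)"
    and "(LINT t|\<L>. s t z) = bergman_simple_integral s z"
proof -
  interpret L: finite_measure \<L> by (rule finite_measure_unit_interval)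
  let ?G = "s ` {0<..<1}"
  define A where "A g = {t \<in> {0<..<1}. s t = g}" for g
  have sf: "simple_function \<L> s" and sub: "?G \<subseteq> bergman_space p \<alpha>"
    using s by (auto simp: bergman_simple_def)
  have fin: "finite ?G" using sf by (simp add: simple_function_def space_restrict_space)
  have A: "A g \<in> sets \<L>" for g
  proof -
    have "s -` {g} \<inter> space \<L> \<in> sets \<L>" using sf by (rule simple_functionD)
    then show ?thesis by (simp add: A_def space_restrict_space vimage_def Int_def conj_commute)
  qed
  have eq: "s t z = (\<Sum>g\<in>?G. indicator (A g) t *\<^sub>R g z)" if "t \<in> {0<..<1}" for t z
  proof -
    have "(\<Sum>g\<in>?G. indicator (A g) t *\<^sub>R g z) = (\<Sum>g\<in>?G. if g = s t then g z else 0)"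
      by (intro sum.cong) (use that in \<open>auto simp: indicator_def A_def\<close>)
    also have "\<dots> = s t z" using fin that by (simp add: sum.delta)
    finally show ?thesis by simp
  qed
  show "t \<in> {0<..<1} \<Longrightarrow> s t \<in> bergman_space p \<alpha>" using sub by auto
  have "(\<lambda>x. \<Sum>g\<in>?G. indicator (A g) (fst x) *\<^sub>R g (snd x)) \<in> borel_measurable (\<L> \<Otimes>\<^sub>M bergman_measure \<alpha>)"
  proof (rule borel_measurable_sum)
    fix g assume "g \<in> ?G"
    then have [measurable]: "g \<in> borel_measurable (bergman_measure \<alpha>)"
      using sub by (auto intro: bergman_space_measurable)
    note A[of g, measurable]
    show "(\<lambda>x. indicator (A g) (fst x) *\<^sub>R g (snd x)) \<in> borel_measurable (\<L> \<Otimes>\<^sub>M bergman_measure \<alpha>)"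
      by measurable
  qed
  moreover have "(\<lambda>x. \<Sum>g\<in>?G. indicator (A g) (fst x) *\<^sub>R g (snd x)) x = (\<lambda>(t, z). s t z) x"
    if "x \<in> space (\<L> \<Otimes>\<^sub>M bergman_measure \<alpha>)" for x
    using that eq[of "fst x" "snd x"] by (auto simp: space_pair_measure space_restrict_space)
  ultimately show "(\<lambda>(t, z). s t z) \<in> borel_measurable (\<L> \<Otimes>\<^sub>M bergman_measure \<alpha>)"
    by (subst measurable_cong[symmetric])
  have i: "integrable \<L> (\<lambda>t. indicator (A g) t *\<^sub>R g z)" for g
    using A[of g] L.emeasure_finite by (intro integrable_indicator integrable_scaleR_left) (auto simp: less_top[symmetric] integrable_indicator_iff)
  have ii: "(LINT t|\<L>. indicator (A g) t *\<^sub>R g z) = complex_of_real (measure \<L> (A g)) * g z" for g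
    using A[of g] Int_absorb2[of "A g" "{0<..<1}"] sets.sets_into_space[OF A[of g]]
    by (subst integral_scaleR_left) (auto simp: scaleR_conv_of_real space_restrict_space less_top[symmetric] integrable_indicator_iff)
  show "integrable \<L> (\<lambda>t. s t z)"
    by (subst Bochner_Integration.integrable_cong[OF refl eq])
       (auto simp: space_restrict_space intro!: Bochner_Integration.integrable_sum i)
  show "(LINT t|\<L>. s t z) = bergman_simple_integral s z"
    unfolding bergman_simple_integral_def A_def[symmetric]
    by (subst Bochner_Integration.integral_cong[OF refl eq])
       (auto simp: space_restrict_space Bochner_Integration.integral_sum i ii)
qed

lemma bergman_simple_integral_in_space:
  assumes s: "bergman_simple p \<alpha> s" and p: "p > 1" and a: "\<alpha> \<ge> 0"
  shows "bergman_simple_integral s \<in> bergman_space p \<alpha>"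
proof -
  have sum: "(\<lambda>z. \<Sum>g\<in>A. c g * g z) \<in> bergman_space p \<alpha>" if "finite A" "A \<subseteq> bergman_space p \<alpha>"
    for A and c :: "_ \<Rightarrow> complex"
    using that by (induction A) (auto intro!: bergman_zero bergman_add bergman_scale p a)
  have "finite (s ` {0<..<1})" "s ` {0<..<1} \<subseteq> bergman_space p \<alpha>"
    using s by (auto simp: bergman_simple_def simple_function_def space_restrict_space)
  then show ?thesis unfolding bergman_simple_integral_def by (rule sum)
qed

text \<open>Compares \<open>F\<close> with scalar multiples of one fixed function \<open>h\<close>,
  whose integral is visibly a multiple of \<open>h\<close>. It serves with \<open>l = 0\<close> for
  the norm of an integral and with the limiting multipliers for the lower bound. The estimate is
  shown for simple functions, where evaluation commutes with integration, and then passes to the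
  limit.\<close>

lemma has_bergman_integral_norm_diff_le:
  assumes G: "has_bergman_integral p \<alpha> F G"
    and F: "(\<lambda>(t, z). F t z) \<in> borel_measurable (\<L> \<Otimes>\<^sub>M bergman_measure \<alpha>)"
    and l: "integrable \<L> l" and h: "h \<in> bergman_space p \<alpha>"
    and p: "p > 1" and a: "\<alpha> \<ge> 0"
  shows "ennreal (bergman_norm p \<alpha> (\<lambda>z. G z - (LINT t|\<L>. l t) * h z))
    \<le> (\<integral>\<^sup>+t. ennreal (bergman_norm p \<alpha> (\<lambda>z. F t z - l t * h z)) \<partial>\<L>)" (is "_ \<le> ?R")
proof (cases "?R = \<infinity>")
  case False
  obtain s where Ft: "\<And>t. t \<in> {0<..<1} \<Longrightarrow> F t \<in> bergman_space p \<alpha>" and Gb: "G \<in> bergman_space p \<alpha>"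
    and s: "\<And>i. bergman_simple p \<alpha> (s i)"
    and sm: "\<And>i. (\<lambda>t. bergman_norm p \<alpha> (\<lambda>z. F t z - s i t z)) \<in> borel_measurable \<L>"
    and s1: "(\<lambda>i. \<integral>\<^sup>+t. ennreal (bergman_norm p \<alpha> (\<lambda>z. F t z - s i t z)) \<partial>\<L>) \<longlonglongrightarrow> 0"
    and s2: "(\<lambda>i. bergman_norm p \<alpha> (\<lambda>z. bergman_simple_integral (s i) z - G z)) \<longlonglongrightarrow> 0"
    using G unfolding has_bergman_integral_def by blast
  note [measurable] = bergman_space_measurable[OF h] borel_measurable_integrable[OF l]
  have Fm [measurable]: "(\<lambda>x. F (fst x) (snd x)) \<in> borel_measurable (\<L> \<Otimes>\<^sub>M bergman_measure \<alpha>)"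
    using F by (simp add: case_prod_unfold)
  have lh: "(\<lambda>z. c * h z) \<in> bergman_space p \<alpha>" for c by (rule bergman_scale(1)[OF h p])
  define \<Lambda> where "\<Lambda> = (LINT t|\<L>. l t)"
  let ?I = "\<lambda>i. bergman_simple_integral (s i)"
  have R: "(\<lambda>t. bergman_norm p \<alpha> (\<lambda>z. F t z - l t * h z)) \<in> borel_measurable \<L>"
    by (rule borel_measurable_bergman_norm[OF _ a]) (simp add: case_prod_unfold)
  have Ib: "?I i \<in> bergman_space p \<alpha>" for i
    by (rule bergman_simple_integral_in_space[OF s p a])
  have bound: "ennreal (bergman_norm p \<alpha> (\<lambda>z. ?I i z - \<Lambda> * h z))
     \<le> (\<integral>\<^sup>+t. ennreal (bergman_norm p \<alpha> (\<lambda>z. F t z - s i t z)) \<partial>\<L>) + ?R" (is "_ \<le> ?Q i + ?R") for i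
  proof -
    note sb = bergman_simple_measurable[OF s[of i]]
    have sm' [measurable]: "(\<lambda>x. s i (fst x) (snd x)) \<in> borel_measurable (\<L> \<Otimes>\<^sub>M bergman_measure \<alpha>)"
      using sb(1) by (simp add: case_prod_unfold)
    show "ennreal (bergman_norm p \<alpha> (\<lambda>z. ?I i z - \<Lambda> * h z)) \<le> ?Q i + ?R"
    proof (cases "?Q i = \<infinity>")
      case False
      define K where "K = enn2real (?Q i + ?R)"
      have K: "?Q i + ?R = ennreal K" "K \<ge> 0"
        using False \<open>?R \<noteq> \<infinity>\<close> by (auto simp: K_def less_top)
      have "bergman_norm p \<alpha> (\<lambda>z. ?I i z - \<Lambda> * h z) \<le> K"
      proof (rule bergman_Minkowski(2)[where H = "\<lambda>t z. s i t z - l t * h z"])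
        show "(\<lambda>(t, z). s i t z - l t * h z) \<in> borel_measurable (\<L> \<Otimes>\<^sub>M bergman_measure \<alpha>)"
          by (simp add: case_prod_unfold)
        show "(\<lambda>z. s i t z - l t * h z) \<in> bergman_space p \<alpha>" if "t \<in> {0<..<1}" for t
          by (rule bergman_diff(1)[OF sb(2)[OF that] lh p a])
        have "(\<integral>\<^sup>+t. ennreal (bergman_norm p \<alpha> (\<lambda>z. s i t z - l t * h z)) \<partial>\<L>)
          \<le> (\<integral>\<^sup>+t. ennreal (bergman_norm p \<alpha> (\<lambda>z. F t z - s i t z)) + ennreal (bergman_norm p \<alpha> (\<lambda>z. F t z - l t * h z)) \<partial>\<L>)"
        proof (rule nn_integral_mono)
          fix t assume "t \<in> space \<L>"
          then have t: "t \<in> {0<..<1}" by (simp add: space_restrict_space)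
          have "(\<lambda>z. s i t z - l t * h z) = (\<lambda>z. (F t z - l t * h z) - (F t z - s i t z))" by auto
          then have "bergman_norm p \<alpha> (\<lambda>z. s i t z - l t * h z)
            \<le> bergman_norm p \<alpha> (\<lambda>z. F t z - l t * h z) + bergman_norm p \<alpha> (\<lambda>z. F t z - s i t z)"
            using bergman_diff(2)[OF bergman_diff(1)[OF Ft[OF t] lh p a] bergman_diff(1)[OF Ft[OF t] sb(2)[OF t] p a] p a]
            by simp
          then show "ennreal (bergman_norm p \<alpha> (\<lambda>z. s i t z - l t * h z))
            \<le> ennreal (bergman_norm p \<alpha> (\<lambda>z. F t z - s i t z)) + ennreal (bergman_norm p \<alpha> (\<lambda>z. F t z - l t * h z))"
            by (simp add: ennreal_plus[symmetric] bergman_norm_nonneg add.commute ennreal_leI del: ennreal_plus)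
        qed
        also have "\<dots> = ?Q i + ?R" using sm[of i] R by (intro nn_integral_add) auto
        finally show "(\<integral>\<^sup>+t. ennreal (bergman_norm p \<alpha> (\<lambda>z. s i t z - l t * h z)) \<partial>\<L>) \<le> ennreal K"
          using K by simp
        show "(\<lambda>z. ?I i z - \<Lambda> * h z) holomorphic_on \<bbbD>"
          by (rule bergman_space_holomorphic[OF bergman_diff(1)[OF Ib lh p a]])
        show "ennreal (cmod (?I i z - \<Lambda> * h z)) \<le> (\<integral>\<^sup>+t. ennreal (cmod (s i t z - l t * h z)) \<partial>\<L>)" for z
        proof -
          have "integrable \<L> (\<lambda>t. s i t z - l t * h z)"
            using sb(3) l by auto
          moreover have "(LINT t|\<L>. s i t z - l t * h z) = ?I i z - \<Lambda> * h z"
            using sb(3)[of z] sb(4)[of z] l by (simp add: \<Lambda>_def)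
          ultimately show ?thesis
            using integral_norm_bound_ennreal by metis
        qed
      qed (use p a K in auto)
      then show ?thesis using K by (simp add: ennreal_leI)
    qed simp
  qed
  \<comment> \<open>Triangle inequality through the simple integrals; as \<open>i\<close> grows both
    error terms vanish and \<open>?R\<close> remains.\<close>
  have "ennreal (bergman_norm p \<alpha> (\<lambda>z. G z - \<Lambda> * h z))
    \<le> ennreal (bergman_norm p \<alpha> (\<lambda>z. ?I i z - G z)) + ((\<integral>\<^sup>+t. ennreal (bergman_norm p \<alpha> (\<lambda>z. F t z - s i t z)) \<partial>\<L>) + ?R)" for i
  proof -
    have "(\<lambda>z. G z - \<Lambda> * h z) = (\<lambda>z. (?I i z - \<Lambda> * h z) - (?I i z - G z))" by auto
    then have "bergman_norm p \<alpha> (\<lambda>z. G z - \<Lambda> * h z)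
      \<le> bergman_norm p \<alpha> (\<lambda>z. ?I i z - \<Lambda> * h z) + bergman_norm p \<alpha> (\<lambda>z. ?I i z - G z)"
      using bergman_diff(2)[OF bergman_diff(1)[OF Ib[of i] lh[of \<Lambda>] p a] bergman_diff(1)[OF Ib[of i] Gb p a] p a] by simp
    then have "ennreal (bergman_norm p \<alpha> (\<lambda>z. G z - \<Lambda> * h z))
      \<le> ennreal (bergman_norm p \<alpha> (\<lambda>z. ?I i z - G z)) + ennreal (bergman_norm p \<alpha> (\<lambda>z. ?I i z - \<Lambda> * h z))"
      by (simp add: ennreal_plus[symmetric] bergman_norm_nonneg add.commute ennreal_leI del: ennreal_plus)
    also have "\<dots> \<le> ennreal (bergman_norm p \<alpha> (\<lambda>z. ?I i z - G z)) + ((\<integral>\<^sup>+t. ennreal (bergman_norm p \<alpha> (\<lambda>z. F t z - s i t z)) \<partial>\<L>) + ?R)"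
      by (intro add_left_mono bound)
    finally show ?thesis .
  qed
  moreover have "(\<lambda>i. ennreal (bergman_norm p \<alpha> (\<lambda>z. ?I i z - G z)) + ((\<integral>\<^sup>+t. ennreal (bergman_norm p \<alpha> (\<lambda>z. F t z - s i t z)) \<partial>\<L>) + ?R)) \<longlonglongrightarrow> ennreal 0 + (0 + ?R)"
    by (intro tendsto_add tendsto_ennrealI s1 s2 tendsto_const)
  ultimately show ?thesis
    unfolding \<Lambda>_def[symmetric] by (intro tendsto_lowerbound[of _ "ennreal 0 + (0 + ?R)" sequentially, simplified]) auto
qed simp

text \<open>A dilation is expansive with constant \<open>r\<close>, and the weight at
  \<open>r z\<close> is at least the weight at \<open>z\<close>, since it decreases with the
  modulus.\<close>

lemma bergman_pow_dilation_le:
  assumes f: "f \<in> bergman_space p \<alpha>" and r: "0 < r" "r < 1" and a: "\<alpha> \<ge> 0"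
  shows "bergman_pow p \<alpha> (\<lambda>z. f (of_real r * z)) \<le> ennreal (1 / r\<^sup>2) * bergman_pow p \<alpha> f"
proof -
  have cont: "continuous_on \<bbbD> f" by (rule bergman_space_continuous[OF f])
  have sub: "of_real r * z \<in> \<bbbD>" if "z \<in> \<bbbD>" for z :: complex
  proof -
    have "r * cmod z \<le> 1 * cmod z" using r by (intro mult_right_mono) auto
    then show ?thesis using that r by (simp add: norm_mult)
  qed
  have cont': "continuous_on \<bbbD> (\<lambda>z. f (of_real r * z))"
    by (rule continuous_on_compose2[OF cont]) (use sub in \<open>auto intro!: continuous_intros\<close>)
  have fm: "(\<lambda>z. indicator \<bbbD> z *\<^sub>R f z) \<in> borel_measurable borel"
    by (rule borel_measurable_continuous_on_indicator[OF _ cont]) auto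
  define g where "g z = ennreal (bergman_weight \<alpha> z) * ennreal (cmod (indicator \<bbbD> z *\<^sub>R f z) powr p) * indicator \<bbbD> z" for z
  have [measurable]: "\<bbbD> \<in> sets borel" by simp
  have gm: "g \<in> borel_measurable borel" using fm unfolding g_def by measurable
  have f1: "f \<in> borel_measurable (bergman_measure \<alpha>)" 
    and f2: "(\<lambda>z. f (of_real r * z)) \<in> borel_measurable (bergman_measure \<alpha>)"
    using cont cont' by (auto intro: continuous_on_imp_measurable_bergman)
  have "bergman_pow p \<alpha> (\<lambda>z. f (of_real r * z)) = (\<integral>\<^sup>+z. ennreal (bergman_weight \<alpha> z) * ennreal (cmod (f (of_real r * z)) powr p) * indicator \<bbbD> z \<partial>lborel)"
    unfolding bergman_pow_def using f2 by (intro nn_integral_bergman_measure) auto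
  also have "\<dots> \<le> (\<integral>\<^sup>+z. g (of_real r * z) * indicator \<bbbD> z \<partial>lborel)"
  proof (rule nn_integral_mono)
    fix z :: complex
    show "ennreal (bergman_weight \<alpha> z) * ennreal (cmod (f (of_real r * z)) powr p) * indicator \<bbbD> z
       \<le> g (of_real r * z) * indicator \<bbbD> z"
    proof (cases "z \<in> \<bbbD>")
      case True
      have "cmod (of_real r * z) \<le> cmod z" using r by (simp add: norm_mult mult_left_le_one_le)
      then have "(cmod (of_real r * z))\<^sup>2 \<le> (cmod z)\<^sup>2" by (rule power_mono) simp
      moreover have "(cmod z)\<^sup>2 \<le> 1" using True by (simp add: abs_square_le_1)
      ultimately have "bergman_weight \<alpha> z \<le> bergman_weight \<alpha> (of_real r * z)"
        using a unfolding bergman_weight_def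
        by (intro divide_right_mono mult_left_mono powr_mono2) auto
      then show ?thesis using True sub[OF True]
        by (auto simp: g_def intro!: mult_right_mono ennreal_leI)
    qed simp
  qed
  also have "\<dots> \<le> ennreal (1 / r\<^sup>2) * (\<integral>\<^sup>+z. g z \<partial>lborel)"
  proof (rule nn_integral_expansive_le[OF _ _ _ r(1) _ gm])
    have "(\<lambda>z. of_real r * z) ` \<bbbD> = (ball 0 r :: complex set)"
    proof safe
      fix z :: complex assume "z \<in> ball 0 r"
      then show "z \<in> (\<lambda>z. of_real r * z) ` \<bbbD>"
        by (intro image_eqI[of _ _ "z / of_real r"]) (use r in \<open>auto simp: norm_divide\<close>)
    qed (use r in \<open>auto simp: norm_mult\<close>)
    then show "open ((\<lambda>z::complex. of_real r * z) ` \<bbbD>)" by simp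
    show "r * cmod (z - w) \<le> cmod (of_real r * z - of_real r * w)" for z w
      using r by (simp add: right_diff_distrib[symmetric] norm_mult)
  qed (auto intro!: continuous_intros)
  also have "(\<integral>\<^sup>+z. g z \<partial>lborel) = bergman_pow p \<alpha> f"
    unfolding bergman_pow_def using f1
    by (subst nn_integral_bergman_measure) (auto simp: g_def indicator_def intro!: nn_integral_cong)
  finally show ?thesis by (simp add: mult_left_mono)
qed

lemma bergman_dilation:
  assumes f: "f \<in> bergman_space p \<alpha>" and r: "0 < r" "r < 1" and a: "\<alpha> \<ge> 0" and p: "p > 1"
  shows "(\<lambda>z. f (of_real r * z)) \<in> bergman_space p \<alpha>"
    and "r \<ge> 1 / 2 \<Longrightarrow> bergman_norm p \<alpha> (\<lambda>z. f (of_real r * z)) \<le> 4 * bergman_norm p \<alpha> f"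
proof -
  have "(\<lambda>z. of_real r * z) ` \<bbbD> \<subseteq> (\<bbbD> :: complex set)"
  proof (rule image_subsetI)
    fix z :: complex assume "z \<in> \<bbbD>"
    moreover have "r * cmod z \<le> 1 * cmod z" using r by (intro mult_right_mono) auto
    ultimately show "of_real r * z \<in> \<bbbD>" using r by (simp add: norm_mult)
  qed
  then have hol: "(\<lambda>z. f (of_real r * z)) holomorphic_on \<bbbD>"
    using bergman_space_holomorphic[OF f]
    by (intro holomorphic_on_compose_gen[of "\<lambda>z. of_real r * z" _ f, unfolded o_def] holomorphic_intros)
  show "(\<lambda>z. f (of_real r * z)) \<in> bergman_space p \<alpha>"
    using hol bergman_pow_dilation_le[OF f r a] f
    by (auto simp: bergman_space_iff ennreal_mult_less_top intro: le_less_trans)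
  show "bergman_norm p \<alpha> (\<lambda>z. f (of_real r * z)) \<le> 4 * bergman_norm p \<alpha> f" if r2: "r \<ge> 1 / 2"
  proof (rule bergman_leI(2)[OF hol _ p])
    \<comment> \<open>For \<open>r \<ge> 1 / 2\<close> the factor \<open>1 / r\<^sup>2\<close> is at
      most 4, hence at most \<open>4 powr p\<close>; this gives a norm bound independent of
      \<open>r\<close>.\<close>
    have "(1 / 2)\<^sup>2 \<le> r\<^sup>2" using r2 by (intro power_mono) auto
    then have "1 / r\<^sup>2 \<le> 4" using r by (simp add: field_simps power2_eq_square)
    also have "4 \<le> 4 powr p" using p powr_mono[of 1 p 4] by simp
    finally have "1 / r\<^sup>2 * bergman_norm p \<alpha> f powr p \<le> 4 powr p * bergman_norm p \<alpha> f powr p"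
      by (rule mult_right_mono) auto
    then show "bergman_pow p \<alpha> (\<lambda>z. f (of_real r * z)) \<le> ennreal ((4 * bergman_norm p \<alpha> f) powr p)"
      using bergman_pow_dilation_le[OF f r a]
      by (simp add: bergman_pow_eq_norm[OF f p] powr_mult bergman_norm_nonneg ennreal_mult[symmetric])
         (meson ennreal_leI order_trans)
  qed (simp add: bergman_norm_nonneg)
qed

lemma norm_diff_powr_le:
  fixes u v :: complex
  assumes "p \<ge> 1"
  shows "cmod (u - v) powr p \<le> 2 powr p * (cmod u powr p + cmod v powr p)"
proof -
  have "cmod (u - v) \<le> 2 * max (cmod u) (cmod v)" using norm_triangle_ineq4[of u v] by linarith
  then have "cmod (u - v) powr p \<le> (2 * max (cmod u) (cmod v)) powr p"
    using assms by (intro powr_mono2) auto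
  also have "\<dots> = 2 powr p * (max (cmod u) (cmod v)) powr p" by (simp add: powr_mult)
  also have "(max (cmod u) (cmod v)) powr p \<le> cmod u powr p + cmod v powr p" by (simp add: max_def)
  finally show ?thesis by (simp add: mult_left_mono)
qed

text \<open>The proof applies Fatou's lemma to \<open>2\<^sup>p (|f\<^sub>n|\<^sup>p + |f|\<^sup>p) - |f\<^sub>n - f|\<^sup>p\<close>.\<close>

lemma bergman_norm_tendsto_of_pointwise:
  fixes fs :: "nat \<Rightarrow> complex \<Rightarrow> complex"
  assumes f: "f \<in> bergman_space p \<alpha>" and fs: "\<And>n. fs n \<in> bergman_space p \<alpha>"
    and lim: "\<And>z. z \<in> \<bbbD> \<Longrightarrow> (\<lambda>n. fs n z) \<longlonglongrightarrow> f z"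
    and le: "\<And>n. bergman_pow p \<alpha> (fs n) \<le> ennreal (c n) * bergman_pow p \<alpha> f"
    and c: "c \<longlonglongrightarrow> 1" "\<And>n. c n \<ge> 0"
    and p: "p > 1" and a: "\<alpha> \<ge> 0"
  shows "(\<lambda>n. bergman_norm p \<alpha> (\<lambda>z. fs n z - f z)) \<longlonglongrightarrow> 0"
proof -
  define P where "P = bergman_norm p \<alpha> f powr p"
  define A where "A n = bergman_norm p \<alpha> (\<lambda>z. fs n z - f z) powr p" for n
  define X where "X n = (\<integral>\<^sup>+z. ennreal (2 powr p * (cmod (fs n z) powr p + cmod (f z) powr p) - cmod (fs n z - f z) powr p) \<partial>bergman_measure \<alpha>)" for n
  have P: "bergman_pow p \<alpha> f = ennreal P" by (simp add: P_def bergman_pow_eq_norm[OF f p])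
  have P0: "P \<ge> 0" by (simp add: P_def)
  note [measurable] = bergman_space_measurable[OF f] bergman_space_measurable[OF fs]
  note conv = norm_diff_powr_le[OF less_imp_le[OF p]]
  \<comment> \<open>The integrand of \<open>X n\<close> is nonnegative by
    \<open>norm_diff_powr_le\<close>, so \<open>X n\<close> and \<open>A n\<close> add up to the
    integral of the majorant. The hypothesis on the norms bounds this by a quantity tending to
    \<open>2 powr p * 2 * P\<close>, which is also the lower bound for \<open>X n\<close> from
    Fatou's lemma; nothing is left for \<open>A n\<close>.\<close>
  have XA: "X n + ennreal (A n) \<le> ennreal (2 powr p * (c n + 1) * P)" for n
  proof -
    have "X n + ennreal (A n) = X n + bergman_pow p \<alpha> (\<lambda>z. fs n z - f z)"
      using bergman_pow_eq_norm[OF bergman_diff(1)[OF fs f p a] p] by (simp add: A_def)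
    also have "\<dots> = (\<integral>\<^sup>+z. ennreal (2 powr p * (cmod (fs n z) powr p + cmod (f z) powr p) - cmod (fs n z - f z) powr p) + ennreal (cmod (fs n z - f z) powr p) \<partial>bergman_measure \<alpha>)"
      unfolding X_def bergman_pow_def by (rule nn_integral_add[symmetric]) measurable
    also have "\<dots> = (\<integral>\<^sup>+z. ennreal (2 powr p) * (ennreal (cmod (fs n z) powr p) + ennreal (cmod (f z) powr p)) \<partial>bergman_measure \<alpha>)"
      using conv by (intro nn_integral_cong) (simp add: ennreal_plus[symmetric] ennreal_mult[symmetric] del: ennreal_plus)
    also have "\<dots> = ennreal (2 powr p) * (bergman_pow p \<alpha> (fs n) + bergman_pow p \<alpha> f)"
      unfolding bergman_pow_def by (subst nn_integral_cmult) (auto simp: nn_integral_add)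
    also have "\<dots> \<le> ennreal (2 powr p) * (ennreal (c n) * ennreal P + ennreal P)"
      using le[of n] unfolding P by (intro mult_left_mono add_right_mono) auto
    also have "\<dots> = ennreal (2 powr p * (c n + 1) * P)"
      using P0 c(2)[of n] by (simp add: ennreal_mult[symmetric] ennreal_plus[symmetric] algebra_simps del: ennreal_plus)
    finally show ?thesis .
  qed
  define K where "K = 2 powr p * 2 * P"
  have K0: "K \<ge> 0" using P0 by (simp add: K_def)
  have "ennreal K = (\<integral>\<^sup>+z. ennreal (2 powr p * 2) * ennreal (cmod (f z) powr p) \<partial>bergman_measure \<alpha>)"
    using P P0 by (subst nn_integral_cmult) (auto simp: K_def bergman_pow_def ennreal_mult)
  also have "\<dots> = (\<integral>\<^sup>+z. liminf (\<lambda>n. ennreal (2 powr p * (cmod (fs n z) powr p + cmod (f z) powr p) - cmod (fs n z - f z) powr p)) \<partial>bergman_measure \<alpha>)"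
  proof (rule nn_integral_cong)
    fix z assume "z \<in> space (bergman_measure \<alpha>)"
    then have z: "(\<lambda>n. fs n z) \<longlonglongrightarrow> f z" using lim by (simp add: space_bergman_measure)
    have "(\<lambda>n. ennreal (2 powr p * (cmod (fs n z) powr p + cmod (f z) powr p) - cmod (fs n z - f z) powr p))
       \<longlonglongrightarrow> ennreal (2 powr p * (cmod (f z) powr p + cmod (f z) powr p) - cmod (f z - f z) powr p)"
      using p by (intro tendsto_intros tendsto_powr' z) auto
    from lim_imp_Liminf[OF _ this]
    show "ennreal (2 powr p * 2) * ennreal (cmod (f z) powr p) = liminf (\<lambda>n. ennreal (2 powr p * (cmod (fs n z) powr p + cmod (f z) powr p) - cmod (fs n z - f z) powr p))"
      using p by (simp add: ennreal_mult[symmetric])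
  qed
  also have "\<dots> \<le> liminf X"
    unfolding X_def by (rule nn_integral_liminf) measurable
  finally have lower: "ennreal K \<le> liminf X" .
  have Alim: "A \<longlonglongrightarrow> 0"
  proof (rule LIMSEQ_I)
    fix e :: real assume e: "e > 0"
    \<comment> \<open>If \<open>K - e / 2\<close> is not positive, \<open>ennreal\<close> truncates
      it to 0 and the claim is trivial; in that case the estimate of \<open>A n\<close> below simply
      drops \<open>X n\<close>.\<close>
    have ev1: "eventually (\<lambda>n. ennreal (K - e / 2) \<le> X n) sequentially"
    proof (cases "K \<le> e / 2")
      case False
      then have "ennreal (K - e / 2) < ennreal K" using e by (intro ennreal_lessI) auto
      then have "ennreal (K - e / 2) < liminf X" using lower by (rule less_le_trans)
      then show ?thesis by (auto dest!: less_LiminfD elim!: eventually_mono simp: less_imp_le)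
    qed (simp add: ennreal_neg)
    have "(\<lambda>n. 2 powr p * (c n + 1) * P) \<longlonglongrightarrow> 2 powr p * (1 + 1) * P"
      by (intro tendsto_intros c)
    then have "(\<lambda>n. 2 powr p * (c n + 1) * P) \<longlonglongrightarrow> K" by (simp add: K_def)
    then have ev2: "eventually (\<lambda>n. 2 powr p * (c n + 1) * P < K + e / 2) sequentially"
      by (rule order_tendstoD) (use e in simp)
    from ev1 ev2 have "eventually (\<lambda>n. A n < e) sequentially"
    proof eventually_elim
      case (elim n)
      have A0: "A n \<ge> 0" by (simp add: A_def)
      show ?case
      proof (cases "K \<le> e / 2")
        case True
        have "ennreal (A n) \<le> X n + ennreal (A n)" by simp
        also note XA
        finally have "A n \<le> 2 powr p * (c n + 1) * P" using P0 c(2)[of n] by (subst (asm) ennreal_le_iff) auto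
        then show ?thesis using elim True by linarith
      next
        case False
        have "ennreal (K - e / 2 + A n) = ennreal (K - e / 2) + ennreal (A n)"
          using False A0 by (intro ennreal_plus) auto
        also have "\<dots> \<le> X n + ennreal (A n)" using elim by (intro add_right_mono)
        also note XA
        finally have "K - e / 2 + A n \<le> 2 powr p * (c n + 1) * P"
          using P0 c(2)[of n] by (subst (asm) ennreal_le_iff) auto
        then show ?thesis using elim by linarith
      qed
    qed
    then show "\<exists>no. \<forall>n\<ge>no. norm (A n - 0) < e"
      by (auto simp: eventually_sequentially A_def)
  qed
  have A0: "A n \<ge> 0" for n by (simp add: A_def)
  have "(\<lambda>n. A n powr (1 / p)) \<longlonglongrightarrow> 0 powr (1 / p)"
    using Alim by (intro tendsto_powr' tendsto_const) (use p A0 in auto)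
  then show ?thesis using p by (simp add: A_def powr_powr bergman_norm_nonneg)
qed

lemma bergman_dilation_tendsto:
  assumes f: "f \<in> bergman_space p \<alpha>" and r: "r \<longlonglongrightarrow> 1" "\<And>n. 0 < r n" "\<And>n. r n < 1"
    and p: "p > 1" and a: "\<alpha> \<ge> 0"
  shows "(\<lambda>n. bergman_norm p \<alpha> (\<lambda>z. f (of_real (r n) * z) - f z)) \<longlonglongrightarrow> 0"
proof (rule bergman_norm_tendsto_of_pointwise[OF f _ _ _ _ _ p a])
  show "bergman_pow p \<alpha> (\<lambda>z. f (of_real (r n) * z)) \<le> ennreal (1 / (r n)\<^sup>2) * bergman_pow p \<alpha> f" for n
    by (rule bergman_pow_dilation_le[OF f r(2,3) a])
  show "(\<lambda>z. f (of_real (r n) * z)) \<in> bergman_space p \<alpha>" for n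
    by (rule bergman_dilation(1)[OF f r(2,3) a p])
  have "(\<lambda>n. 1 / (r n)\<^sup>2) \<longlonglongrightarrow> 1 / 1\<^sup>2" by (intro tendsto_intros r) auto
  then show "(\<lambda>n. 1 / (r n)\<^sup>2) \<longlonglongrightarrow> 1" by simp
  show "(\<lambda>n. f (of_real (r n) * z)) \<longlonglongrightarrow> f z" if z: "z \<in> \<bbbD>" for z
  proof -
    have "isCont f z" using bergman_space_continuous[OF f] z by (simp add: continuous_on_eq_continuous_at)
    moreover have "(\<lambda>n. of_real (r n) * z) \<longlonglongrightarrow> of_real 1 * z" by (intro tendsto_intros r)
    ultimately show ?thesis by (intro isCont_tendsto_compose[of z f]) simp_all
  qed
qed simp

lemma bergman_norm_le_sup:
  assumes h: "h holomorphic_on \<bbbD>" and e: "\<And>z. z \<in> \<bbbD> \<Longrightarrow> cmod (h z) \<le> e" "e \<ge> 0"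
    and p: "p > 1" and a: "\<alpha> \<ge> 0"
  shows "h \<in> bergman_space p \<alpha>"
    and "bergman_norm p \<alpha> h \<le> e * (measure (bergman_measure \<alpha>) \<bbbD>) powr (1 / p)"
proof -
  interpret finite_measure "bergman_measure \<alpha>" by (rule finite_measure_bergman[OF a])
  have "bergman_pow p \<alpha> h \<le> (\<integral>\<^sup>+z. ennreal (e powr p) \<partial>bergman_measure \<alpha>)"
    unfolding bergman_pow_def using e p
    by (intro nn_integral_mono ennreal_leI powr_mono2) (auto simp: space_bergman_measure)
  also have "\<dots> = ennreal ((e * (measure (bergman_measure \<alpha>) \<bbbD>) powr (1 / p)) powr p)"
    using e p by (simp add: space_bergman_measure emeasure_eq_measure ennreal_mult[symmetric] powr_mult powr_powr)
  finally have *: "bergman_pow p \<alpha> h \<le> ennreal ((e * (measure (bergman_measure \<alpha>) \<bbbD>) powr (1 / p)) powr p)" .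
  show "h \<in> bergman_space p \<alpha>"
    and "bergman_norm p \<alpha> h \<le> e * (measure (bergman_measure \<alpha>) \<bbbD>) powr (1 / p)"
    using bergman_leI[OF h _ p *] e by simp_all
qed

text \<open>The approximating function is a step function in \<open>t\<close> of the dilations \<open>z \<mapsto> F t (r z)\<close>, which
  depend continuously on \<open>t\<close> in the supremum norm of the disc.\<close>

lemma bergman_simple_approx:
  fixes F :: "real \<Rightarrow> complex \<Rightarrow> complex"
  assumes cont: "continuous_on ({0<..<1} \<times> \<bbbD>) (\<lambda>(t, z). F t z)"
    and F: "\<And>t. t \<in> {0<..<1} \<Longrightarrow> F t \<in> bergman_space p \<alpha>"
    and fin: "(\<integral>\<^sup>+t. ennreal (bergman_norm p \<alpha> (F t)) \<partial>\<L>) < \<infinity>"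
    and p: "p > 1" and a: "\<alpha> \<ge> 0" and e: "e > 0"
  obtains s where "bergman_simple p \<alpha> s"
    "(\<lambda>t. bergman_norm p \<alpha> (\<lambda>z. F t z - s t z)) \<in> borel_measurable \<L>"
    "(\<integral>\<^sup>+t. ennreal (bergman_norm p \<alpha> (\<lambda>z. F t z - s t z)) \<partial>\<L>) \<le> ennreal e"
proof -
  have [simp]: "space \<L> = {0<..<1}" by (simp add: space_restrict_space)
  have Fm [measurable]: "(\<lambda>x. F (fst x) (snd x)) \<in> borel_measurable (\<L> \<Otimes>\<^sub>M bergman_measure \<alpha>)"
    using borel_measurable_pair_bergman[OF cont] by (simp add: case_prod_unfold)
  have nm [measurable]: "(\<lambda>t. bergman_norm p \<alpha> (F t)) \<in> borel_measurable \<L>"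
    by (rule borel_measurable_bergman_norm[OF _ a]) (simp add: case_prod_unfold)
  \<comment> \<open>After dilation the functions are continuous up to the closed disc, so
    compactness becomes available.\<close>
  have dil: "continuous_on ({0<..<1} \<times> cball 0 1) (\<lambda>(t, z). F t (of_real r * z))"
    if r: "0 < r" "r < 1" for r
  proof -
    have "(t, of_real r * z) \<in> {0<..<1} \<times> \<bbbD>" if "(t, z) \<in> {0<..<1} \<times> cball 0 1" for t and z :: complex
    proof -
      have "r * cmod z \<le> r * 1" using that r by (intro mult_left_mono) auto
      then have "r * cmod z < 1" using r by linarith
      then show ?thesis using that r by (auto simp: norm_mult)
    qed
    then show ?thesis
      using continuous_on_compose2[OF cont, of "{0<..<1} \<times> cball 0 1" "\<lambda>x. (fst x, of_real r * snd x)"]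
      by (force simp: case_prod_unfold intro!: continuous_intros)
  qed
  have dil': "continuous_on ({0<..<1} \<times> \<bbbD>) (\<lambda>(t, z). F t (of_real r * z))"
    if r: "0 < r" "r < 1" for r
    by (rule continuous_on_subset[OF dil[OF r]]) auto
  define R where "R n = 1 - 1 / (real n + 2)" for n
  have R: "0 < R n" "R n < 1" "1 / 2 \<le> R n" for n
    by (auto simp: R_def field_simps)
  have R1: "R \<longlonglongrightarrow> 1" unfolding R_def by real_asymp
  \<comment> \<open>The dominating constant 5 is 4 for the dilated function, uniformly because
    \<open>R n \<ge> 1 / 2\<close>, plus 1 for the function itself.\<close>
  have "(\<lambda>n. \<integral>\<^sup>+t. ennreal (bergman_norm p \<alpha> (\<lambda>z. F t (of_real (R n) * z) - F t z)) \<partial>\<L>) \<longlonglongrightarrow> (\<integral>\<^sup>+t. 0 \<partial>\<L>)"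
  proof (rule nn_integral_dominated_convergence[where w = "\<lambda>t. ennreal 5 * ennreal (bergman_norm p \<alpha> (F t))"])
    show "(\<lambda>t. ennreal (bergman_norm p \<alpha> (\<lambda>z. F t (of_real (R n) * z) - F t z))) \<in> borel_measurable \<L>" for n
    proof -
      have "continuous_on ({0<..<1} \<times> \<bbbD>) (\<lambda>(t, z). F t (of_real (R n) * z) - F t z)"
        using continuous_on_diff[OF dil'[OF R(1,2)] cont] by (simp add: case_prod_unfold)
      from borel_measurable_bergman_norm[OF borel_measurable_pair_bergman[OF this] a]
      show ?thesis by measurable
    qed
    show "AE t in \<L>. ennreal (bergman_norm p \<alpha> (\<lambda>z. F t (of_real (R n) * z) - F t z)) \<le> ennreal 5 * ennreal (bergman_norm p \<alpha> (F t))" for n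
    proof (rule AE_I2)
      fix t assume "t \<in> space \<L>"
      then have Ft: "F t \<in> bergman_space p \<alpha>" using F by simp
      have "bergman_norm p \<alpha> (\<lambda>z. F t (of_real (R n) * z) - F t z) \<le> 5 * bergman_norm p \<alpha> (F t)"
        using bergman_diff(2)[OF bergman_dilation(1)[OF Ft R(1)[of n] R(2)[of n] a p] Ft p a] bergman_dilation(2)[OF Ft R(1)[of n] R(2)[of n] a p R(3)[of n]]
        by linarith
      then show "ennreal (bergman_norm p \<alpha> (\<lambda>z. F t (of_real (R n) * z) - F t z)) \<le> ennreal 5 * ennreal (bergman_norm p \<alpha> (F t))"
        by (subst ennreal_mult[symmetric]) (auto simp: bergman_norm_nonneg intro!: ennreal_leI)
    qed
    show "(\<integral>\<^sup>+t. ennreal 5 * ennreal (bergman_norm p \<alpha> (F t)) \<partial>\<L>) < \<infinity>"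
      using fin by (subst nn_integral_cmult) (auto simp: ennreal_mult_less_top)
    show "AE t in \<L>. (\<lambda>n. ennreal (bergman_norm p \<alpha> (\<lambda>z. F t (of_real (R n) * z) - F t z))) \<longlonglongrightarrow> 0"
      using tendsto_ennrealI[OF bergman_dilation_tendsto[OF F R1 R(1,2) p a]]
      by (intro AE_I2) simp
  qed auto
  then have "eventually (\<lambda>n. (\<integral>\<^sup>+t. ennreal (bergman_norm p \<alpha> (\<lambda>z. F t (of_real (R n) * z) - F t z)) \<partial>\<L>) < ennreal (e / 3)) sequentially"
    by (rule order_tendstoD) (use e in simp)
  then obtain n where n: "(\<integral>\<^sup>+t. ennreal (bergman_norm p \<alpha> (\<lambda>z. F t (of_real (R n) * z) - F t z)) \<partial>\<L>) < ennreal (e / 3)"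
    by (auto simp: eventually_sequentially)
  define r where "r = R n"
  define D where "D t z = F t (of_real r * z)" for t z
  have r: "0 < r" "r < 1" "1 / 2 \<le> r" using R by (auto simp: r_def)
  have Db: "D t \<in> bergman_space p \<alpha>" "bergman_norm p \<alpha> (D t) \<le> 4 * bergman_norm p \<alpha> (F t)" if "t \<in> {0<..<1}" for t
    unfolding D_def using bergman_dilation[OF F[OF that] r(1,2) a p] r(3) by auto
  have D1: "(\<integral>\<^sup>+t. ennreal (bergman_norm p \<alpha> (\<lambda>z. D t z - F t z)) \<partial>\<L>) < ennreal (e / 3)"
    using n by (simp add: D_def r_def)
  have Dc: "continuous_on ({0<..<1} \<times> \<bbbD>) (\<lambda>(t, z). D t z)" using dil'[OF r(1,2)] by (simp add: D_def)
  have Dm [measurable]: "(\<lambda>x. D (fst x) (snd x)) \<in> borel_measurable (\<L> \<Otimes>\<^sub>M bergman_measure \<alpha>)"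
    using borel_measurable_pair_bergman[OF Dc] by (simp add: case_prod_unfold)
  have Dn [measurable]: "(\<lambda>t. bergman_norm p \<alpha> (D t)) \<in> borel_measurable \<L>"
    by (rule borel_measurable_bergman_norm[OF _ a]) (simp add: case_prod_unfold)
  \<comment> \<open>Uniform continuity in \<open>t\<close> needs a compact interval, so the ends of
    the unit interval are cut off at the cost of a small integral. The 3 keeps \<open>A k\<close>
    below \<open>1 / 2\<close>.\<close>
  define A where "A k = 1 / (real k + 3)" for k :: nat
  have idm [measurable]: "(\<lambda>x. x) \<in> measurable \<L> borel"
    by (intro measurable_restrict_space1 measurable_completion) auto
  have "(\<lambda>k. \<integral>\<^sup>+t. ennreal (bergman_norm p \<alpha> (D t)) * indicator (- {A k..1 - A k}) t \<partial>\<L>) \<longlonglongrightarrow> (\<integral>\<^sup>+t. 0 \<partial>\<L>)"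
  proof (rule nn_integral_dominated_convergence[where w = "\<lambda>t. ennreal 4 * ennreal (bergman_norm p \<alpha> (F t))"])
    show "AE t in \<L>. ennreal (bergman_norm p \<alpha> (D t)) * indicator (- {A k..1 - A k}) t \<le> ennreal 4 * ennreal (bergman_norm p \<alpha> (F t))" for k
    proof (rule AE_I2)
      fix t assume "t \<in> space \<L>"
      then have "ennreal (bergman_norm p \<alpha> (D t)) \<le> ennreal 4 * ennreal (bergman_norm p \<alpha> (F t))"
        using Db(2)[of t] by (subst ennreal_mult[symmetric]) (auto simp: bergman_norm_nonneg intro!: ennreal_leI)
      then show "ennreal (bergman_norm p \<alpha> (D t)) * indicator (- {A k..1 - A k}) t \<le> ennreal 4 * ennreal (bergman_norm p \<alpha> (F t))"
        by (auto simp: indicator_def)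
    qed
    show "(\<integral>\<^sup>+t. ennreal 4 * ennreal (bergman_norm p \<alpha> (F t)) \<partial>\<L>) < \<infinity>"
      using fin by (subst nn_integral_cmult) (auto simp: ennreal_mult_less_top)
    show "AE t in \<L>. (\<lambda>k. ennreal (bergman_norm p \<alpha> (D t)) * indicator (- {A k..1 - A k}) t) \<longlonglongrightarrow> 0"
    proof (rule AE_I2)
      fix t assume "t \<in> space \<L>"
      then have t: "0 < min t (1 - t)" by simp
      have "A \<longlonglongrightarrow> 0" unfolding A_def by real_asymp
      then have "eventually (\<lambda>k. A k < min t (1 - t)) sequentially" using t by (rule order_tendstoD)
      then have "eventually (\<lambda>k. ennreal (bergman_norm p \<alpha> (D t)) * indicator (- {A k..1 - A k}) t = 0) sequentially"
        by eventually_elim auto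
      then show "(\<lambda>k. ennreal (bergman_norm p \<alpha> (D t)) * indicator (- {A k..1 - A k}) t) \<longlonglongrightarrow> 0"
        by (rule tendsto_eventually)
    qed
  qed auto
  then have "eventually (\<lambda>k. (\<integral>\<^sup>+t. ennreal (bergman_norm p \<alpha> (D t)) * indicator (- {A k..1 - A k}) t \<partial>\<L>) < ennreal (e / 3)) sequentially"
    by (rule order_tendstoD) (use e in simp)
  then obtain k where k: "(\<integral>\<^sup>+t. ennreal (bergman_norm p \<alpha> (D t)) * indicator (- {A k..1 - A k}) t \<partial>\<L>) < ennreal (e / 3)"
    by (auto simp: eventually_sequentially)
  define b where "b = A k"
  have b: "0 < b" "b < 1 / 2" by (auto simp: b_def A_def field_simps)
  define W where "W = (measure (bergman_measure \<alpha>) \<bbbD>) powr (1 / p)"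
  have W: "W \<ge> 0" by (simp add: W_def)
  \<comment> \<open>A uniform error \<eta> on the disc is an error of at most
    \<open>\<eta> * W\<close> in norm.\<close>
  define \<eta> where "\<eta> = e / 3 / (W + 1)"
  have eta: "\<eta> > 0" "\<eta> * W \<le> e / 3"
  proof -
    show "\<eta> > 0" using e W by (simp add: \<eta>_def)
    have "\<eta> * W \<le> \<eta> * (W + 1)" using \<open>\<eta> > 0\<close> by simp
    also have "\<dots> = e / 3"
    proof -
      have "W + 1 \<noteq> 0" using W by linarith
      then show ?thesis unfolding \<eta>_def by (rule nonzero_eq_divide_eq[THEN iffD1, OF _ refl])
    qed
    finally show "\<eta> * W \<le> e / 3" .
  qed
  \<comment> \<open>The interval starts at \<open>b / 2\<close> and not at \<open>b\<close>, because
    rounding \<open>t\<close> down to the grid of mesh \<open>1 / m\<close> moves it by less than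
    \<open>b / 2\<close>.\<close>
  have "uniformly_continuous_on ({b / 2..1 - b} \<times> cball 0 1) (\<lambda>(t, z). D t z)"
  proof (rule compact_uniformly_continuous)
    show "continuous_on ({b / 2..1 - b} \<times> cball 0 1) (\<lambda>(t, z). D t z)"
      using dil[OF r(1,2)] unfolding D_def by (rule continuous_on_subset) (use b in auto)
  qed (auto intro!: compact_Times)
  then obtain d where d: "d > 0" "\<And>x y. x \<in> {b / 2..1 - b} \<times> cball 0 1 \<Longrightarrow> y \<in> {b / 2..1 - b} \<times> cball 0 1 \<Longrightarrow>
      dist y x < d \<Longrightarrow> dist (case y of (t, z) \<Rightarrow> D t z) (case x of (t, z) \<Rightarrow> D t z) < \<eta>"
    using eta(1) unfolding uniformly_continuous_on_def by metis
  obtain m :: nat where m: "m > 0" "1 / m < min d (b / 2)"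
  proof -
    obtain m0 where "inverse (real (Suc m0)) < min d (b / 2)"
      using reals_Archimedean[of "min d (b / 2)"] d(1) b by auto
    then show thesis by (intro that[of "Suc m0"]) (auto simp: inverse_eq_divide)
  qed
  define \<tau> where "\<tau> t = real_of_int \<lfloor>real m * t\<rfloor> / m" for t
  have tau: "\<tau> t \<le> t" "t < \<tau> t + 1 / m" for t
  proof -
    have "real_of_int \<lfloor>real m * t\<rfloor> \<le> real m * t" "real m * t < real_of_int \<lfloor>real m * t\<rfloor> + 1"
      by linarith+
    then show "\<tau> t \<le> t" "t < \<tau> t + 1 / m"
      using m(1) by (simp_all add: \<tau>_def pos_divide_le_eq pos_less_divide_eq add_divide_distrib[symmetric] mult.commute)
  qed
  define s where "s t = (if t \<in> {b..1 - b} then D (\<tau> t) else (\<lambda>z. 0))" for t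
  have taub: "\<tau> t \<in> {b / 2..1 - b}" "dist (\<tau> t) t < d" if "t \<in> {b..1 - b}" for t
    using tau[of t] that m by (auto simp: dist_real_def)
  have ss: "bergman_simple p \<alpha> s"
    unfolding bergman_simple_def
  proof
    \<comment> \<open>\<open>s\<close> factors through an integer index with finitely many values;
      the index -1 stands for the cut-off ends, where \<open>s\<close> is the zero function.\<close>
    define q where "q t = (if t \<in> {b..1 - b} then \<lfloor>real m * t\<rfloor> else -1)" for t
    have qm: "q \<in> measurable \<L> (count_space UNIV)"
      unfolding q_def by measurable
    have "simple_function \<L> q"
      unfolding simple_function_def
    proof safe
      have "q ` space \<L> \<subseteq> {-1..int m}"
      proof (rule image_subsetI)
        fix t assume "t \<in> space \<L>"
        then have t: "0 < t" "t < 1" by auto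
        have "real m * t \<le> real m * 1" using t by (intro mult_left_mono) auto
        then have "\<lfloor>real m * t\<rfloor> \<le> int m" by linarith
        moreover have "0 \<le> real m * t" using t by simp
        then have "-1 \<le> \<lfloor>real m * t\<rfloor>" by linarith
        ultimately show "q t \<in> {-1..int m}" by (auto simp: q_def)
      qed
      then show "finite (q ` space \<L>)" by (rule finite_subset) simp
      show "q -` {q x} \<inter> space \<L> \<in> sets \<L>" for x
        using qm by (rule measurable_sets) simp
    qed
    from simple_function_compose[OF this, of "\<lambda>j. if j \<ge> 0 then D (real_of_int j / m) else (\<lambda>z. 0)"]
    have "simple_function \<L> (\<lambda>t. if q t \<ge> 0 then D (real_of_int (q t) / m) else (\<lambda>z. 0))"
      by (simp add: o_def)
    also have "(\<lambda>t. if q t \<ge> 0 then D (real_of_int (q t) / m) else (\<lambda>z. 0)) = s"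
      using b by (auto simp: q_def s_def \<tau>_def fun_eq_iff not_le)
    finally show "simple_function \<L> s" .
    show "s ` {0<..<1} \<subseteq> bergman_space p \<alpha>"
    proof (rule image_subsetI)
      fix t show "s t \<in> bergman_space p \<alpha>"
        using Db(1)[of "\<tau> t"] taub(1)[of t] b bergman_zero(1)[OF p] by (auto simp: s_def)
    qed
  qed
  have sm [measurable]: "(\<lambda>x. s (fst x) (snd x)) \<in> borel_measurable (\<L> \<Otimes>\<^sub>M bergman_measure \<alpha>)"
    using bergman_simple_measurable(1)[OF ss] by (simp add: case_prod_unfold)
  have meas: "(\<lambda>t. bergman_norm p \<alpha> (\<lambda>z. F t z - s t z)) \<in> borel_measurable \<L>"
    by (rule borel_measurable_bergman_norm[OF _ a]) (simp add: case_prod_unfold)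
  have meas2: "(\<lambda>t. bergman_norm p \<alpha> (\<lambda>z. D t z - F t z)) \<in> borel_measurable \<L>"
    by (rule borel_measurable_bergman_norm[OF _ a]) (simp add: case_prod_unfold)
  \<comment> \<open>Three errors of at most \<open>e / 3\<close> each: dilation, cut-off ends,
    rounding.\<close>
  have "(\<integral>\<^sup>+t. ennreal (bergman_norm p \<alpha> (\<lambda>z. F t z - s t z)) \<partial>\<L>)
    \<le> (\<integral>\<^sup>+t. ennreal (bergman_norm p \<alpha> (\<lambda>z. D t z - F t z)) + (ennreal (bergman_norm p \<alpha> (D t)) * indicator (- {b..1 - b}) t + ennreal (e / 3)) \<partial>\<L>)"
  proof (rule nn_integral_mono)
    fix t assume "t \<in> space \<L>"
    then have t: "t \<in> {0<..<1}" by simp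
    have st: "s t \<in> bergman_space p \<alpha>" using bergman_simple_measurable(2)[OF ss t] .
    have 1: "bergman_norm p \<alpha> (\<lambda>z. F t z - s t z) \<le> bergman_norm p \<alpha> (\<lambda>z. D t z - s t z) + bergman_norm p \<alpha> (\<lambda>z. D t z - F t z)"
      using bergman_diff(2)[OF bergman_diff(1)[OF Db(1)[OF t] st p a] bergman_diff(1)[OF Db(1)[OF t] F[OF t] p a] p a] by simp
    have 2: "ennreal (bergman_norm p \<alpha> (\<lambda>z. D t z - s t z)) \<le> ennreal (bergman_norm p \<alpha> (D t)) * indicator (- {b..1 - b}) t + ennreal (e / 3)"
    proof (cases "t \<in> {b..1 - b}")
      case True
      have "bergman_norm p \<alpha> (\<lambda>z. D t z - s t z) \<le> \<eta> * W"
        unfolding W_def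
      proof (rule bergman_norm_le_sup(2)[OF bergman_space_holomorphic _ _ p a])
        show "(\<lambda>z. D t z - s t z) \<in> bergman_space p \<alpha>" by (rule bergman_diff(1)[OF Db(1)[OF t] st p a])
        show "cmod (D t z - s t z) \<le> \<eta>" if z: "z \<in> \<bbbD>" for z
        proof -
          have "dist (case (t, z) of (t, z) \<Rightarrow> D t z) (case (\<tau> t, z) of (t, z) \<Rightarrow> D t z) < \<eta>"
            using taub[OF True] True z b by (intro d) (auto simp: dist_Pair_Pair dist_commute)
          then show ?thesis using True by (simp add: s_def dist_norm)
        qed
      qed (use eta in simp)
      then show ?thesis using True eta(2) by (auto intro!: ennreal_leI)
    next
      case False
      then have "s t = (\<lambda>z. 0)" unfolding s_def by (rule if_not_P)
      then show ?thesis using False by simp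
    qed
    have "ennreal (bergman_norm p \<alpha> (\<lambda>z. F t z - s t z)) \<le> ennreal (bergman_norm p \<alpha> (\<lambda>z. D t z - F t z)) + ennreal (bergman_norm p \<alpha> (\<lambda>z. D t z - s t z))"
      using 1 by (simp add: ennreal_plus[symmetric] bergman_norm_nonneg add.commute ennreal_leI del: ennreal_plus)
    also have "\<dots> \<le> ennreal (bergman_norm p \<alpha> (\<lambda>z. D t z - F t z)) + (ennreal (bergman_norm p \<alpha> (D t)) * indicator (- {b..1 - b}) t + ennreal (e / 3))"
      using 2 by (rule add_left_mono)
    finally show "ennreal (bergman_norm p \<alpha> (\<lambda>z. F t z - s t z)) \<le> ennreal (bergman_norm p \<alpha> (\<lambda>z. D t z - F t z)) + (ennreal (bergman_norm p \<alpha> (D t)) * indicator (- {b..1 - b}) t + ennreal (e / 3))" .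
  qed
  also have "\<dots> = (\<integral>\<^sup>+t. ennreal (bergman_norm p \<alpha> (\<lambda>z. D t z - F t z)) \<partial>\<L>) + ((\<integral>\<^sup>+t. ennreal (bergman_norm p \<alpha> (D t)) * indicator (- {b..1 - b}) t \<partial>\<L>) + ennreal (e / 3))"
    using meas2 by (subst nn_integral_add) (auto simp: nn_integral_add emeasure_restrict_space)
  also have "\<dots> \<le> ennreal (e / 3) + (ennreal (e / 3) + ennreal (e / 3))"
    using D1 k unfolding b_def by (intro add_mono) auto
  also have "\<dots> = ennreal e" using e by (simp add: ennreal_plus[symmetric] del: ennreal_plus)
  finally show thesis using that[OF ss meas] by blast
qed

text \<open>The candidate is the pointwise integral. By the evaluation bound the integrals of the
  approximating step functions converge to it locally uniformly, so it is holomorphic; Minkowski's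
  inequality upgrades this to convergence in norm.\<close>

lemma has_bergman_integral_exists:
  fixes F :: "real \<Rightarrow> complex \<Rightarrow> complex"
  assumes cont: "continuous_on ({0<..<1} \<times> \<bbbD>) (\<lambda>(t, z). F t z)"
    and F: "\<And>t. t \<in> {0<..<1} \<Longrightarrow> F t \<in> bergman_space p \<alpha>"
    and fin: "(\<integral>\<^sup>+t. ennreal (bergman_norm p \<alpha> (F t)) \<partial>\<L>) < \<infinity>"
    and p: "p > 1" and a: "\<alpha> \<ge> 0"
  shows "\<exists>g. has_bergman_integral p \<alpha> F g"
proof -
  have sp [simp]: "space \<L> = {0<..<1}" by (simp add: space_restrict_space)
  have Fm [measurable]: "(\<lambda>x. F (fst x) (snd x)) \<in> borel_measurable (\<L> \<Otimes>\<^sub>M bergman_measure \<alpha>)"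
    using borel_measurable_pair_bergman[OF cont] by (simp add: case_prod_unfold)
  have nm: "(\<lambda>t. bergman_norm p \<alpha> (F t)) \<in> borel_measurable \<L>"
    by (rule borel_measurable_bergman_norm[OF _ a]) (simp add: case_prod_unfold)
  have Fi: "integrable \<L> (\<lambda>t. F t z)" if z: "z \<in> \<bbbD>" for z
  proof -
    have m: "(\<lambda>t. F t z) \<in> borel_measurable \<L>"
    proof (rule continuous_imp_measurable_on_sets_lebesgue)
      show "continuous_on {0<..<1} (\<lambda>t. F t z)"
      proof -
        have "continuous_on {0<..<1} (\<lambda>t. case (t, z) of (t, z) \<Rightarrow> F t z)"
          by (rule continuous_on_compose2[OF cont]) (use z in \<open>auto intro!: continuous_intros\<close>)
        then show ?thesis by simp
      qed
    qed simp
    obtain C where C: "C > 0" "\<And>f w. f \<in> bergman_space p \<alpha> \<Longrightarrow> cmod w \<le> cmod z \<Longrightarrow> cmod (f w) \<le> C * bergman_norm p \<alpha> f"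
      using bergman_eval_bound[of "cmod z" p \<alpha>] z p a by auto
    have "(\<integral>\<^sup>+t. ennreal (cmod (F t z)) \<partial>\<L>) \<le> (\<integral>\<^sup>+t. ennreal C * ennreal (bergman_norm p \<alpha> (F t)) \<partial>\<L>)"
      using C F by (intro nn_integral_mono) (auto simp: ennreal_mult[symmetric] bergman_norm_nonneg intro!: ennreal_leI)
    also have "\<dots> = ennreal C * (\<integral>\<^sup>+t. ennreal (bergman_norm p \<alpha> (F t)) \<partial>\<L>)"
      using nm by (intro nn_integral_cmult) auto
    also have "\<dots> < \<infinity>" using fin by (simp add: ennreal_mult_less_top)
    finally show ?thesis using m by (intro integrableI_bounded)
  qed
  define e where "e i = 1 / (real i + 1)" for i :: nat
  have e0: "e i > 0" for i by (simp add: e_def)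
  have e1: "e \<longlonglongrightarrow> 0" unfolding e_def by real_asymp
  define Q where "Q i s \<longleftrightarrow> bergman_simple p \<alpha> s \<and> (\<lambda>t. bergman_norm p \<alpha> (\<lambda>z. F t z - s t z)) \<in> borel_measurable \<L> \<and>
    (\<integral>\<^sup>+t. ennreal (bergman_norm p \<alpha> (\<lambda>z. F t z - s t z)) \<partial>\<L>) \<le> ennreal (e i)" for i s
  have "\<exists>s. Q i s" for i
    unfolding Q_def
    by (rule bergman_simple_approx[OF cont F fin p a e0[of i]]; (intro exI conjI)?) assumption+
  then obtain s where "\<And>i. Q i (s i)" by metis
  then have s: "\<And>i. bergman_simple p \<alpha> (s i)"
      "\<And>i. (\<lambda>t. bergman_norm p \<alpha> (\<lambda>z. F t z - s i t z)) \<in> borel_measurable \<L>"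
      "\<And>i. (\<integral>\<^sup>+t. ennreal (bergman_norm p \<alpha> (\<lambda>z. F t z - s i t z)) \<partial>\<L>) \<le> ennreal (e i)"
    unfolding Q_def by simp_all
  define J where "J i = bergman_simple_integral (s i)" for i
  define g where "g z = (LINT t|\<L>. F t z)" for z
  have Jb: "J i \<in> bergman_space p \<alpha>" for i
    unfolding J_def by (rule bergman_simple_integral_in_space[OF s(1) p a])
  have diff: "(\<lambda>z. F t z - s i t z) \<in> bergman_space p \<alpha>" if "t \<in> {0<..<1}" for i t
    by (rule bergman_diff(1)[OF F[OF that] bergman_simple_measurable(2)[OF s(1) that] p a])
  have le: "ennreal (cmod (J i z - g z)) \<le> (\<integral>\<^sup>+t. ennreal (cmod (F t z - s i t z)) \<partial>\<L>)" if z: "z \<in> \<bbbD>" for i z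
  proof -
    note si = bergman_simple_measurable(3,4)[OF s(1)[of i], of z]
    have "integrable \<L> (\<lambda>t. F t z - s i t z)" using Fi[OF z] si(1) by auto
    moreover have "(LINT t|\<L>. F t z - s i t z) = g z - J i z"
      using Fi[OF z] si by (simp add: g_def J_def)
    ultimately show ?thesis
      using integral_norm_bound_ennreal[of \<L> "\<lambda>t. F t z - s i t z"] by (simp add: norm_minus_commute[of "J i z"])
  qed
  have hol: "g holomorphic_on \<bbbD>"
  proof (rule holomorphic_uniform_sequence)
    show "J i holomorphic_on \<bbbD>" for i by (rule bergman_space_holomorphic[OF Jb])
    fix w assume w: "w \<in> \<bbbD>"
    define d where "d = (1 - cmod w) / 2"
    have d: "d > 0" "cmod w + d < 1" using w by (auto simp: d_def field_simps)
    obtain C where C: "C > 0" "\<And>f z. f \<in> bergman_space p \<alpha> \<Longrightarrow> cmod z \<le> cmod w + d \<Longrightarrow> cmod (f z) \<le> C * bergman_norm p \<alpha> f"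
    proof (rule bergman_eval_bound[of "cmod w + d" p \<alpha>])
      show "0 \<le> cmod w + d" using d by simp
    qed (use d p a in auto)
    have cb: "cmod z \<le> cmod w + d" if "z \<in> cball w d" for z
      using that norm_triangle_sub[of z w] by (simp add: dist_norm norm_minus_commute)
    have sub: "cball w d \<subseteq> \<bbbD>" using le_less_trans[OF cb d(2)] by auto
    have est: "cmod (J i z - g z) \<le> C * e i" if z: "z \<in> cball w d" for i z
    proof -
      have "ennreal (cmod (J i z - g z)) \<le> (\<integral>\<^sup>+t. ennreal (cmod (F t z - s i t z)) \<partial>\<L>)"
        using le sub z by blast
      also have "\<dots> \<le> (\<integral>\<^sup>+t. ennreal C * ennreal (bergman_norm p \<alpha> (\<lambda>z. F t z - s i t z)) \<partial>\<L>)"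
        using C(1) C(2)[OF diff cb[OF z]]
        by (intro nn_integral_mono) (auto simp: ennreal_mult[symmetric] bergman_norm_nonneg intro!: ennreal_leI)
      also have "\<dots> = ennreal C * (\<integral>\<^sup>+t. ennreal (bergman_norm p \<alpha> (\<lambda>z. F t z - s i t z)) \<partial>\<L>)"
        using s(2)[of i] by (intro nn_integral_cmult) auto
      also have "\<dots> \<le> ennreal C * ennreal (e i)" using s(3) by (intro mult_left_mono) auto
      finally show ?thesis using C(1) e0[of i] by (simp add: ennreal_mult[symmetric])
    qed
    have "uniform_limit (cball w d) J g sequentially"
    proof (rule uniform_limitI)
      fix \<epsilon> :: real assume eps: "\<epsilon> > 0"
      have "(\<lambda>i. C * e i) \<longlonglongrightarrow> C * 0" by (intro tendsto_intros e1)
      then have "eventually (\<lambda>i. C * e i < \<epsilon>) sequentially" using eps by (intro order_tendstoD(2)) auto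
      then show "\<forall>\<^sub>F n in sequentially. \<forall>x\<in>cball w d. dist (J n x) (g x) < \<epsilon>"
        by eventually_elim (auto simp: dist_norm intro: le_less_trans[OF est])
    qed
    then show "\<exists>d>0. cball w d \<subseteq> \<bbbD> \<and> uniform_limit (cball w d) J g sequentially"
      using d sub by blast
  qed simp
  have Jg: "(\<lambda>z. J i z - g z) \<in> bergman_space p \<alpha>" "bergman_norm p \<alpha> (\<lambda>z. J i z - g z) \<le> e i" for i
  proof -
    have sm: "(\<lambda>x. s i (fst x) (snd x)) \<in> borel_measurable (\<L> \<Otimes>\<^sub>M bergman_measure \<alpha>)"
      using bergman_simple_measurable(1)[OF s(1)] by (simp add: case_prod_unfold)
    have m: "(\<lambda>(t, z). F t z - s i t z) \<in> borel_measurable (\<L> \<Otimes>\<^sub>M bergman_measure \<alpha>)"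
      using Fm sm by (simp add: case_prod_unfold)
    have h: "(\<lambda>z. J i z - g z) holomorphic_on \<bbbD>"
      by (intro holomorphic_intros hol bergman_space_holomorphic[OF Jb])
    show "(\<lambda>z. J i z - g z) \<in> bergman_space p \<alpha>" "bergman_norm p \<alpha> (\<lambda>z. J i z - g z) \<le> e i"
      using bergman_Minkowski[OF m diff s(3) _ h le p a] e0[of i] by auto
  qed
  have gb: "g \<in> bergman_space p \<alpha>"
  proof -
    have "(\<lambda>z. J 0 z - (J 0 z - g z)) \<in> bergman_space p \<alpha>"
      by (rule bergman_diff(1)[OF Jb Jg(1) p a])
    then show ?thesis by simp
  qed
  have "has_bergman_integral p \<alpha> F g"
    unfolding has_bergman_integral_def
  proof (intro conjI exI[of _ s] allI ballI)
    show "(\<lambda>i. \<integral>\<^sup>+t. ennreal (bergman_norm p \<alpha> (\<lambda>z. F t z - s i t z)) \<partial>\<L>) \<longlonglongrightarrow> 0"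
      by (rule tendsto_sandwich[OF _ _ tendsto_const tendsto_ennrealI[OF e1, simplified]])
         (auto intro!: always_eventually s(3))
    show "(\<lambda>i. bergman_norm p \<alpha> (\<lambda>z. bergman_simple_integral (s i) z - g z)) \<longlonglongrightarrow> 0"
      by (rule tendsto_sandwich[OF _ _ tendsto_const e1])
         (use Jg(2) in \<open>auto intro!: always_eventually simp: bergman_norm_nonneg J_def\<close>)
  qed (use F gb s in auto)
  then show ?thesis by blast
qed

lemma bergman_integral_works:
  assumes "has_bergman_integral p \<alpha> F g"
  shows "has_bergman_integral p \<alpha> F (bergman_integral p \<alpha> F)"
  using assms someI_ex[of "has_bergman_integral p \<alpha> F"] by (auto simp: bergman_integral_def)

text \<open>The comparison with \<open>l = 0\<close>. If the integral does not exist,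
  \<open>bergman_integral\<close> is the zero function and the bound is trivial.\<close>

lemma bergman_integral_norm_le:
  assumes F: "(\<lambda>(t, z). F t z) \<in> borel_measurable (\<L> \<Otimes>\<^sub>M bergman_measure \<alpha>)"
    and p: "p > 1" and a: "\<alpha> \<ge> 0"
  shows "ennreal (bergman_norm p \<alpha> (bergman_integral p \<alpha> F)) \<le> (\<integral>\<^sup>+t. ennreal (bergman_norm p \<alpha> (F t)) \<partial>\<L>)"
proof (cases "\<exists>g. has_bergman_integral p \<alpha> F g")
  case True
  then have "has_bergman_integral p \<alpha> F (bergman_integral p \<alpha> F)" using bergman_integral_works by blast
  from has_bergman_integral_norm_diff_le[OF this F _ bergman_zero(1)[OF p] p a, of "\<lambda>_. 0"]
  show ?thesis by simp
next
  case False
  then show ?thesis by (simp add: bergman_integral_def bergman_zero[OF p])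
qed

section \<open>Boundary behaviour of the symbols\<close>

lemma at_boundary_nontrivial: "cmod \<xi> = 1 \<Longrightarrow> at \<xi> within \<bbbD> \<noteq> bot"
  by (simp add: trivial_limit_within islimpt_ball)

text \<open>\<open>Lim\<close> is defined by description. Continuity of the extension on the closed
  disc provides a limit, unique because \<xi> is a limit point of the disc.\<close>

lemma tendsto_boundary_value:
  assumes "extends_continuously_near f \<xi>" and xi: "cmod \<xi> = 1"
  shows "(f \<longlongrightarrow> boundary_value f \<xi>) (at \<xi> within \<bbbD>)"
proof -
  obtain e g where e: "e > 0" and g: "continuous_on (cball 0 1 \<inter> ball \<xi> e) g" "\<And>z. z \<in> \<bbbD> \<inter> ball \<xi> e \<Longrightarrow> g z = f z"
    using assms by (auto simp: extends_continuously_near_def)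
  have "(g \<longlongrightarrow> g \<xi>) (at \<xi> within cball 0 1 \<inter> ball \<xi> e)"
    using g(1) e xi by (auto simp: continuous_on_def)
  then have "(g \<longlongrightarrow> g \<xi>) (at \<xi> within \<bbbD> \<inter> ball \<xi> e)"
    by (rule tendsto_within_subset) auto
  also have "at \<xi> within \<bbbD> \<inter> ball \<xi> e = at \<xi> within \<bbbD>"
    by (rule at_within_nhd[of _ "ball \<xi> e"]) (use e in auto)
  finally have "(g \<longlongrightarrow> g \<xi>) (at \<xi> within \<bbbD>)" .
  moreover have "eventually (\<lambda>z. g z = f z) (at \<xi> within \<bbbD>)"
    unfolding eventually_at using g(2) e by (auto intro!: exI[of _ e] simp: dist_commute)
  ultimately have lim: "(f \<longlongrightarrow> g \<xi>) (at \<xi> within \<bbbD>)" by (rule Lim_transform_eventually)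
  then have "boundary_value f \<xi> = g \<xi>"
    unfolding boundary_value_def by (rule tendsto_Lim[OF at_boundary_nontrivial[OF xi]])
  with lim show ?thesis by simp
qed

text \<open>Composing \<phi> with the disc automorphisms that take 0 to \<open>z\<close> and
  \<open>\<phi> z\<close> to 0 gives a self-map of the disc fixing 0, to which Schwarz's lemma
  applies; the chain rule isolates the derivative of \<phi>.\<close>

lemma Schwarz_Pick:
  assumes hol: "\<phi> holomorphic_on \<bbbD>" and im: "\<phi> ` \<bbbD> \<subseteq> \<bbbD>" and z: "z \<in> \<bbbD>"
  shows "(1 - (cmod z)\<^sup>2) * cmod (deriv \<phi> z) \<le> 1 - (cmod (\<phi> z))\<^sup>2"
proof -
  define w where "w = \<phi> z"
  have z1: "cmod z < 1" using z by simp
  have "\<phi> z \<in> \<bbbD>" using im z by blast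
  then have w1: "cmod w < 1" by (simp add: w_def)
  have sq: "x * cnj x = (of_real (cmod x))\<^sup>2" for x using complex_norm_square[of x] by simp
  have pos: "(cmod z)\<^sup>2 < 1" "(cmod w)\<^sup>2 < 1" using z1 w1 by (simp_all add: abs_square_less_1)
  have wn: "1 - cnj w * w \<noteq> 0" 
    using pos by (metis complex_norm_square mult.commute of_real_1 of_real_eq_iff right_minus_eq less_irrefl)
  define f where "f = Moebius_function 0 w \<circ> \<phi> \<circ> Moebius_function 0 (-z)"
  have m1: "Moebius_function 0 (-z) ` \<bbbD> \<subseteq> \<bbbD>"
    using z1 by (auto intro!: Moebius_function_norm_lt_1)
  have f0: "f 0 = 0" 
    by (simp add: f_def Moebius_function_of_zero Moebius_function_eq_zero w_def)
  have "f holomorphic_on \<bbbD>"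
    unfolding f_def
    by (intro holomorphic_on_compose_gen[OF _ _ m1] holomorphic_on_compose_gen[OF hol _ im] Moebius_function_holomorphic)
       (use z1 w1 in auto)
  moreover have "cmod (f x) < 1" if "cmod x < 1" for x
  proof -
    have "\<phi> (Moebius_function 0 (-z) x) \<in> \<bbbD>" using that m1 im by force
    then show ?thesis using w1 by (auto simp: f_def intro!: Moebius_function_norm_lt_1)
  qed
  ultimately have le: "cmod (deriv f 0) \<le> 1" using Schwarz_Lemma(2)[of f 0] f0 by auto
  have d1: "(Moebius_function 0 (-z) has_field_derivative of_real (1 - (cmod z)\<^sup>2)) (at 0)"
    unfolding Moebius_function_simple[abs_def]
    by (auto intro!: derivative_eq_intros simp: sq)
  have m0: "Moebius_function 0 (-z) 0 = z" by (simp add: Moebius_function_of_zero)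
  have d2: "(\<phi> has_field_derivative deriv \<phi> z) (at (Moebius_function 0 (-z) 0))"
    unfolding m0 by (rule holomorphic_derivI[OF hol _ z]) simp
  have "(Moebius_function 0 w has_field_derivative of_real (1 / (1 - (cmod w)\<^sup>2))) (at w)"
    unfolding Moebius_function_simple[abs_def]
    using wn by (auto intro!: derivative_eq_intros simp: sq mult.commute[of "cnj w"])
  then have d3: "(Moebius_function 0 w has_field_derivative of_real (1 / (1 - (cmod w)\<^sup>2))) (at (\<phi> (Moebius_function 0 (-z) 0)))"
    by (simp add: m0 w_def)
  have "(f has_field_derivative of_real (1 / (1 - (cmod w)\<^sup>2)) * (deriv \<phi> z * of_real (1 - (cmod z)\<^sup>2))) (at 0)"
    unfolding f_def comp_assoc
    by (rule DERIV_chain[OF _ DERIV_chain[OF d2 d1]]) (use d3 in \<open>simp add: o_def\<close>)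
  then have "deriv f 0 = of_real (1 / (1 - (cmod w)\<^sup>2)) * (deriv \<phi> z * of_real (1 - (cmod z)\<^sup>2))"
    by (rule DERIV_imp_deriv)
  then have "cmod (deriv f 0) = cmod (deriv \<phi> z) * (1 - (cmod z)\<^sup>2) / (1 - (cmod w)\<^sup>2)"
    using pos by (simp add: norm_mult norm_divide del: of_real_diff of_real_power of_real_divide of_real_mult)
  then show ?thesis using le pos by (simp add: w_def field_simps)
qed

text \<open>Mean value inequality for \<open>\<phi> z - d * z\<close> on the convex set
  \<open>\<bbbD> \<inter> ball \<xi> \<epsilon>\<close>, where its derivative is smaller than
  \<delta>. The expansion at \<xi> itself follows by letting \<open>w\<close> tend to \<xi>.\<close>

lemma boundary_derivative_expansion:
  assumes hol: "\<phi> holomorphic_on \<bbbD>" and xi: "cmod \<xi> = 1"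
    and lim: "(\<phi> \<longlongrightarrow> \<xi>) (at \<xi> within \<bbbD>)" and der: "(deriv \<phi> \<longlongrightarrow> d) (at \<xi> within \<bbbD>)" and \<delta>: "\<delta> > 0"
  obtains \<epsilon> where "\<epsilon> > 0"
    "\<And>z. z \<in> \<bbbD> \<inter> ball \<xi> \<epsilon> \<Longrightarrow> cmod (deriv \<phi> z - d) < \<delta>"
    "\<And>z w. z \<in> \<bbbD> \<inter> ball \<xi> \<epsilon> \<Longrightarrow> w \<in> \<bbbD> \<inter> ball \<xi> \<epsilon> \<Longrightarrow> cmod (\<phi> z - \<phi> w - d * (z - w)) \<le> \<delta> * cmod (z - w)"
    "\<And>z. z \<in> \<bbbD> \<inter> ball \<xi> \<epsilon> \<Longrightarrow> cmod (\<phi> z - \<xi> - d * (z - \<xi>)) \<le> \<delta> * cmod (z - \<xi>)"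
proof -
  obtain \<epsilon> where e: "\<epsilon> > 0" and dd: "\<And>z. z \<in> \<bbbD> \<Longrightarrow> z \<noteq> \<xi> \<Longrightarrow> dist z \<xi> < \<epsilon> \<Longrightarrow> dist (deriv \<phi> z) d < \<delta>"
    using tendstoD[OF der \<delta>] by (auto simp: eventually_at)
  define S where "S = \<bbbD> \<inter> ball \<xi> \<epsilon>"
  have d': "cmod (deriv \<phi> z - d) < \<delta>" if "z \<in> S" for z
  proof -
    have "z \<noteq> \<xi>" using that xi by (auto simp: S_def)
    then show ?thesis using dd[of z] that by (auto simp: S_def dist_norm norm_minus_commute)
  qed
  have 2: "cmod (\<phi> z - \<phi> w - d * (z - w)) \<le> \<delta> * cmod (z - w)" if "z \<in> S" "w \<in> S" for z w
  proof -
    have "norm ((\<phi> z - d * z) - (\<phi> w - d * w)) \<le> \<delta> * norm (z - w)"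
    proof (rule field_differentiable_bound[of S "\<lambda>z. \<phi> z - d * z" "\<lambda>z. deriv \<phi> z - d"])
      show "convex S" unfolding S_def by (intro convex_Int convex_ball)
      show "((\<lambda>z. \<phi> z - d * z) has_field_derivative deriv \<phi> x - d) (at x within S)" if "x \<in> S" for x
      proof -
        have "(\<phi> has_field_derivative deriv \<phi> x) (at x within S)"
          using holomorphic_derivI[OF hol, of x] that by (auto simp: S_def intro: has_field_derivative_at_within)
        then show ?thesis by (auto intro!: derivative_eq_intros)
      qed
      show "norm (deriv \<phi> x - d) \<le> \<delta>" if "x \<in> S" for x using d'[OF that] by simp
    qed (use that in auto)
    then show ?thesis by (simp add: algebra_simps)
  qed
  have 3: "cmod (\<phi> z - \<xi> - d * (z - \<xi>)) \<le> \<delta> * cmod (z - \<xi>)" if z: "z \<in> S" for z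
  proof (rule tendsto_le[OF at_boundary_nontrivial[OF xi]])
    show "((\<lambda>w. cmod (\<phi> z - \<phi> w - d * (z - w))) \<longlongrightarrow> cmod (\<phi> z - \<xi> - d * (z - \<xi>))) (at \<xi> within \<bbbD>)"
      by (intro tendsto_intros lim)
    show "((\<lambda>w. \<delta> * cmod (z - w)) \<longlongrightarrow> \<delta> * cmod (z - \<xi>)) (at \<xi> within \<bbbD>)"
      by (intro tendsto_intros)
    have "eventually (\<lambda>w. w \<in> S) (at \<xi> within \<bbbD>)"
      unfolding eventually_at S_def using e by (auto intro!: exI[of _ \<epsilon>] simp: dist_commute)
    then show "\<forall>\<^sub>F w in at \<xi> within \<bbbD>. cmod (\<phi> z - \<phi> w - d * (z - w)) \<le> \<delta> * cmod (z - w)"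
      by eventually_elim (rule 2[OF z])
  qed
  show thesis by (rule that[OF e]) (use d' 2 3 in \<open>auto simp: S_def\<close>)
qed

text \<open>To first order \<phi> sends the displacement \<open>- \<xi> v\<close> from \<xi> to
  \<open>- \<xi> d v\<close>. Displacements with \<open>Re v > 0\<close> enter the disc and the
  image stays in the disc, so \<open>Re (d * v) \<ge> 0\<close>. Multiplication by \<open>d\<close>
  thus maps the right half-plane into its closure, which forces \<open>d\<close> to be real and
  nonnegative.\<close>

lemma boundary_derivative_nonneg_real:
  assumes hol: "\<phi> holomorphic_on \<bbbD>" and im: "\<phi> ` \<bbbD> \<subseteq> \<bbbD>" and xi: "cmod \<xi> = 1"
    and lim: "(\<phi> \<longlongrightarrow> \<xi>) (at \<xi> within \<bbbD>)" and der: "(deriv \<phi> \<longlongrightarrow> d) (at \<xi> within \<bbbD>)"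
  shows "Im d = 0" "Re d \<ge> 0"
proof -
  have xx: "cnj \<xi> * \<xi> = 1" using xi by (metis complex_norm_square mult.commute of_real_1 one_power2)
  have key: "Re (d * v) \<ge> 0" if v: "Re v > 0" for v
  proof -
    have vpos: "cmod v > 0" using v by auto
    have "- (\<delta> * cmod v) \<le> Re (d * v)" if del: "\<delta> > 0" for \<delta>
    proof -
      obtain \<epsilon> where e: "\<epsilon> > 0" and ex: "\<And>z. z \<in> \<bbbD> \<inter> ball \<xi> \<epsilon> \<Longrightarrow> cmod (\<phi> z - \<xi> - d * (z - \<xi>)) \<le> \<delta> * cmod (z - \<xi>)"
        using boundary_derivative_expansion[OF hol xi lim der del] by metis
      \<comment> \<open>Small enough for the point to lie in \<open>ball \<xi> \<epsilon>\<close>,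
        and for the quadratic term of \<open>1 - 2 s Re v + s\<^sup>2 (cmod v)\<^sup>2\<close> to be
        at most half of the linear one.\<close>
      define s where "s = min (\<epsilon> / (2 * cmod v)) (Re v / (cmod v)\<^sup>2)"
      have s: "s > 0" "s * cmod v < \<epsilon>" "s * (cmod v)\<^sup>2 \<le> Re v"
      proof -
        show "s > 0" using e v vpos by (simp add: s_def)
        have "s * cmod v \<le> \<epsilon> / (2 * cmod v) * cmod v" by (intro mult_right_mono) (auto simp: s_def)
        also have "\<dots> < \<epsilon>" using e vpos by simp
        finally show "s * cmod v < \<epsilon>" .
        have "s * (cmod v)\<^sup>2 \<le> Re v / (cmod v)\<^sup>2 * (cmod v)\<^sup>2" by (intro mult_right_mono) (auto simp: s_def)
        then show "s * (cmod v)\<^sup>2 \<le> Re v" using vpos by simp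
      qed
      define z where "z = \<xi> * (1 - of_real s * v)"
      have zx: "z - \<xi> = - (of_real s * \<xi> * v)" by (simp add: z_def algebra_simps)
      have nzx: "cmod (z - \<xi>) = s * cmod v" using s(1) xi by (simp add: zx norm_mult)
      have "(cmod z)\<^sup>2 = (cmod (1 - of_real s * v))\<^sup>2" using xi by (simp add: z_def norm_mult)
      also have "\<dots> = 1 - 2 * s * Re v + s * (s * (cmod v)\<^sup>2)"
        unfolding cmod_power2 by (simp add: power2_eq_square algebra_simps)
      also have "\<dots> \<le> 1 - 2 * s * Re v + s * Re v" using s by (intro add_left_mono mult_left_mono) auto
      also have "\<dots> < 1" using s v by (simp add: algebra_simps)
      finally have zD: "z \<in> \<bbbD>" by (simp add: abs_square_less_1)
      then have "z \<in> \<bbbD> \<inter> ball \<xi> \<epsilon>" using nzx s by (simp add: dist_norm norm_minus_commute)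
      from ex[OF this] have er: "cmod (\<phi> z - \<xi> - d * (z - \<xi>)) \<le> \<delta> * (s * cmod v)" by (simp add: nzx)
      have "cmod (\<phi> z) < 1" using im zD by force
      then have "Re (cnj \<xi> * \<phi> z) < 1"
        using complex_Re_le_cmod[of "cnj \<xi> * \<phi> z"] xi by (simp add: norm_mult)
      moreover have "cnj \<xi> * \<phi> z = cnj \<xi> * (\<phi> z - \<xi> - d * (z - \<xi>)) + cnj \<xi> * \<xi> + (cnj \<xi> * \<xi>) * (- of_real s * (d * v))"
        by (simp add: zx algebra_simps)
      ultimately have "Re (cnj \<xi> * (\<phi> z - \<xi> - d * (z - \<xi>))) + 1 - s * Re (d * v) < 1"
        unfolding xx by simp
      moreover have "- (\<delta> * (s * cmod v)) \<le> Re (cnj \<xi> * (\<phi> z - \<xi> - d * (z - \<xi>)))"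
        using er abs_Re_le_cmod[of "cnj \<xi> * (\<phi> z - \<xi> - d * (z - \<xi>))"] xi by (simp add: norm_mult)
      ultimately have "s * (- (\<delta> * cmod v)) \<le> s * Re (d * v)" by (simp add: algebra_simps)
      then show ?thesis using s(1) by (simp only: mult_le_cancel_left_pos)
    qed
    then have "0 \<le> Re (d * v) + e" if "e > 0" for e
      using that[THEN divide_pos_pos[OF _ vpos]] vpos by force
    then show ?thesis by (rule field_le_epsilon)
  qed
  show R: "Re d \<ge> 0" using key[of 1] by simp
  \<comment> \<open>With \<open>v = Complex 1 y\<close> the inequality reads
    \<open>Re d - y * Im d \<ge> 0\<close>, for every real \<open>y\<close>.\<close>
  have y: "y * Im d \<le> Re d" for y using key[of "Complex 1 y"] by (simp add: mult.commute)
  show "Im d = 0"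
  proof (rule ccontr)
    assume "Im d \<noteq> 0"
    then show False using y[of "(Re d + 1) / Im d"] by simp
  qed
qed

text \<open>The closure of the image is a compact subset of the open disc, so the modulus attains
  its maximum there. For large \<epsilon> the set is empty and any radius serves.\<close>

lemma compact_image_away_from_boundary:
  assumes "closure (\<phi> ` (\<bbbD> - ball \<xi> \<epsilon>)) \<inter> sphere 0 1 = {}" and im: "\<phi> ` \<bbbD> \<subseteq> \<bbbD>"
  obtains R where "0 \<le> R" "R < 1" "\<And>z. z \<in> \<bbbD> - ball \<xi> \<epsilon> \<Longrightarrow> cmod (\<phi> z) \<le> R"
proof (cases "\<bbbD> - ball \<xi> \<epsilon> = {}")
  case True
  show ?thesis by (rule that[of 0]) (use True in auto)
next
  case False
  define K where "K = closure (\<phi> ` (\<bbbD> - ball \<xi> \<epsilon>))"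
  have sub: "K \<subseteq> cball 0 1" unfolding K_def by (rule closure_minimal) (use im in fastforce)+
  then have "compact K" unfolding compact_eq_bounded_closed K_def by (auto intro: bounded_subset[OF bounded_cball])
  moreover have "K \<noteq> {}" using False by (auto simp: K_def)
  ultimately obtain w where w: "w \<in> K" "\<And>v. v \<in> K \<Longrightarrow> cmod v \<le> cmod w"
    using continuous_attains_sup[of K cmod] by (auto intro!: continuous_intros)
  have "cmod w \<noteq> 1" "cmod w \<le> 1" using w(1) assms(1) sub by (auto simp: K_def)
  then show ?thesis
    by (intro that[of "cmod w"]) (auto intro!: w(2) simp: K_def closure_subset[THEN subsetD])
qed

lemma AE_at_eventually_le:
  assumes f: "f \<in> AE_at p \<alpha> \<eta>" and e: "e > 0" "\<epsilon> > 0"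
  shows "eventually (\<lambda>n. \<forall>z\<in>\<bbbD> - ball \<eta> \<epsilon>. cmod (f n z) \<le> e) sequentially"
proof -
  have "(\<lambda>n. SUP z\<in>\<bbbD> - ball \<eta> \<epsilon>. ennreal (cmod (f n z))) \<longlonglongrightarrow> 0"
    using f e by (simp add: AE_at_def)
  then have "eventually (\<lambda>n. (SUP z\<in>\<bbbD> - ball \<eta> \<epsilon>. ennreal (cmod (f n z))) < ennreal e) sequentially"
    by (rule order_tendstoD) (use e in simp)
  then show ?thesis
  proof eventually_elim
    case (elim n)
    show ?case
    proof
      fix z assume "z \<in> \<bbbD> - ball \<eta> \<epsilon>"
      then have "ennreal (cmod (f n z)) \<le> (SUP z\<in>\<bbbD> - ball \<eta> \<epsilon>. ennreal (cmod (f n z)))" by (rule SUP_upper)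
      also note elim
      finally show "cmod (f n z) \<le> e" using e by (simp add: ennreal_less_iff)
    qed
  qed
qed

section \<open>Approximate evaluation maps\<close>

lemma bergman_part_le:
  assumes u: "u \<in> bergman_space p \<alpha>" and g: "\<And>z. z \<in> \<bbbD> \<Longrightarrow> z \<in> E \<Longrightarrow> cmod (g z) \<le> e"
    and e: "e \<ge> 0" and p: "p > 1"
  shows "(\<integral>\<^sup>+z. ennreal (cmod (u z * g z) powr p) * indicator E z \<partial>bergman_measure \<alpha>)
    \<le> ennreal (e powr p * bergman_norm p \<alpha> u powr p)"
proof -
  note [measurable] = bergman_space_measurable[OF u]
  have "(\<integral>\<^sup>+z. ennreal (cmod (u z * g z) powr p) * indicator E z \<partial>bergman_measure \<alpha>)
    \<le> (\<integral>\<^sup>+z. ennreal (e powr p) * ennreal (cmod (u z) powr p) \<partial>bergman_measure \<alpha>)"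
  proof (rule nn_integral_mono)
    fix z assume z: "z \<in> space (bergman_measure \<alpha>)"
    show "ennreal (cmod (u z * g z) powr p) * indicator E z \<le> ennreal (e powr p) * ennreal (cmod (u z) powr p)"
    proof (cases "z \<in> E")
      case True
      have "cmod (g z) powr p \<le> e powr p" using g[of z] z True p by (intro powr_mono2) (auto simp: space_bergman_measure)
      then show ?thesis using True
        by (auto simp: norm_mult powr_mult ennreal_mult[symmetric] mult.commute intro!: ennreal_leI mult_right_mono)
    qed simp
  qed
  also have "\<dots> = ennreal (e powr p) * bergman_pow p \<alpha> u"
    unfolding bergman_pow_def by (rule nn_integral_cmult) measurable
  finally show ?thesis by (simp add: bergman_pow_eq_norm[OF u p] ennreal_mult)
qed

text \<open>The exponent \<open>2 + \<alpha>\<close> arises here: expansion contributes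
  \<open>k powr (-2)\<close> for the area, and Schwarz--Pick gives \<open>1 - (cmod z)\<^sup>2 \<le>
  (1 - (cmod (\<phi> z))\<^sup>2) / k\<close>, whose \<alpha>-th power contributes
  \<open>k powr (-\<alpha>)\<close> for the weight.\<close>

lemma weighted_comp_near_boundary_le:
  assumes hol: "\<phi> holomorphic_on \<bbbD>" and im: "\<phi> ` \<bbbD> \<subseteq> \<bbbD>" and u: "u \<in> bergman_space p \<alpha>"
    and f: "f \<in> bergman_space p \<alpha>" and p: "p > 1" and a: "\<alpha> \<ge> 0" and k: "k > 0"
    and U: "\<And>z. z \<in> \<bbbD> \<inter> ball \<xi> \<epsilon> \<Longrightarrow> cmod (u z) \<le> U"
    and der: "\<And>z. z \<in> \<bbbD> \<inter> ball \<xi> \<epsilon> \<Longrightarrow> k \<le> cmod (deriv \<phi> z)"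
    and low: "\<And>z w. z \<in> \<bbbD> \<inter> ball \<xi> \<epsilon> \<Longrightarrow> w \<in> \<bbbD> \<inter> ball \<xi> \<epsilon> \<Longrightarrow> k * cmod (z - w) \<le> cmod (\<phi> z - \<phi> w)"
  shows "(\<integral>\<^sup>+z. ennreal (cmod (u z * f (\<phi> z)) powr p) * indicator (ball \<xi> \<epsilon>) z \<partial>bergman_measure \<alpha>)
    \<le> ennreal (U powr p * k powr (- (2 + \<alpha>)) * bergman_norm p \<alpha> f powr p)"
proof -
  define B where "B = \<bbbD> \<inter> ball \<xi> \<epsilon>"
  have B: "open B" "B \<subseteq> \<bbbD>" by (auto simp: B_def)
  have cf: "continuous_on \<bbbD> f" by (rule bergman_space_continuous[OF f])
  have cphi: "continuous_on \<bbbD> \<phi>" by (rule holomorphic_on_imp_continuous_on[OF hol])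
  have "continuous_on \<bbbD> (\<lambda>z. u z * f (\<phi> z))"
    by (intro continuous_intros bergman_space_continuous[OF u] continuous_on_compose2[OF cf cphi im])
  then have [measurable]: "(\<lambda>z. u z * f (\<phi> z)) \<in> borel_measurable (bergman_measure \<alpha>)"
    by (rule continuous_on_imp_measurable_bergman)
  note measurable_ident_bergman [measurable]
  have [measurable]: "ball \<xi> \<epsilon> \<in> sets borel" "\<bbbD> \<in> sets borel" by simp_all
  have fm: "(\<lambda>z. indicator \<bbbD> z *\<^sub>R f z) \<in> borel_measurable borel"
    by (rule borel_measurable_continuous_on_indicator[OF _ cf]) auto
  define g where "g z = ennreal (bergman_weight \<alpha> z) * ennreal (cmod (indicator \<bbbD> z *\<^sub>R f z) powr p) * indicator \<bbbD> z" for z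
  have gm: "g \<in> borel_measurable borel" using fm unfolding g_def by measurable
  have g: "(\<integral>\<^sup>+z. g z \<partial>lborel) = ennreal (bergman_norm p \<alpha> f powr p)"
    unfolding bergman_pow_eq_norm[OF f p, symmetric] bergman_pow_def using bergman_space_measurable[OF f]
    by (subst nn_integral_bergman_measure) (auto simp: g_def indicator_def intro!: nn_integral_cong)
  \<comment> \<open>Injectivity gives openness of the image by the open mapping theorem, as the area
    estimate requires.\<close>
  have inj: "inj_on \<phi> B"
  proof (rule inj_onI)
    fix x y assume "x \<in> B" "y \<in> B" "\<phi> x = \<phi> y"
    then have "k * cmod (x - y) \<le> 0" using low[of x y] by (simp add: B_def)
    then show "x = y" using k by (simp add: mult_le_0_iff)
  qed
  have "(\<integral>\<^sup>+z. ennreal (cmod (u z * f (\<phi> z)) powr p) * indicator (ball \<xi> \<epsilon>) z \<partial>bergman_measure \<alpha>)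
    = (\<integral>\<^sup>+z. ennreal (bergman_weight \<alpha> z) * (ennreal (cmod (u z * f (\<phi> z)) powr p) * indicator (ball \<xi> \<epsilon>) z) * indicator \<bbbD> z \<partial>lborel)"
    by (rule nn_integral_bergman_measure) measurable
  also have "\<dots> \<le> (\<integral>\<^sup>+z. ennreal (U powr p * k powr (- \<alpha>)) * (g (\<phi> z) * indicator B z) \<partial>lborel)"
  proof (rule nn_integral_mono)
    fix z
    show "ennreal (bergman_weight \<alpha> z) * (ennreal (cmod (u z * f (\<phi> z)) powr p) * indicator (ball \<xi> \<epsilon>) z) * indicator \<bbbD> z
      \<le> ennreal (U powr p * k powr (- \<alpha>)) * (g (\<phi> z) * indicator B z)"
    proof (cases "z \<in> B")
      case True
      then have zD: "z \<in> \<bbbD>" and zb: "z \<in> ball \<xi> \<epsilon>" by (auto simp: B_def)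
      have fz: "\<phi> z \<in> \<bbbD>" using im zD by blast
      have sz: "(cmod z)\<^sup>2 \<le> 1" using zD by (simp add: abs_square_le_1)
      have "(1 - (cmod z)\<^sup>2) * k \<le> (1 - (cmod z)\<^sup>2) * cmod (deriv \<phi> z)"
        using der[of z] zD zb sz by (intro mult_left_mono) auto
      also have "\<dots> \<le> 1 - (cmod (\<phi> z))\<^sup>2" by (rule Schwarz_Pick[OF hol im zD])
      finally have "1 - (cmod z)\<^sup>2 \<le> (1 - (cmod (\<phi> z))\<^sup>2) / k" using k by (simp add: pos_le_divide_eq)
      then have "(1 - (cmod z)\<^sup>2) powr \<alpha> \<le> ((1 - (cmod (\<phi> z))\<^sup>2) / k) powr \<alpha>"
        using sz a by (intro powr_mono2) auto
      also have "\<dots> = k powr (- \<alpha>) * (1 - (cmod (\<phi> z))\<^sup>2) powr \<alpha>"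
        using k fz by (simp add: powr_divide powr_minus_divide abs_square_le_1)
      finally have "(1 + \<alpha>) / pi * (1 - (cmod z)\<^sup>2) powr \<alpha> \<le> (1 + \<alpha>) / pi * (k powr (- \<alpha>) * (1 - (cmod (\<phi> z))\<^sup>2) powr \<alpha>)"
        using a by (intro mult_left_mono) auto
      then have w: "bergman_weight \<alpha> z \<le> k powr (- \<alpha>) * bergman_weight \<alpha> (\<phi> z)"
        by (simp add: bergman_weight_def mult_ac)
      have "cmod (u z) powr p \<le> U powr p" using U[of z] zD zb p by (intro powr_mono2) auto
      then have "cmod (u z * f (\<phi> z)) powr p \<le> U powr p * cmod (f (\<phi> z)) powr p"
        by (simp add: norm_mult powr_mult mult_right_mono)
      then have "bergman_weight \<alpha> z * cmod (u z * f (\<phi> z)) powr p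
        \<le> (k powr (- \<alpha>) * bergman_weight \<alpha> (\<phi> z)) * (U powr p * cmod (f (\<phi> z)) powr p)"
        using w bergman_weight_nonneg[OF a] by (intro mult_mono) auto
      then have "ennreal (bergman_weight \<alpha> z * cmod (u z * f (\<phi> z)) powr p)
        \<le> ennreal (U powr p * k powr (- \<alpha>) * (bergman_weight \<alpha> (\<phi> z) * cmod (f (\<phi> z)) powr p))"
        by (intro ennreal_leI) (simp add: mult_ac)
      then show ?thesis using True zD zb fz bergman_weight_nonneg[OF a]
        by (simp add: g_def ennreal_mult)
    qed (auto simp: B_def indicator_def)
  qed
  also have "\<dots> = ennreal (U powr p * k powr (- \<alpha>)) * (\<integral>\<^sup>+z. g (\<phi> z) * indicator B z \<partial>lborel)"
  proof (rule nn_integral_cmult)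
    have "(\<lambda>z. indicator B z *\<^sub>R \<phi> z) \<in> borel_measurable borel"
      by (rule borel_measurable_continuous_on_indicator) (use B cphi in \<open>auto intro: continuous_on_subset\<close>)
    then have "(\<lambda>z. g (indicator B z *\<^sub>R \<phi> z) * indicator B z) \<in> borel_measurable borel"
    proof -
      have [measurable]: "B \<in> sets borel" using B by simp
      assume "(\<lambda>z. indicator B z *\<^sub>R \<phi> z) \<in> borel_measurable borel"
      then show ?thesis using gm by measurable
    qed
    also have "(\<lambda>z. g (indicator B z *\<^sub>R \<phi> z) * indicator B z) = (\<lambda>z. g (\<phi> z) * indicator B z)"
      by (auto simp: indicator_def)
    finally show "(\<lambda>z. g (\<phi> z) * indicator B z) \<in> borel_measurable lborel" by simp
  qed
  also have "\<dots> \<le> ennreal (U powr p * k powr (- \<alpha>)) * (ennreal (1 / k\<^sup>2) * ennreal (bergman_norm p \<alpha> f powr p))"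
    unfolding g[symmetric]
    by (intro mult_left_mono nn_integral_expansive_le B gm k open_mapping_thm3[OF _ _ inj] continuous_on_subset[OF cphi]
         holomorphic_on_subset[OF hol]) (use low in \<open>auto simp: B_def\<close>)
  also have "\<dots> = ennreal (U powr p * k powr (- (2 + \<alpha>)) * bergman_norm p \<alpha> f powr p)"
  proof -
    have "k powr (- \<alpha>) * (1 / k\<^sup>2) = k powr (- (2 + \<alpha>))"
    proof -
      have k2: "1 / k\<^sup>2 = k powr (- 2)" using k by (simp add: powr_minus powr_numeral divide_inverse)
      show ?thesis unfolding k2 powr_add[symmetric] by (simp add: algebra_simps)
    qed
    moreover have "U powr p * k powr (- \<alpha>) * (1 / k\<^sup>2 * bergman_norm p \<alpha> f powr p)
        = U powr p * (k powr (- \<alpha>) * (1 / k\<^sup>2)) * bergman_norm p \<alpha> f powr p"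
      by (simp only: mult_ac)
    moreover have "ennreal (U powr p * k powr (- \<alpha>)) * (ennreal (1 / k\<^sup>2) * ennreal (bergman_norm p \<alpha> f powr p))
      = ennreal (U powr p * k powr (- \<alpha>) * (1 / k\<^sup>2 * bergman_norm p \<alpha> f powr p))"
      using k by (subst ennreal_mult[symmetric], simp, simp)+ simp
    ultimately show ?thesis by (simp only:)
  qed
  finally show ?thesis .
qed

lemma eventually_bergman_part_le:
  fixes g :: "nat \<Rightarrow> complex \<Rightarrow> complex"
  assumes u: "u \<in> bergman_space p \<alpha>" and p: "p > 1" and \<kappa>: "\<kappa> > 0"
    and g: "\<And>e. e > 0 \<Longrightarrow> eventually (\<lambda>n. \<forall>z\<in>\<bbbD> \<inter> E. cmod (g n z) \<le> e) sequentially"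
  shows "eventually (\<lambda>n. (\<integral>\<^sup>+z. ennreal (cmod (u z * g n z) powr p) * indicator E z \<partial>bergman_measure \<alpha>) \<le> ennreal \<kappa>) sequentially"
proof -
  define P where "P = bergman_norm p \<alpha> u powr p"
  have P0: "P \<ge> 0" by (simp add: P_def)
  \<comment> \<open>Chosen so that \<open>e powr p * (P + 1) = \<kappa>\<close>; the 1 avoids
    division by 0 when \<open>u\<close> has norm 0.\<close>
  define e where "e = (\<kappa> / (P + 1)) powr (1 / p)"
  have e: "e > 0" using \<kappa> P0 by (simp add: e_def)
  have ep: "e powr p = \<kappa> / (P + 1)" using \<kappa> P0 p by (simp add: e_def powr_powr)
  have le: "e powr p * P \<le> \<kappa>"
  proof -
    have "e powr p * P \<le> e powr p * (P + 1)" by (intro mult_left_mono) auto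
    also have "\<dots> = \<kappa>" unfolding ep using P0 by (intro nonzero_eq_divide_eq[THEN iffD1]) auto
    finally show ?thesis .
  qed
  from g[OF e] show ?thesis
  proof eventually_elim
    case (elim n)
    have "(\<integral>\<^sup>+z. ennreal (cmod (u z * g n z) powr p) * indicator E z \<partial>bergman_measure \<alpha>) \<le> ennreal (e powr p * P)"
      unfolding P_def by (rule bergman_part_le[OF u _ less_imp_le[OF e] p]) (use elim in auto)
    also have "\<dots> \<le> ennreal \<kappa>" using le by (rule ennreal_leI)
    finally show ?case .
  qed
qed

text \<open>Outside \<open>ball \<xi> \<epsilon>\<close> the symbol takes values of modulus at most
  \<open>R < 1\<close>, at distance at least \<open>1 - R\<close> from every boundary point \<eta>,
  so the concentration of \<open>f n\<close> is not seen there, wherever it happens.\<close>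

lemma weighted_comp_AE_outer:
  assumes im: "\<phi> ` \<bbbD> \<subseteq> \<bbbD>" and out: "closure (\<phi> ` (\<bbbD> - ball \<xi> \<epsilon>)) \<inter> sphere 0 1 = {}"
    and u: "u \<in> bergman_space p \<alpha>" and f: "f \<in> AE_at p \<alpha> \<eta>" and eta: "cmod \<eta> = 1"
    and p: "p > 1" and \<kappa>: "\<kappa> > 0"
  shows "eventually (\<lambda>n. (\<integral>\<^sup>+z. ennreal (cmod (u z * f n (\<phi> z)) powr p) * indicator (- ball \<xi> \<epsilon>) z \<partial>bergman_measure \<alpha>) \<le> ennreal \<kappa>) sequentially"
proof (rule eventually_bergman_part_le[OF u p \<kappa>])
  fix e :: real assume e: "e > 0"
  obtain R where R: "0 \<le> R" "R < 1" "\<And>z. z \<in> \<bbbD> - ball \<xi> \<epsilon> \<Longrightarrow> cmod (\<phi> z) \<le> R"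
    by (rule compact_image_away_from_boundary[OF out im]) blast
  have "0 < 1 - R" using R by simp
  from AE_at_eventually_le[OF f e this]
  show "eventually (\<lambda>n. \<forall>z\<in>\<bbbD> \<inter> - ball \<xi> \<epsilon>. cmod (f n (\<phi> z)) \<le> e) sequentially"
  proof eventually_elim
    case (elim n)
    show ?case
    proof
      fix z assume z: "z \<in> \<bbbD> \<inter> - ball \<xi> \<epsilon>"
      then have "cmod (\<phi> z) \<le> R" using R(3) by auto
      moreover have "\<phi> z \<in> \<bbbD>" using z im by blast
      moreover have "1 - cmod (\<phi> z) \<le> dist \<eta> (\<phi> z)" using norm_triangle_ineq2[of \<eta> "\<phi> z"] eta by (simp add: dist_norm)
      ultimately show "cmod (f n (\<phi> z)) \<le> e" using elim by auto
    qed
  qed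
qed

text \<open>The factor \<open>d\<close> is the angular derivative: Schwarz--Pick bounds the weight and the change of
  variables contributes \<open>d\<^sup>-\<^sup>2\<close>.\<close>

lemma weighted_comp_AE_upper:
  assumes hol: "\<phi> holomorphic_on \<bbbD>" and im: "\<phi> ` \<bbbD> \<subseteq> \<bbbD>" and xi: "cmod \<xi> = 1"
    and lim: "(\<phi> \<longlongrightarrow> \<xi>) (at \<xi> within \<bbbD>)" and der: "(deriv \<phi> \<longlongrightarrow> of_real d) (at \<xi> within \<bbbD>)" and d: "d > 0"
    and out: "\<And>\<epsilon>. \<epsilon> > 0 \<Longrightarrow> closure (\<phi> ` (\<bbbD> - ball \<xi> \<epsilon>)) \<inter> sphere 0 1 = {}"
    and u: "u \<in> bergman_space p \<alpha>" and ulim: "(u \<longlongrightarrow> b) (at \<xi> within \<bbbD>)"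
    and T: "\<And>f. f \<in> bergman_space p \<alpha> \<Longrightarrow> weighted_comp u \<phi> f \<in> bergman_space p \<alpha>"
    and f: "f \<in> AE_at p \<alpha> \<eta>" and eta: "cmod \<eta> = 1"
    and p: "p > 1" and a: "\<alpha> \<ge> 0" and K: "K > cmod b * d powr (- ((2 + \<alpha>) / p))"
  shows "eventually (\<lambda>n. bergman_norm p \<alpha> (weighted_comp u \<phi> (f n)) \<le> K) sequentially"
proof -
  have K0: "K > 0" using K by (smt (verit) mult_nonneg_nonneg norm_ge_zero powr_ge_zero)
  have fb: "f n \<in> bergman_space p \<alpha>" "bergman_norm p \<alpha> (f n) = 1" for n
    using f by (auto simp: AE_at_def bergman_sphere_def)
  let ?I = "\<lambda>n E. \<integral>\<^sup>+z. ennreal (cmod (u z * f n (\<phi> z)) powr p) * indicator E z \<partial>bergman_measure \<alpha>"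
  note outer = weighted_comp_AE_outer[OF im out u f eta p]
  \<comment> \<open>The p-th power of the bound is a budget, divided between the part away from
    \<xi> and the part near \<xi>.\<close>
  have total: "bergman_norm p \<alpha> (weighted_comp u \<phi> (f n)) \<le> K"
    if "?I n (- ball \<xi> \<epsilon>) \<le> ennreal x" "?I n (ball \<xi> \<epsilon>) \<le> ennreal y" "x + y \<le> K powr p" "x \<ge> 0" "y \<ge> 0" for n \<epsilon> x y
  proof (rule bergman_leI(2)[OF bergman_space_holomorphic[OF T[OF fb(1)]] less_imp_le[OF K0] p])
    note [measurable] = bergman_space_measurable[OF T[OF fb(1)], of n, unfolded weighted_comp_def]
    note measurable_ident_bergman [measurable]
    have [measurable]: "ball \<xi> \<epsilon> \<in> sets borel" by simp
    have "bergman_pow p \<alpha> (weighted_comp u \<phi> (f n)) = (\<integral>\<^sup>+z. ennreal (cmod (u z * f n (\<phi> z)) powr p) * indicator (- ball \<xi> \<epsilon>) z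
        + ennreal (cmod (u z * f n (\<phi> z)) powr p) * indicator (ball \<xi> \<epsilon>) z \<partial>bergman_measure \<alpha>)"
      unfolding bergman_pow_def weighted_comp_def by (intro nn_integral_cong) (auto simp: indicator_def)
    also have "\<dots> = ?I n (- ball \<xi> \<epsilon>) + ?I n (ball \<xi> \<epsilon>)"
      by (rule nn_integral_add) measurable
    also have "\<dots> \<le> ennreal x + ennreal y" using that by (intro add_mono) auto
    also have "\<dots> = ennreal (x + y)" using that by simp
    also have "\<dots> \<le> ennreal (K powr p)" using that by (intro ennreal_leI)
    finally show "bergman_pow p \<alpha> (weighted_comp u \<phi> (f n)) \<le> ennreal (K powr p)" .
  qed
  show ?thesis
  proof (cases "\<eta> = \<xi>")
    case False
    \<comment> \<open>Concentration happens at another boundary point. Near \<xi> the values of the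
      symbol stay near \<xi>, at distance at least \<rho> from \<eta>, so both parts tend to 0 and
      each may use half of the budget.\<close>
    define \<rho> where "\<rho> = dist \<xi> \<eta> / 2"
    have rho: "\<rho> > 0" using False by (simp add: \<rho>_def)
    obtain \<epsilon> where eps: "\<epsilon> > 0" "\<And>z. z \<in> \<bbbD> \<Longrightarrow> z \<noteq> \<xi> \<Longrightarrow> dist z \<xi> < \<epsilon> \<Longrightarrow> dist (\<phi> z) \<xi> < \<rho>"
      using tendstoD[OF lim rho] by (auto simp: eventually_at)
    have inner: "eventually (\<lambda>n. ?I n (ball \<xi> \<epsilon>) \<le> ennreal (K powr p / 2)) sequentially"
    proof (rule eventually_bergman_part_le[OF u p])
      fix e :: real assume e: "e > 0"
      from AE_at_eventually_le[OF f e rho]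
      show "eventually (\<lambda>n. \<forall>z\<in>\<bbbD> \<inter> ball \<xi> \<epsilon>. cmod (f n (\<phi> z)) \<le> e) sequentially"
      proof eventually_elim
        case (elim n)
        show ?case
        proof
          fix z assume z: "z \<in> \<bbbD> \<inter> ball \<xi> \<epsilon>"
          then have "z \<noteq> \<xi>" using xi by auto
          then have "dist (\<phi> z) \<xi> < \<rho>" using eps(2)[of z] z by (auto simp: dist_commute)
          then have "\<phi> z \<notin> ball \<eta> \<rho>" using dist_triangle[of \<xi> \<eta> "\<phi> z"] by (auto simp: \<rho>_def dist_commute)
          moreover have "\<phi> z \<in> \<bbbD>" using z im by blast
          ultimately show "cmod (f n (\<phi> z)) \<le> e" using elim by auto
        qed
      qed
    qed (use K0 in simp)
    have half: "K powr p / 2 > 0" using K0 by simp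
    from outer[OF eps(1) half] inner show ?thesis
      by eventually_elim (rule total, assumption+, use K0 in auto)
  next
    case True
    \<comment> \<open>\<open>?M \<delta>\<close> is the bound with \<open>u\<close> and the
      derivative perturbed by \<delta>; by continuity it stays below \<open>K\<close> for small
      \<delta>.\<close>
    let ?M = "\<lambda>\<delta>. (cmod b + \<delta>) * (d - \<delta>) powr (- ((2 + \<alpha>) / p))"
    have "(?M \<longlongrightarrow> (cmod b + 0) * (d - 0) powr (- ((2 + \<alpha>) / p))) (at_right 0)"
      using d by (intro tendsto_intros) auto
    then have "eventually (\<lambda>\<delta>. ?M \<delta> < K) (at_right 0)"
      by (rule order_tendstoD) (use K in simp)
    moreover have "eventually (\<lambda>\<delta>. \<delta> \<in> {0<..<d}) (at_right 0)" using d by (rule eventually_at_right_real)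
    ultimately have "eventually (\<lambda>\<delta>. ?M \<delta> < K \<and> 0 < \<delta> \<and> \<delta> < d) (at_right 0)"
      by eventually_elim auto
    then obtain \<delta> where \<delta>: "?M \<delta> < K" "0 < \<delta>" "\<delta> < d"
      using eventually_happens[of _ "at_right (0::real)"] by (auto simp: trivial_limit_at_right_real)
    define k where "k = d - \<delta>"
    have k: "k > 0" using \<delta> by (simp add: k_def)
    obtain \<epsilon>1 where e1: "\<epsilon>1 > 0"
      "\<And>z. z \<in> \<bbbD> \<inter> ball \<xi> \<epsilon>1 \<Longrightarrow> cmod (deriv \<phi> z - of_real d) < \<delta>"
      "\<And>z w. z \<in> \<bbbD> \<inter> ball \<xi> \<epsilon>1 \<Longrightarrow> w \<in> \<bbbD> \<inter> ball \<xi> \<epsilon>1 \<Longrightarrow> cmod (\<phi> z - \<phi> w - of_real d * (z - w)) \<le> \<delta> * cmod (z - w)"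
      by (rule boundary_derivative_expansion[OF hol xi lim der \<delta>(2)]) blast
    obtain \<epsilon>2 where e2: "\<epsilon>2 > 0" "\<And>z. z \<in> \<bbbD> \<Longrightarrow> z \<noteq> \<xi> \<Longrightarrow> dist z \<xi> < \<epsilon>2 \<Longrightarrow> dist (u z) b < \<delta>"
      using tendstoD[OF ulim \<delta>(2)] by (auto simp: eventually_at)
    define \<epsilon> where "\<epsilon> = min \<epsilon>1 \<epsilon>2"
    have eps: "\<epsilon> > 0" using e1 e2 by (simp add: \<epsilon>_def)
    define y where "y = (cmod b + \<delta>) powr p * k powr (- (2 + \<alpha>))"
    have y: "y = ?M \<delta> powr p"
      using p k \<delta> by (simp add: y_def k_def powr_mult powr_powr)
    have yK: "y < K powr p" unfolding y
      by (rule powr_less_mono2) (use \<delta> p in auto)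
    have inner: "?I n (ball \<xi> \<epsilon>) \<le> ennreal y" for n
    proof -
      have "?I n (ball \<xi> \<epsilon>) \<le> ennreal ((cmod b + \<delta>) powr p * k powr (- (2 + \<alpha>)) * bergman_norm p \<alpha> (f n) powr p)"
      proof (rule weighted_comp_near_boundary_le[OF hol im u fb(1) p a k])
        fix z assume z: "z \<in> \<bbbD> \<inter> ball \<xi> \<epsilon>"
        then have z1: "z \<in> \<bbbD> \<inter> ball \<xi> \<epsilon>1" by (auto simp: \<epsilon>_def)
        have "z \<noteq> \<xi>" using z xi by auto
        then have "dist (u z) b < \<delta>" using e2(2)[of z] z by (auto simp: \<epsilon>_def dist_commute)
        then show "cmod (u z) \<le> cmod b + \<delta>" using norm_triangle_sub[of "u z" b] by (simp add: dist_norm)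
        show "k \<le> cmod (deriv \<phi> z)"
          using e1(2)[OF z1] norm_triangle_sub[of "of_real d" "deriv \<phi> z"] d by (simp add: k_def norm_minus_commute)
        fix w assume w: "w \<in> \<bbbD> \<inter> ball \<xi> \<epsilon>"
        then have w1: "w \<in> \<bbbD> \<inter> ball \<xi> \<epsilon>1" by (auto simp: \<epsilon>_def)
        have "cmod (of_real d * (z - w)) \<le> cmod (\<phi> z - \<phi> w) + cmod (\<phi> z - \<phi> w - of_real d * (z - w))"
          using norm_triangle_sub[of "of_real d * (z - w)" "\<phi> z - \<phi> w"] by (simp add: norm_minus_commute)
        then show "k * cmod (z - w) \<le> cmod (\<phi> z - \<phi> w)"
          using e1(3)[OF z1 w1] d by (simp add: k_def norm_mult left_diff_distrib)
      qed
      then show ?thesis by (simp add: fb y_def)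
    qed
    \<comment> \<open>What the part near \<xi> leaves of the budget is positive and goes to the
      outer part.\<close>
    have "K powr p - y > 0" using yK by simp
    from outer[OF eps this] show ?thesis
      by eventually_elim (rule total[OF _ inner], assumption, use yK y_def in auto)
  qed
qed

section \<open>Power functions\<close>

lemma power_branch_holomorphic: "power_branch \<xi> a h \<Longrightarrow> h holomorphic_on \<bbbD>"
proof -
  assume "power_branch \<xi> a h"
  then obtain l where l: "l holomorphic_on \<bbbD>" "\<And>z. z \<in> \<bbbD> \<Longrightarrow> h z = exp (of_real a * l z)"
    by (auto simp: power_branch_def)
  have "(\<lambda>z. exp (of_real a * l z)) holomorphic_on \<bbbD>" by (intro holomorphic_intros l)
  then show ?thesis by (rule holomorphic_transform) (simp add: l(2))
qed

text \<open>\<open>Re (l z)\<close> is the real logarithm of \<open>cmod (\<xi> - z)\<close> for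
  every branch, so moduli and norms do not depend on the branch.\<close>

lemma power_branch_norm:
  assumes "power_branch \<xi> a h" "z \<in> \<bbbD>"
  shows "cmod (h z) = cmod (\<xi> - z) powr a"
proof -
  obtain l where l: "exp (l z) = \<xi> - z" "h z = exp (of_real a * l z)"
    using assms unfolding power_branch_def by blast
  have "cmod (\<xi> - z) = exp (Re (l z))" unfolding l(1)[symmetric] by simp
  then show ?thesis by (simp add: l(2) powr_def)
qed

text \<open>On the disc every logarithm of \<open>\<xi> - z\<close> is a constant plus the principal logarithm of
  \<open>1 - z / \<xi>\<close>, whose imaginary part is less than \<open>\<pi> / 2\<close> in absolute value.\<close>

lemma power_branch_quotient:
  assumes h: "power_branch \<xi> a h" and xi: "cmod \<xi> = 1" and z: "z \<in> \<bbbD>" and w: "w \<in> \<bbbD>"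
    and q: "Re ((\<xi> - w) / (\<xi> - z)) > 0"
  shows "h w = h z * exp (of_real a * Ln ((\<xi> - w) / (\<xi> - z)))"
proof -
  obtain l where l: "l holomorphic_on \<bbbD>" "\<And>z. z \<in> \<bbbD> \<Longrightarrow> exp (l z) = \<xi> - z" "\<And>z. z \<in> \<bbbD> \<Longrightarrow> h z = exp (of_real a * l z)"
    using h by (auto simp: power_branch_def)
  have xi0: "\<xi> \<noteq> 0" using xi by auto
  have re: "Re (1 - x / \<xi>) > 0" if "x \<in> \<bbbD>" for x
  proof -
    have "Re (x / \<xi>) \<le> cmod (x / \<xi>)" by (rule complex_Re_le_cmod)
    then show ?thesis using that xi by (simp add: norm_divide)
  qed
  \<comment> \<open>Differentiating \<open>exp (l x) = \<xi> - x\<close> shows that both logarithms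
    have derivative \<open>- 1 / (\<xi> - x)\<close>, so they differ by a constant.\<close>
  have "((\<lambda>x. l x - Ln (1 - x / \<xi>)) has_field_derivative 0) (at x within \<bbbD>)" if x: "x \<in> \<bbbD>" for x
  proof -
    have nz: "\<xi> - x \<noteq> 0" using x xi by auto
    have dl: "(l has_field_derivative deriv l x) (at x)" by (rule holomorphic_derivI[OF l(1) _ x]) simp
    have "((\<lambda>x. exp (l x)) has_field_derivative exp (l x) * deriv l x) (at x)"
      by (rule DERIV_chain2[OF DERIV_exp dl])
    then have "((\<lambda>x. \<xi> - x) has_field_derivative exp (l x) * deriv l x) (at x)"
      by (rule has_field_derivative_transform_within_open[of _ _ _ \<bbbD>]) (use l(2) x in auto)
    moreover have "((\<lambda>x. \<xi> - x) has_field_derivative - 1) (at x)" by (auto intro!: derivative_eq_intros)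
    ultimately have "exp (l x) * deriv l x = - 1" by (rule DERIV_unique)
    then have e1: "deriv l x = - 1 / (\<xi> - x)" using nz l(2)[OF x] by (simp add: field_simps)
    have "1 - x / \<xi> \<notin> \<real>\<^sub>\<le>\<^sub>0" using re[OF x] by (auto simp: complex_nonpos_Reals_iff)
    then have "((\<lambda>x. Ln (1 - x / \<xi>)) has_field_derivative (- 1 / \<xi>) / (1 - x / \<xi>)) (at x)"
      by (auto intro!: derivative_eq_intros simp: divide_inverse)
    moreover have "(- 1 / \<xi>) / (1 - x / \<xi>) = - 1 / (\<xi> - x)"
      using xi0 nz by (simp add: field_simps)
    ultimately have "((\<lambda>x. l x - Ln (1 - x / \<xi>)) has_field_derivative - 1 / (\<xi> - x) - - 1 / (\<xi> - x)) (at x)"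
      using dl unfolding e1 by (intro DERIV_diff) auto
    then show ?thesis by (auto intro: has_field_derivative_at_within)
  qed
  then obtain C where C: "\<And>x. x \<in> \<bbbD> \<Longrightarrow> l x - Ln (1 - x / \<xi>) = C"
    using has_field_derivative_zero_constant[of \<bbbD> "\<lambda>x. l x - Ln (1 - x / \<xi>)"] convex_ball by blast
  have nz: "\<xi> - z \<noteq> 0" "\<xi> - w \<noteq> 0" "1 - z / \<xi> \<noteq> 0" "1 - w / \<xi> \<noteq> 0" using z w xi re[OF z] re[OF w] by auto
  \<comment> \<open>Equal exponentials give equal logarithms once the imaginary parts differ by less
    than \<open>2 * pi\<close>; here three angles below \<open>pi / 2\<close> add up to less than
    \<open>3 * pi / 2\<close>.\<close>
  have "Ln (1 - w / \<xi>) - Ln (1 - z / \<xi>) = Ln ((\<xi> - w) / (\<xi> - z))"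
  proof (rule exp_complex_eqI)
    have "\<bar>Im (Ln (1 - w / \<xi>))\<bar> < pi / 2" "\<bar>Im (Ln (1 - z / \<xi>))\<bar> < pi / 2" "\<bar>Im (Ln ((\<xi> - w) / (\<xi> - z)))\<bar> < pi / 2"
      using re[OF z] re[OF w] q Re_Ln_pos_lt_imp by blast+
    then show "\<bar>Im (Ln (1 - w / \<xi>) - Ln (1 - z / \<xi>)) - Im (Ln ((\<xi> - w) / (\<xi> - z)))\<bar> < 2 * pi"
      by simp
    show "exp (Ln (1 - w / \<xi>) - Ln (1 - z / \<xi>)) = exp (Ln ((\<xi> - w) / (\<xi> - z)))"
      using nz xi0 by (simp add: exp_diff field_simps)
  qed
  then have "l w = l z + Ln ((\<xi> - w) / (\<xi> - z))" using C[OF z] C[OF w] by (simp add: algebra_simps)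
  then show ?thesis using l(3)[OF z] l(3)[OF w] by (simp add: exp_add[symmetric] distrib_left)
qed

text \<open>Dyadic rings: for \<open>r k \<le> cmod (\<xi> - z) < 2 * r k\<close> the integrand is
  at most \<open>r k powr \<beta>\<close>, and the enclosing ball has area
  \<open>4 * pi * (r k)\<^sup>2\<close>. The contributions form a geometric series of ratio
  \<open>(1 / 2) powr \<beta> / 4\<close>, which is below 1 exactly for
  \<open>\<beta> > -2\<close>.\<close>

lemma nn_integral_boundary_power_finite:
  assumes \<beta>: "- 2 < \<beta>" "\<beta> < 0" and xi: "cmod \<xi> = 1"
  shows "(\<integral>\<^sup>+z. ennreal (cmod (\<xi> - z) powr \<beta>) * indicator \<bbbD> z \<partial>lborel) < \<infinity>"
proof -
  define r :: "nat \<Rightarrow> real" where "r k = (1 / 2) ^ k" for k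
  have r0: "r k > 0" for k by (simp add: r_def)
  let ?u = "\<lambda>k z. ennreal (r k powr \<beta>) * indicator (ball \<xi> (2 * r k)) z"
  have "ennreal (cmod (\<xi> - z) powr \<beta>) * indicator \<bbbD> z \<le> (\<Sum>k. ?u k z)" for z
  proof (cases "z \<in> \<bbbD>")
    case True
    define x where "x = cmod (\<xi> - z)"
    have x: "0 < x" "x < 2" using True xi norm_triangle_ineq4[of \<xi> z] by (auto simp: x_def)
    have "\<exists>k. r k \<le> x"
      using real_arch_pow_inv[of x "1/2"] x by (auto simp: r_def intro: less_imp_le)
    \<comment> \<open>The least such index places the point in its ring by minimality; for index 0
      the upper end of the ring is the diameter 2 of the disc.\<close>
    define k where "k = (LEAST k. r k \<le> x)"
    have k: "r k \<le> x" unfolding k_def by (rule LeastI_ex) fact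
    have "x < 2 * r k"
    proof (cases k)
      case 0
      then show ?thesis using x by (simp add: r_def)
    next
      case (Suc j)
      then have "\<not> r j \<le> x" using not_less_Least[of j "\<lambda>k. r k \<le> x"] by (simp add: k_def)
      then show ?thesis using Suc by (simp add: r_def)
    qed
    then have "z \<in> ball \<xi> (2 * r k)" by (simp add: x_def dist_norm)
    moreover have "x powr \<beta> \<le> r k powr \<beta>" using \<beta> r0 k by (intro powr_mono2') auto
    ultimately have "ennreal (cmod (\<xi> - z) powr \<beta>) * indicator \<bbbD> z \<le> ?u k z"
      using True by (simp add: x_def ennreal_leI)
    also have "\<dots> \<le> (\<Sum>k. ?u k z)"
    proof -
      define v where "v = (\<lambda>k. ?u k z)"
      have "v k \<le> (\<Sum>k. v k)" using sum_le_suminf[of v "{k}"] by simp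
      then show ?thesis by (simp only: v_def)
    qed
    finally show ?thesis .
  qed simp
  then have "(\<integral>\<^sup>+z. ennreal (cmod (\<xi> - z) powr \<beta>) * indicator \<bbbD> z \<partial>lborel) \<le> (\<integral>\<^sup>+z. (\<Sum>k. ?u k z) \<partial>lborel)"
    by (intro nn_integral_mono)
  also have "\<dots> = (\<Sum>k. \<integral>\<^sup>+z. ?u k z \<partial>lborel)"
  proof (rule nn_integral_suminf)
    fix k
    have [measurable]: "ball \<xi> (2 * r k) \<in> sets borel" by simp
    show "?u k \<in> borel_measurable lborel" by measurable
  qed
  also have "\<dots> = (\<Sum>k. ennreal (4 * pi * ((1 / 2) powr \<beta> / 4) ^ k))"
  proof (rule suminf_cong)
    fix k
    have "(\<integral>\<^sup>+z. ?u k z \<partial>lborel) = ennreal (r k powr \<beta>) * emeasure lborel (ball \<xi> (2 * r k))"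
      by (rule nn_integral_cmult_indicator) simp
    also have "\<dots> = ennreal (r k powr \<beta> * (pi * (2 * r k)\<^sup>2))"
      using r0[of k] by (simp add: emeasure_ball unit_ball_vol_2 ennreal_mult)
    also have "r k powr \<beta> * (pi * (2 * r k)\<^sup>2) = 4 * pi * ((1 / 2) powr \<beta> / 4) ^ k"
    proof -
      have "r k powr \<beta> = ((1 / 2) powr \<beta>) ^ k"
        by (simp add: r_def powr_realpow[symmetric] powr_powr mult.commute)
      moreover have "(r k)\<^sup>2 = (1 / 4) ^ k"
        by (simp add: r_def power_mult[symmetric] mult.commute[of k]) (simp add: power_mult power2_eq_square)
      ultimately show ?thesis by (simp add: power_mult_distrib power_divide)
    qed
    finally show "(\<integral>\<^sup>+z. ?u k z \<partial>lborel) = ennreal (4 * pi * ((1 / 2) powr \<beta> / 4) ^ k)" .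
  qed
  also have "\<dots> < \<infinity>"
  proof -
    have "(1 / 2) powr \<beta> = 2 powr (- \<beta>)" by (simp add: powr_divide powr_minus_divide)
    also have "\<dots> < 2 powr 2" using \<beta> by (intro powr_less_mono) auto
    finally have "(1 / 2 :: real) powr \<beta> / 4 < 1" by simp
    then have "summable (\<lambda>k. 4 * pi * ((1 / 2) powr \<beta> / 4) ^ k)"
      by (intro summable_mult summable_geometric) auto
    then show ?thesis by (subst suminf_ennreal_eq[OF _ summable_sums]) auto
  qed
  finally show ?thesis .
qed

text \<open>Since \<open>1 - (cmod z)\<^sup>2 \<le> 2 * cmod (\<xi> - z)\<close>, the integrand is
  at most a constant times \<open>cmod (\<xi> - z) powr \<beta>\<close> with
  \<open>\<beta> = \<alpha> - c * p\<close>. The two bounds on \<open>c\<close> say that \<beta>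
  lies between -2 and 0.\<close>

lemma power_branch_in_bergman_space:
  assumes h: "power_branch \<xi> (- c) h" and xi: "cmod \<xi> = 1" and p: "p > 1" and a: "\<alpha> \<ge> 0"
    and c: "\<alpha> / p < c" "c < (2 + \<alpha>) / p"
  shows "h \<in> bergman_space p \<alpha>" "bergman_norm p \<alpha> h > 0"
proof -
  have hol: "h holomorphic_on \<bbbD>" by (rule power_branch_holomorphic[OF h])
  note [measurable] = borel_measurable_holomorphic_bergman[OF hol, of \<alpha>]
  define \<beta> where "\<beta> = \<alpha> - c * p"
  have b: "- 2 < \<beta>" "\<beta> < 0" using c p by (auto simp: \<beta>_def field_simps)
  define C where "C = (1 + \<alpha>) * 2 powr \<alpha> / pi"
  have C: "C \<ge> 0" using a by (simp add: C_def)
  have [measurable]: "\<bbbD> \<in> sets borel" by simp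
  have "bergman_pow p \<alpha> h = (\<integral>\<^sup>+z. ennreal (bergman_weight \<alpha> z) * ennreal (cmod (h z) powr p) * indicator \<bbbD> z \<partial>lborel)"
    unfolding bergman_pow_def by (rule nn_integral_bergman_measure) measurable
  also have "\<dots> \<le> (\<integral>\<^sup>+z. ennreal C * (ennreal (cmod (\<xi> - z) powr \<beta>) * indicator \<bbbD> z) \<partial>lborel)"
  proof (rule nn_integral_mono)
    fix z
    show "ennreal (bergman_weight \<alpha> z) * ennreal (cmod (h z) powr p) * indicator \<bbbD> z \<le> ennreal C * (ennreal (cmod (\<xi> - z) powr \<beta>) * indicator \<bbbD> z)"
    proof (cases "z \<in> \<bbbD>")
      case True
      define x where "x = cmod (\<xi> - z)"
      have x: "x > 0" using True xi by (auto simp: x_def)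
      have "1 - (cmod z)\<^sup>2 = (1 - cmod z) * (1 + cmod z)" by (simp add: power2_eq_square algebra_simps)
      also have "\<dots> \<le> x * 2" using norm_triangle_ineq2[of \<xi> z] xi True
        by (intro mult_mono) (auto simp: x_def)
      finally have "(1 - (cmod z)\<^sup>2) powr \<alpha> \<le> (x * 2) powr \<alpha>"
        using True a by (intro powr_mono2) (auto simp: abs_square_le_1)
      also have "\<dots> = x powr \<alpha> * 2 powr \<alpha>" using x by (simp add: powr_mult)
      finally have "(1 + \<alpha>) / pi * (1 - (cmod z)\<^sup>2) powr \<alpha> \<le> (1 + \<alpha>) / pi * (x powr \<alpha> * 2 powr \<alpha>)"
        using a by (intro mult_left_mono) auto
      then have "bergman_weight \<alpha> z \<le> C * x powr \<alpha>" by (simp add: bergman_weight_def C_def mult_ac)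
      moreover have "cmod (h z) powr p = x powr (- (c * p))"
        using power_branch_norm[OF h True] by (simp add: x_def powr_powr)
      ultimately have "bergman_weight \<alpha> z * cmod (h z) powr p \<le> C * x powr \<alpha> * x powr (- (c * p))"
        by (simp add: mult_right_mono)
      also have "\<dots> = C * x powr \<beta>" using x by (simp add: \<beta>_def powr_add[symmetric])
      finally have "ennreal (bergman_weight \<alpha> z * cmod (h z) powr p) \<le> ennreal (C * x powr \<beta>)" by (rule ennreal_leI)
      then show ?thesis using True C bergman_weight_nonneg[OF a] by (simp add: ennreal_mult x_def)
    qed simp
  qed
  also have "\<dots> = ennreal C * (\<integral>\<^sup>+z. ennreal (cmod (\<xi> - z) powr \<beta>) * indicator \<bbbD> z \<partial>lborel)"
    by (rule nn_integral_cmult) measurable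
  also have "\<dots> < \<infinity>"
    using nn_integral_boundary_power_finite[OF b xi] by (simp add: ennreal_mult_less_top)
  finally show hb: "h \<in> bergman_space p \<alpha>" using hol by (simp add: bergman_space_iff)
  \<comment> \<open>Positivity of the norm comes from evaluation at 0, where the power function has
    modulus 1.\<close>
  obtain D where D: "D > 0" "\<And>f z. f \<in> bergman_space p \<alpha> \<Longrightarrow> cmod z \<le> 0 \<Longrightarrow> cmod (f z) \<le> D * bergman_norm p \<alpha> f"
    by (rule bergman_eval_bound[of 0 p \<alpha>]) (use p a in auto)
  have "1 \<le> D * bergman_norm p \<alpha> h" using D(2)[OF hb, of 0] power_branch_norm[OF h, of 0] xi by simp
  then show "bergman_norm p \<alpha> h > 0" using D(1) by (smt (verit) mult_nonneg_nonpos)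
qed

text \<open>The balls of radius \<open>r\<^sub>k / 2\<close> about \<open>(1 - r\<^sub>k) \<xi>\<close> all contribute at least a fixed amount.\<close>

lemma nn_integral_boundary_power_critical:
  assumes xi: "cmod \<xi> = 1" and a: "\<alpha> \<ge> 0"
  shows "(\<integral>\<^sup>+z. ennreal (cmod (\<xi> - z) powr (- (2 + \<alpha>))) \<partial>bergman_measure \<alpha>) = \<infinity>"
proof (rule ccontr)
  let ?g = "\<lambda>z. ennreal (cmod (\<xi> - z) powr (- (2 + \<alpha>)))"
  assume "(\<integral>\<^sup>+z. ?g z \<partial>bergman_measure \<alpha>) \<noteq> \<infinity>"
  then have fin: "(\<integral>\<^sup>+z. ?g z \<partial>bergman_measure \<alpha>) < \<infinity>" by (simp add: less_top)
  define r :: "nat \<Rightarrow> real" where "r k = (1 / 2) ^ k" for k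
  have r0: "r k > 0" "r k \<le> 1" for k by (auto simp: r_def power_le_one)
  have rlim: "r \<longlonglongrightarrow> 0" unfolding r_def by (rule LIMSEQ_realpow_zero) auto
  define B where "B k = ball (of_real (1 - r k) * \<xi>) (r k / 2)" for k
  note measurable_ident_bergman [measurable]
  have [measurable]: "B k \<in> sets borel" "\<bbbD> \<in> sets borel" for k by (simp_all add: B_def)
  have upper: "cmod (\<xi> - z) < 3 / 2 * r k" "cmod z < 1 - r k / 2" if z: "z \<in> B k" for z k
  proof -
    have d: "cmod (of_real (1 - r k) * \<xi> - z) < r k / 2" using z by (simp add: B_def dist_norm)
    have "cmod (\<xi> - z) \<le> cmod (\<xi> - of_real (1 - r k) * \<xi>) + cmod (of_real (1 - r k) * \<xi> - z)"
      using norm_triangle_ineq[of "\<xi> - of_real (1 - r k) * \<xi>" "of_real (1 - r k) * \<xi> - z"] by simp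
    also have "\<xi> - of_real (1 - r k) * \<xi> = of_real (r k) * \<xi>" by (simp add: algebra_simps)
    finally show "cmod (\<xi> - z) < 3 / 2 * r k" using d r0[of k] xi by (simp add: norm_mult)
    have "cmod z \<le> cmod (of_real (1 - r k) * \<xi>) + cmod (of_real (1 - r k) * \<xi> - z)"
      using norm_triangle_sub[of z "of_real (1 - r k) * \<xi>"] by (simp add: norm_minus_commute)
    also have "cmod (of_real (1 - r k) * \<xi>) = 1 - r k" using r0[of k] xi by (simp add: norm_mult del: of_real_diff)
    finally show "cmod z < 1 - r k / 2" using d by simp
  qed
  \<comment> \<open>If the integral were finite, dominated convergence would make the contributions
    of the balls tend to 0, because each point of the disc lies in only finitely many of
    them.\<close>
  have "(\<lambda>k. \<integral>\<^sup>+z. ?g z * indicator (B k) z \<partial>bergman_measure \<alpha>) \<longlonglongrightarrow> (\<integral>\<^sup>+z. 0 \<partial>bergman_measure \<alpha>)"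
  proof (rule nn_integral_dominated_convergence[where w = ?g])
    show "AE z in bergman_measure \<alpha>. (\<lambda>k. ?g z * indicator (B k) z) \<longlonglongrightarrow> 0"
    proof (rule AE_I2)
      fix z assume "z \<in> space (bergman_measure \<alpha>)"
      then have "cmod (\<xi> - z) > 0" using xi by (auto simp: space_bergman_measure)
      with tendsto_mult_right_zero[OF rlim, of "3 / 2"]
      have "eventually (\<lambda>k. 3 / 2 * r k < cmod (\<xi> - z)) sequentially"
        by (rule order_tendstoD(2))
      then have "eventually (\<lambda>k. ?g z * indicator (B k) z = 0) sequentially"
        by eventually_elim (use upper in \<open>force simp: indicator_def\<close>)
      then show "(\<lambda>k. ?g z * indicator (B k) z) \<longlonglongrightarrow> 0" by (rule tendsto_eventually)
    qed
  qed (use fin in \<open>auto simp: indicator_def\<close>)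
  then have lim0: "(\<lambda>k. \<integral>\<^sup>+z. ?g z * indicator (B k) z \<partial>bergman_measure \<alpha>) \<longlonglongrightarrow> 0" by simp
  \<comment> \<open>On the k-th ball the weight is at least
    \<open>(1 + \<alpha>) / pi * (r k / 2) powr \<alpha>\<close> and the power at least
    \<open>(3 / 2 * r k) powr (- (2 + \<alpha>))\<close>. The constants are collected in \<kappa>;
    the remaining \<open>1 / (r k)\<^sup>2\<close> balances the area
    \<open>pi * (r k)\<^sup>2 / 4\<close>.\<close>
  define \<kappa> where "\<kappa> = (1 + \<alpha>) / pi * (1 / 2) powr \<alpha> * (3 / 2) powr (- (2 + \<alpha>))"
  have kap: "\<kappa> > 0" using a by (simp add: \<kappa>_def)
  have "ennreal (\<kappa> * pi / 4) \<le> (\<integral>\<^sup>+z. ?g z * indicator (B k) z \<partial>bergman_measure \<alpha>)" for k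
  proof -
    have "ennreal (\<kappa> * pi / 4) = ennreal (\<kappa> / (r k)\<^sup>2) * emeasure lborel (B k)"
      using r0[of k] kap by (simp add: B_def emeasure_ball unit_ball_vol_2 ennreal_mult[symmetric] power_divide)
    also have "\<dots> = (\<integral>\<^sup>+z. ennreal (\<kappa> / (r k)\<^sup>2) * indicator (B k) z \<partial>lborel)"
      by (rule nn_integral_cmult_indicator[symmetric]) simp
    also have "\<dots> \<le> (\<integral>\<^sup>+z. ennreal (bergman_weight \<alpha> z) * (?g z * indicator (B k) z) * indicator \<bbbD> z \<partial>lborel)"
    proof (rule nn_integral_mono)
      fix z
      show "ennreal (\<kappa> / (r k)\<^sup>2) * indicator (B k) z \<le> ennreal (bergman_weight \<alpha> z) * (?g z * indicator (B k) z) * indicator \<bbbD> z"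
      proof (cases "z \<in> B k")
        case True
        note up = upper[OF True]
        have zD: "z \<in> \<bbbD>" using up r0[of k] by simp
        have "(cmod z)\<^sup>2 \<le> cmod z" using zD by (simp add: power2_eq_square mult_left_le)
        then have "r k / 2 \<le> 1 - (cmod z)\<^sup>2" using up by linarith
        then have "(r k / 2) powr \<alpha> \<le> (1 - (cmod z)\<^sup>2) powr \<alpha>" using a r0[of k] by (intro powr_mono2) auto
        moreover have "(r k / 2) powr \<alpha> = (1 / 2) powr \<alpha> * r k powr \<alpha>"
          using r0[of k] by (simp add: powr_divide)
        ultimately have "(1 + \<alpha>) / pi * ((1 / 2) powr \<alpha> * r k powr \<alpha>) \<le> (1 + \<alpha>) / pi * (1 - (cmod z)\<^sup>2) powr \<alpha>"
          using a by (intro mult_left_mono) auto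
        then have w: "(1 + \<alpha>) / pi * ((1 / 2) powr \<alpha> * r k powr \<alpha>) \<le> bergman_weight \<alpha> z"
          by (simp add: bergman_weight_def)
        have "cmod (\<xi> - z) > 0" using zD xi by auto
        then have g: "(3 / 2 * r k) powr (- (2 + \<alpha>)) \<le> cmod (\<xi> - z) powr (- (2 + \<alpha>))"
          using up(1) a by (intro powr_mono2') auto
        have gr: "(3 / 2 * r k) powr (- (2 + \<alpha>)) = (3 / 2) powr (- (2 + \<alpha>)) * (r k powr (- (2 + \<alpha>)))"
          using r0[of k] by (subst powr_mult) auto
        have rr: "r k powr \<alpha> * r k powr (- (2 + \<alpha>)) = 1 / (r k)\<^sup>2"
          using r0[of k] by (simp add: powr_add[symmetric] powr_minus powr_numeral divide_inverse)
        have "\<kappa> / (r k)\<^sup>2 = \<kappa> * (r k powr \<alpha> * r k powr (- (2 + \<alpha>)))" unfolding rr by simp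
        also have "\<dots> = ((1 + \<alpha>) / pi * ((1 / 2) powr \<alpha> * r k powr \<alpha>)) * (3 / 2 * r k) powr (- (2 + \<alpha>))"
          unfolding gr \<kappa>_def by (simp only: mult_ac)
        also have "\<dots> \<le> bergman_weight \<alpha> z * cmod (\<xi> - z) powr (- (2 + \<alpha>))"
          by (rule mult_mono[OF w g]) (use bergman_weight_nonneg[OF a] in auto)
        finally have "ennreal (\<kappa> / (r k)\<^sup>2) \<le> ennreal (bergman_weight \<alpha> z * cmod (\<xi> - z) powr (- (2 + \<alpha>)))"
          by (rule ennreal_leI)
        then show ?thesis using True zD bergman_weight_nonneg[OF a] by (simp add: ennreal_mult)
      qed simp
    qed
    also have "\<dots> = (\<integral>\<^sup>+z. ?g z * indicator (B k) z \<partial>bergman_measure \<alpha>)"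
      by (rule nn_integral_bergman_measure[symmetric]) measurable
    finally show ?thesis .
  qed
  then have "ennreal (\<kappa> * pi / 4) \<le> 0"
    by (intro tendsto_lowerbound[OF lim0]) auto
  then show False using kap pi_gt_zero by (simp add: mult_le_0_iff)
qed

text \<open>Fatou's lemma: the p-th powers of the moduli converge pointwise to the critical power,
  whose integral is infinite.\<close>

lemma power_branch_norm_at_top:
  fixes h :: "nat \<Rightarrow> complex \<Rightarrow> complex"
  assumes h: "\<And>n. power_branch \<xi> (- c n) (h n)" and xi: "cmod \<xi> = 1" and p: "p > 1" and a: "\<alpha> \<ge> 0"
    and c: "\<And>n. \<alpha> / p < c n" "\<And>n. c n < (2 + \<alpha>) / p" "c \<longlonglongrightarrow> (2 + \<alpha>) / p"
  shows "filterlim (\<lambda>n. bergman_norm p \<alpha> (h n)) at_top sequentially"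
proof -
  note hb = power_branch_in_bergman_space[OF h xi p a c(1,2)]
  note [measurable] = bergman_space_measurable[OF hb(1)]
  have "\<infinity> = (\<integral>\<^sup>+z. ennreal (cmod (\<xi> - z) powr (- (2 + \<alpha>))) \<partial>bergman_measure \<alpha>)"
    by (rule nn_integral_boundary_power_critical[OF xi a, symmetric])
  also have "\<dots> = (\<integral>\<^sup>+z. liminf (\<lambda>n. ennreal (cmod (h n z) powr p)) \<partial>bergman_measure \<alpha>)"
  proof (rule nn_integral_cong)
    fix z assume "z \<in> space (bergman_measure \<alpha>)"
    then have z: "z \<in> \<bbbD>" "\<xi> - z \<noteq> 0" using xi by (auto simp: space_bergman_measure)
    have "(\<lambda>n. cmod (\<xi> - z) powr (- (c n * p))) \<longlonglongrightarrow> cmod (\<xi> - z) powr (- ((2 + \<alpha>) / p * p))"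
      using z by (intro tendsto_intros c) auto
    then have "(\<lambda>n. ennreal (cmod (h n z) powr p)) \<longlonglongrightarrow> ennreal (cmod (\<xi> - z) powr (- (2 + \<alpha>)))"
      using p by (intro tendsto_ennrealI) (simp add: power_branch_norm[OF h z(1)] powr_powr)
    from lim_imp_Liminf[OF _ this]
    show "ennreal (cmod (\<xi> - z) powr (- (2 + \<alpha>))) = liminf (\<lambda>n. ennreal (cmod (h n z) powr p))" by simp
  qed
  also have "\<dots> \<le> liminf (\<lambda>n. bergman_pow p \<alpha> (h n))"
    unfolding bergman_pow_def by (rule nn_integral_liminf) measurable
  finally have li: "liminf (\<lambda>n. bergman_pow p \<alpha> (h n)) = \<infinity>" by (simp add: top_unique)
  show ?thesis
  proof (rule filterlim_at_top_gt[THEN iffD2, rule_format])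
    fix Z :: real assume Z: "Z > 0"
    have "ennreal (Z powr p) < liminf (\<lambda>n. bergman_pow p \<alpha> (h n))" by (simp add: li)
    then have "eventually (\<lambda>n. ennreal (Z powr p) < bergman_pow p \<alpha> (h n)) sequentially"
      by (rule less_LiminfD)
    then show "eventually (\<lambda>n. Z \<le> bergman_norm p \<alpha> (h n)) sequentially"
    proof eventually_elim
      case (elim n)
      then have "Z powr p < bergman_norm p \<alpha> (h n) powr p"
        by (simp add: bergman_pow_eq_norm[OF hb(1) p] ennreal_less_iff)
      then show ?case using Z p powr_mono2[of p "bergman_norm p \<alpha> (h n)" Z] bergman_norm_nonneg[of p \<alpha> "h n"] by force
    qed
  qed
qed

lemma normalized_power_branch_sphere:
  assumes h: "power_branch \<xi> (- c) h" and xi: "cmod \<xi> = 1" and p: "p > 1" and a: "\<alpha> \<ge> 0"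
    and c: "\<alpha> / p < c" "c < (2 + \<alpha>) / p"
  shows "bergman_normalize p \<alpha> h \<in> bergman_sphere p \<alpha>"
proof -
  note hb = power_branch_in_bergman_space[OF h xi p a c]
  have eq: "bergman_normalize p \<alpha> h = (\<lambda>z. of_real (1 / bergman_norm p \<alpha> h) * h z)"
    by (auto simp: bergman_normalize_def)
  show ?thesis
    unfolding bergman_sphere_def eq using bergman_scale[OF hb(1) p, of "of_real (1 / bergman_norm p \<alpha> h)"] hb(2)
    by (auto simp: norm_divide simp del: of_real_divide)
qed

text \<open>Outside \<open>ball \<xi> \<epsilon>\<close> the power functions are bounded by
  \<open>\<epsilon> powr (- c n)\<close>, which converges, while the normalising norms tend to
  infinity.\<close>

lemma normalized_power_branch_AE_at:
  fixes h :: "nat \<Rightarrow> complex \<Rightarrow> complex"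
  assumes h: "\<And>n. power_branch \<xi> (- c n) (h n)" and xi: "cmod \<xi> = 1" and p: "p > 1" and a: "\<alpha> \<ge> 0"
    and c: "\<And>n. \<alpha> / p < c n" "\<And>n. c n < (2 + \<alpha>) / p" "c \<longlonglongrightarrow> (2 + \<alpha>) / p"
  shows "(\<lambda>n. bergman_normalize p \<alpha> (h n)) \<in> AE_at p \<alpha> \<xi>"
  unfolding AE_at_def
proof (intro CollectI conjI allI impI)
  show "bergman_normalize p \<alpha> (h n) \<in> bergman_sphere p \<alpha>" for n
    by (rule normalized_power_branch_sphere[OF h xi p a c(1,2)])
  fix \<epsilon> :: real assume e: "\<epsilon> > 0"
  note hb = power_branch_in_bergman_space[OF h xi p a c(1,2)]
  have c0: "c n > 0" for n using c(1)[of n] a p by (smt (verit) divide_nonneg_pos)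
  have "(\<lambda>n. \<epsilon> powr (- c n) * inverse (bergman_norm p \<alpha> (h n))) \<longlonglongrightarrow> \<epsilon> powr (- ((2 + \<alpha>) / p)) * 0"
    using e by (intro tendsto_intros c tendsto_inverse_0_at_top[OF power_branch_norm_at_top[OF h xi p a c]]) auto
  then have "(\<lambda>n. ennreal (\<epsilon> powr (- c n) / bergman_norm p \<alpha> (h n))) \<longlonglongrightarrow> ennreal 0"
    by (intro tendsto_ennrealI) (simp add: divide_inverse)
  then have lim: "(\<lambda>n. ennreal (\<epsilon> powr (- c n) / bergman_norm p \<alpha> (h n))) \<longlonglongrightarrow> 0" by simp
  have le: "(SUP z\<in>\<bbbD> - ball \<xi> \<epsilon>. ennreal (cmod (bergman_normalize p \<alpha> (h n) z))) \<le> ennreal (\<epsilon> powr (- c n) / bergman_norm p \<alpha> (h n))" for n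
  proof (rule SUP_least)
    fix z assume z: "z \<in> \<bbbD> - ball \<xi> \<epsilon>"
    have "cmod (\<xi> - z) powr (- c n) \<le> \<epsilon> powr (- c n)"
      using z e c0[of n] by (intro powr_mono2') (auto simp: dist_norm)
    then have "cmod (h n z) / bergman_norm p \<alpha> (h n) \<le> \<epsilon> powr (- c n) / bergman_norm p \<alpha> (h n)"
      using z power_branch_norm[OF h, of z n] by (intro divide_right_mono) (auto simp: bergman_norm_nonneg)
    then show "ennreal (cmod (bergman_normalize p \<alpha> (h n) z)) \<le> ennreal (\<epsilon> powr (- c n) / bergman_norm p \<alpha> (h n))"
      by (intro ennreal_leI) (simp add: bergman_normalize_def norm_divide bergman_norm_nonneg)
  qed
  show "(\<lambda>n. SUP z\<in>\<bbbD> - ball \<xi> \<epsilon>. ennreal (cmod (bergman_normalize p \<alpha> (h n) z))) \<longlonglongrightarrow> 0"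
    by (rule tendsto_sandwich[OF _ _ tendsto_const lim]) (auto intro!: always_eventually le)
qed

text \<open>Near \<open>\<xi>\<close> the quotient \<open>(\<xi> - \<phi> z) / (\<xi> - z)\<close> tends to \<open>d\<close>, so the operator multiplies
  the power function by nearly \<open>b d powr (- c)\<close>; the rest of the disc carries no mass in the limit.\<close>

lemma weighted_comp_power_branch_limit:
  fixes h :: "nat \<Rightarrow> complex \<Rightarrow> complex" and \<alpha> p :: real
  defines "\<gamma> \<equiv> (2 + \<alpha>) / p"
  assumes hol: "\<phi> holomorphic_on \<bbbD>" and im: "\<phi> ` \<bbbD> \<subseteq> \<bbbD>" and xi: "cmod \<xi> = 1"
    and lim: "(\<phi> \<longlongrightarrow> \<xi>) (at \<xi> within \<bbbD>)" and der: "(deriv \<phi> \<longlongrightarrow> of_real d) (at \<xi> within \<bbbD>)" and d: "d > 0"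
    and out: "\<And>\<epsilon>. \<epsilon> > 0 \<Longrightarrow> closure (\<phi> ` (\<bbbD> - ball \<xi> \<epsilon>)) \<inter> sphere 0 1 = {}"
    and u: "u \<in> bergman_space p \<alpha>" and ulim: "(u \<longlongrightarrow> b) (at \<xi> within \<bbbD>)"
    and T: "\<And>f. f \<in> bergman_space p \<alpha> \<Longrightarrow> weighted_comp u \<phi> f \<in> bergman_space p \<alpha>"
    and h: "\<And>n. power_branch \<xi> (- c n) (h n)" and p: "p > 1" and a: "\<alpha> \<ge> 0"
    and c: "\<And>n. \<alpha> / p < c n" "\<And>n. c n < \<gamma>" "c \<longlonglongrightarrow> \<gamma>"
  shows "(\<lambda>n. bergman_norm p \<alpha> (\<lambda>z. weighted_comp u \<phi> (bergman_normalize p \<alpha> (h n)) z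
      - b * of_real (d powr (- \<gamma>)) * bergman_normalize p \<alpha> (h n) z)) \<longlonglongrightarrow> 0"
proof -
  define F where "F n = bergman_normalize p \<alpha> (h n)" for n
  define l where "l = b * of_real (d powr (- \<gamma>))"
  have F: "F \<in> AE_at p \<alpha> \<xi>"
    unfolding F_def[abs_def] using c unfolding \<gamma>_def by (intro normalized_power_branch_AE_at[OF h xi p a]) auto
  have Fb: "F n \<in> bergman_space p \<alpha>" "bergman_norm p \<alpha> (F n) = 1" for n
    using F by (auto simp: AE_at_def bergman_sphere_def)
  define q where "q z = (\<xi> - \<phi> z) / (\<xi> - z)" for z
  have q: "(q \<longlongrightarrow> of_real d) (at \<xi> within \<bbbD>)"
  proof (rule tendstoI)
    fix e :: real assume e: "e > 0"
    then have e2: "e / 2 > 0" by simp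
    obtain \<epsilon> where eps: "\<epsilon> > 0" "\<And>z. z \<in> \<bbbD> \<inter> ball \<xi> \<epsilon> \<Longrightarrow> cmod (\<phi> z - \<xi> - of_real d * (z - \<xi>)) \<le> e / 2 * cmod (z - \<xi>)"
      by (rule boundary_derivative_expansion[OF hol xi lim der e2]) blast
    have "dist (q z) (of_real d) < e" if z: "z \<in> \<bbbD>" "dist z \<xi> < \<epsilon>" for z
    proof -
      have nz: "z - \<xi> \<noteq> 0" using z xi by auto
      have "q z - of_real d = (\<phi> z - \<xi> - of_real d * (z - \<xi>)) / (z - \<xi>)"
      proof -
        have "q z = (\<phi> z - \<xi>) / (z - \<xi>)" using minus_divide_divide[of "\<phi> z - \<xi>" "z - \<xi>"] by (simp add: q_def)
        then show ?thesis using nz by (simp add: diff_divide_distrib)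
      qed
      then have "dist (q z) (of_real d) = cmod (\<phi> z - \<xi> - of_real d * (z - \<xi>)) / cmod (z - \<xi>)"
        by (simp add: dist_norm norm_divide)
      also have "\<dots> \<le> e / 2" using eps(2)[of z] z nz by (simp add: pos_divide_le_eq dist_commute)
      finally show ?thesis using e by simp
    qed
    then show "\<forall>\<^sub>F z in at \<xi> within \<bbbD>. dist (q z) (of_real d) < e"
      unfolding eventually_at using eps(1) by auto
  qed
  \<comment> \<open>By \<open>power_branch_quotient\<close>, the exact factor by which the operator
    multiplies \<open>F n\<close> at points near \<xi>.\<close>
  let ?G = "\<lambda>n z. u z * exp (of_real (- c n) * Ln (q z))"
  have l_exp: "l = b * exp (of_real (- \<gamma>) * Ln (of_real d))"
    using d by (simp add: l_def powr_def Ln_of_real exp_of_real[symmetric])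
  have dn: "of_real d \<notin> (\<real>\<^sub>\<le>\<^sub>0 :: complex set)" using d by (simp add: complex_nonpos_Reals_iff)
  \<comment> \<open>The limit is joint in \<open>z\<close> and \<open>n\<close>, so that a single
    neighbourhood of \<xi> serves all large \<open>n\<close>.\<close>
  have Glim: "((\<lambda>x. ?G (snd x) (fst x)) \<longlongrightarrow> l) ((at \<xi> within \<bbbD>) \<times>\<^sub>F sequentially)"
    unfolding l_exp
    by (intro tendsto_intros tendsto_Ln dn filterlim_compose[OF ulim filterlim_fst]
          filterlim_compose[OF q filterlim_fst] filterlim_compose[OF c(3) filterlim_snd])
  have key: "eventually (\<lambda>n. bergman_norm p \<alpha> (\<lambda>z. weighted_comp u \<phi> (F n) z - l * F n z) \<le> K) sequentially"
    if K: "K > 0" for K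
  proof -
    \<comment> \<open>Budget for the p-th power: half of \<open>K powr p\<close> near \<xi> and a
      quarter for each of the two terms outside, where \<kappa> already allows for the factor
      \<open>2 powr p\<close> of \<open>norm_diff_powr_le\<close>.\<close>
    define \<delta> where "\<delta> = (K powr p / 2) powr (1 / p)"
    have del: "\<delta> > 0" using K by (simp add: \<delta>_def)
    have delp: "\<delta> powr p = K powr p / 2" using K p by (simp add: \<delta>_def powr_powr)
    define \<kappa> where "\<kappa> = K powr p / (4 * 2 powr p)"
    have kap: "\<kappa> > 0" using K by (simp add: \<kappa>_def)
    have sum: "2 powr p * (\<kappa> + \<kappa>) + \<delta> powr p = K powr p"
      by (simp add: delp \<kappa>_def)
    obtain Pf Pg where Pf: "eventually Pf (at \<xi> within \<bbbD>)" and Pg: "eventually Pg sequentially"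
      and PG: "\<And>z n. Pf z \<Longrightarrow> Pg n \<Longrightarrow> dist (?G n z) l < \<delta>"
      using tendstoD[OF Glim del] unfolding eventually_prod_filter by auto
    \<comment> \<open>Distance less than \<open>d\<close> from the positive number \<open>d\<close>
      puts \<open>q z\<close> in the right half-plane, where the quotient formula holds.\<close>
    have "eventually (\<lambda>z. Pf z \<and> dist (q z) (of_real d) < d) (at \<xi> within \<bbbD>)"
      using Pf tendstoD[OF q d] by eventually_elim auto
    then obtain \<epsilon> where eps: "\<epsilon> > 0"
      and P: "\<And>z. z \<in> \<bbbD> \<Longrightarrow> z \<noteq> \<xi> \<Longrightarrow> dist z \<xi> < \<epsilon> \<Longrightarrow> Pf z \<and> dist (q z) (of_real d) < d"
      unfolding eventually_at by blast
    \<comment> \<open>The constant \<open>l\<close> takes the role of the weight \<open>u\<close>,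
      so that the same estimate covers the term \<open>l * F n z\<close>.\<close>
    have lb: "(\<lambda>z. l) \<in> bergman_space p \<alpha>"
      by (rule bergman_norm_le_sup(1)[of _ "cmod l"]) (use p a in auto)
    have o1: "eventually (\<lambda>n. (\<integral>\<^sup>+z. ennreal (cmod (u z * F n (\<phi> z)) powr p) * indicator (- ball \<xi> \<epsilon>) z \<partial>bergman_measure \<alpha>) \<le> ennreal \<kappa>) sequentially"
      by (rule weighted_comp_AE_outer[OF im out[OF eps] u F xi p kap])
    have o2: "eventually (\<lambda>n. (\<integral>\<^sup>+z. ennreal (cmod (l * F n z) powr p) * indicator (- ball \<xi> \<epsilon>) z \<partial>bergman_measure \<alpha>) \<le> ennreal \<kappa>) sequentially"
    proof (rule eventually_bergman_part_le[OF lb p kap])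
      fix e :: real assume "e > 0"
      from AE_at_eventually_le[OF F this eps]
      show "eventually (\<lambda>n. \<forall>z\<in>\<bbbD> \<inter> - ball \<xi> \<epsilon>. cmod (F n z) \<le> e) sequentially"
        by eventually_elim auto
    qed
    from o1 o2 Pg show ?thesis
    proof eventually_elim
      case (elim n)
      have TF: "weighted_comp u \<phi> (F n) \<in> bergman_space p \<alpha>" by (rule T[OF Fb(1)])
      have lF: "(\<lambda>z. l * F n z) \<in> bergman_space p \<alpha>" by (rule bergman_scale(1)[OF Fb(1) p])
      have diff: "(\<lambda>z. weighted_comp u \<phi> (F n) z - l * F n z) \<in> bergman_space p \<alpha>"
        by (rule bergman_diff(1)[OF TF lF p a])
      note [measurable] = bergman_space_measurable[OF TF, unfolded weighted_comp_def] bergman_space_measurable[OF lF]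
      note measurable_ident_bergman [measurable]
      have [measurable]: "ball \<xi> \<epsilon> \<in> sets borel" by simp
      have near: "u z * F n (\<phi> z) - l * F n z = F n z * (?G n z - l)" if z: "z \<in> \<bbbD>" "z \<in> ball \<xi> \<epsilon>" for z
      proof -
        have "z \<noteq> \<xi>" using z xi by auto
        then have "dist (q z) (of_real d) < d" using P[of z] z by (auto simp: dist_commute)
        then have "\<bar>Re (q z) - d\<bar> < d" using abs_Re_le_cmod[of "q z - of_real d"] by (simp add: dist_norm)
        then have "Re ((\<xi> - \<phi> z) / (\<xi> - z)) > 0" by (simp add: q_def)
        moreover have "\<phi> z \<in> \<bbbD>" using im z by blast
        ultimately have "h n (\<phi> z) = h n z * exp (of_real (- c n) * Ln (q z))"
          unfolding q_def using power_branch_quotient[OF h xi z(1)] by blast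
        then show ?thesis by (simp add: F_def bergman_normalize_def algebra_simps)
      qed
      have "bergman_pow p \<alpha> (\<lambda>z. weighted_comp u \<phi> (F n) z - l * F n z)
        \<le> (\<integral>\<^sup>+z. ennreal (2 powr p) * (ennreal (cmod (u z * F n (\<phi> z)) powr p) * indicator (- ball \<xi> \<epsilon>) z
              + ennreal (cmod (l * F n z) powr p) * indicator (- ball \<xi> \<epsilon>) z)
            + ennreal (cmod (u z * F n (\<phi> z) - l * F n z) powr p) * indicator (ball \<xi> \<epsilon>) z \<partial>bergman_measure \<alpha>)"
        unfolding bergman_pow_def weighted_comp_def
      proof (rule nn_integral_mono)
        fix z
        show "ennreal (cmod (u z * F n (\<phi> z) - l * F n z) powr p) \<le> ennreal (2 powr p) * (ennreal (cmod (u z * F n (\<phi> z)) powr p) * indicator (- ball \<xi> \<epsilon>) z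
              + ennreal (cmod (l * F n z) powr p) * indicator (- ball \<xi> \<epsilon>) z)
            + ennreal (cmod (u z * F n (\<phi> z) - l * F n z) powr p) * indicator (ball \<xi> \<epsilon>) z"
        proof (cases "z \<in> ball \<xi> \<epsilon>")
          case False
          have "ennreal (cmod (u z * F n (\<phi> z) - l * F n z) powr p) \<le> ennreal (2 powr p * (cmod (u z * F n (\<phi> z)) powr p + cmod (l * F n z) powr p))"
            using p by (intro ennreal_leI norm_diff_powr_le) simp
          then show ?thesis using False by (simp add: ennreal_mult)
        qed simp
      qed
      also have "\<dots> = ennreal (2 powr p) * ((\<integral>\<^sup>+z. ennreal (cmod (u z * F n (\<phi> z)) powr p) * indicator (- ball \<xi> \<epsilon>) z \<partial>bergman_measure \<alpha>)
            + (\<integral>\<^sup>+z. ennreal (cmod (l * F n z) powr p) * indicator (- ball \<xi> \<epsilon>) z \<partial>bergman_measure \<alpha>))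
            + (\<integral>\<^sup>+z. ennreal (cmod (u z * F n (\<phi> z) - l * F n z) powr p) * indicator (ball \<xi> \<epsilon>) z \<partial>bergman_measure \<alpha>)"
        by (simp add: nn_integral_add nn_integral_cmult)
      also have "(\<integral>\<^sup>+z. ennreal (cmod (u z * F n (\<phi> z) - l * F n z) powr p) * indicator (ball \<xi> \<epsilon>) z \<partial>bergman_measure \<alpha>)
        = (\<integral>\<^sup>+z. ennreal (cmod (F n z * (?G n z - l)) powr p) * indicator (ball \<xi> \<epsilon>) z \<partial>bergman_measure \<alpha>)"
        using near by (intro nn_integral_cong) (auto simp: space_bergman_measure indicator_def)
      also have "\<dots> \<le> ennreal (\<delta> powr p * bergman_norm p \<alpha> (F n) powr p)"
      proof (rule bergman_part_le[OF Fb(1) _ less_imp_le[OF del] p])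
        fix z assume z: "z \<in> \<bbbD>" "z \<in> ball \<xi> \<epsilon>"
        then have "z \<noteq> \<xi>" using xi by auto
        then have "dist (?G n z) l < \<delta>" using P[of z] z elim(3) by (intro PG) (auto simp: dist_commute)
        then show "cmod (?G n z - l) \<le> \<delta>" by (simp add: dist_norm)
      qed
      also have "ennreal (2 powr p) * ((\<integral>\<^sup>+z. ennreal (cmod (u z * F n (\<phi> z)) powr p) * indicator (- ball \<xi> \<epsilon>) z \<partial>bergman_measure \<alpha>)
            + (\<integral>\<^sup>+z. ennreal (cmod (l * F n z) powr p) * indicator (- ball \<xi> \<epsilon>) z \<partial>bergman_measure \<alpha>))
          \<le> ennreal (2 powr p) * (ennreal \<kappa> + ennreal \<kappa>)"
        using elim by (intro mult_left_mono add_mono) auto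
      finally have "bergman_pow p \<alpha> (\<lambda>z. weighted_comp u \<phi> (F n) z - l * F n z)
          \<le> ennreal (2 powr p) * (ennreal \<kappa> + ennreal \<kappa>) + ennreal (\<delta> powr p)"
        by (simp add: Fb add_left_mono add_right_mono)
      also have "\<dots> = ennreal (K powr p)"
        unfolding sum[symmetric] using kap
        by (subst ennreal_plus, simp, simp, subst ennreal_mult, simp, simp, subst ennreal_plus, simp_all)
      finally show ?case
        by (intro bergman_leI(2)[OF bergman_space_holomorphic[OF diff] less_imp_le[OF K] p])
    qed
  qed
  show ?thesis
    unfolding F_def[symmetric] l_def[symmetric]
  proof (rule LIMSEQ_I)
    fix e :: real assume "e > 0"
    then have "eventually (\<lambda>n. bergman_norm p \<alpha> (\<lambda>z. weighted_comp u \<phi> (F n) z - l * F n z) \<le> e / 2) sequentially"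
      by (intro key) simp
    then show "\<exists>no. \<forall>n\<ge>no. norm (bergman_norm p \<alpha> (\<lambda>z. weighted_comp u \<phi> (F n) z - l * F n z) - 0) < e"
      unfolding eventually_sequentially using \<open>e > 0\<close> by (auto simp: bergman_norm_nonneg) (smt (verit) field_sum_of_halves)
  qed
qed

section \<open>The family of operators\<close>

lemma continuous_on_family:
  fixes g :: "real \<Rightarrow> complex \<Rightarrow> complex"
  assumes g: "\<And>t. t \<in> {0<..<1} \<Longrightarrow> continuous_on \<bbbD> (g t)"
    and lim: "\<And>t0 R e. t0 \<in> {0<..<1} \<Longrightarrow> 0 \<le> R \<Longrightarrow> R < 1 \<Longrightarrow> e > 0 \<Longrightarrow>
      eventually (\<lambda>t. \<forall>z. cmod z \<le> R \<longrightarrow> cmod (g t z - g t0 z) \<le> e) (at t0)"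
  shows "continuous_on ({0<..<1} \<times> \<bbbD>) (\<lambda>(t, z). g t z)"
  unfolding continuous_on_iff
proof (intro ballI allI impI)
  fix x :: "real \<times> complex" and e :: real
  assume x: "x \<in> {0<..<1} \<times> \<bbbD>" and e: "e > 0"
  obtain t0 z0 where x0: "x = (t0, z0)" by (cases x)
  have t0: "t0 \<in> {0<..<1}" and z0: "z0 \<in> \<bbbD>" using x by (auto simp: x0)
  define R where "R = (1 + cmod z0) / 2"
  have R: "0 \<le> R" "R < 1" "cmod z0 < R" using z0 by (auto simp: R_def field_simps)
  have e4: "e / 4 > 0" using e by simp
  from lim[OF t0 R(1,2) e4] obtain d1 where d1: "d1 > 0"
    "\<And>t z. t \<noteq> t0 \<Longrightarrow> dist t t0 < d1 \<Longrightarrow> cmod z \<le> R \<Longrightarrow> cmod (g t z - g t0 z) \<le> e / 4"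
    unfolding eventually_at by blast
  obtain d2 where d2: "d2 > 0" "\<And>z. z \<in> \<bbbD> \<Longrightarrow> dist z z0 < d2 \<Longrightarrow> dist (g t0 z) (g t0 z0) < e / 4"
    using g[OF t0] z0 e4 unfolding continuous_on_iff by blast
  define d where "d = min d1 (min d2 (R - cmod z0))"
  show "\<exists>d>0. \<forall>x'\<in>{0<..<1} \<times> \<bbbD>. dist x' x < d \<longrightarrow> dist (case x' of (t, z) \<Rightarrow> g t z) (case x of (t, z) \<Rightarrow> g t z) < e"
  proof (intro exI[of _ d] conjI ballI impI)
    show "d > 0" using d1 d2 R by (simp add: d_def)
    fix y :: "real \<times> complex" assume y: "y \<in> {0<..<1} \<times> \<bbbD>" "dist y x < d"
    obtain t z where y0: "y = (t, z)" by (cases y)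
    have tz: "dist t t0 < d" "dist z z0 < d"
      using y(2) dist_fst_le[of y x] dist_snd_le[of y x] by (auto simp: y0 x0)
    have "cmod z \<le> R" using tz(2) norm_triangle_sub[of z z0] by (simp add: d_def dist_norm)
    \<comment> \<open>The filter \<open>at t0\<close> excludes \<open>t0\<close> itself, where the
      difference is 0.\<close>
    then have "cmod (g t z - g t0 z) \<le> e / 4"
      using d1(2)[of t z] tz e by (cases "t = t0") (auto simp: d_def)
    moreover have "dist (g t0 z) (g t0 z0) < e / 4" using d2(2)[of z] tz y by (auto simp: y0 d_def)
    ultimately show "dist (case y of (t, z) \<Rightarrow> g t z) (case x of (t, z) \<Rightarrow> g t z) < e"
      using dist_triangle[of "g t z" "g t0 z0" "g t0 z"] e by (simp add: x0 y0 dist_norm)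
  qed
qed

text \<open>Admissibility gives uniform continuity in \<open>t\<close> for the symbols outright. For
  the weights it controls p-th means off any neighbourhood of \<xi>, and the local mean value bound
  turns these into uniform bounds on compact discs.\<close>

lemma admissible_joint_continuity:
  assumes wc: "weighted_comp_family p \<alpha> u \<phi>" and adm: "admissible p \<alpha> u \<phi> \<xi>"
    and f: "f \<in> bergman_space p \<alpha>" and p: "p > 1" and a: "\<alpha> \<ge> 0"
  shows "continuous_on ({0<..<1} \<times> \<bbbD>) (\<lambda>(t, z). weighted_comp (u t) (\<phi> t) f z)"
proof -
  have xi: "cmod \<xi> = 1" using adm by (auto simp: admissible_def has_direction_def)
  have W: "\<phi> t holomorphic_on \<bbbD>" "\<phi> t ` \<bbbD> \<subseteq> \<bbbD>" "u t \<in> bergman_space p \<alpha>" if "t \<in> {0<..<1}" for t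
    using wc that by (auto simp: weighted_comp_family_def)
  have i: "((\<lambda>t. SUP z\<in>\<bbbD>. ennreal (cmod (\<phi> t z - \<phi> t0 z))) \<longlongrightarrow> 0) (at t0)" if "t0 \<in> {0<..<1}" for t0
    using adm that by (simp add: admissible_def)
  have ii: "((\<lambda>t. \<integral>\<^sup>+z\<in>\<bbbD> - ball \<xi> \<epsilon>. ennreal (cmod (u t z - u t0 z) powr p) \<partial>bergman_measure \<alpha>) \<longlongrightarrow> 0) (at t0)"
    if "t0 \<in> {0<..<1}" "\<epsilon> > 0" for t0 \<epsilon>
    using adm that by (simp add: admissible_def)
  have cphi: "continuous_on ({0<..<1} \<times> \<bbbD>) (\<lambda>(t, z). \<phi> t z)"
  proof (rule continuous_on_family)
    show "continuous_on \<bbbD> (\<phi> t)" if "t \<in> {0<..<1}" for t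
      by (rule holomorphic_on_imp_continuous_on[OF W(1)[OF that]])
    fix t0 R e :: real assume t0: "t0 \<in> {0<..<1}" and R: "R < 1" and e: "e > 0"
    have "eventually (\<lambda>t. (SUP z\<in>\<bbbD>. ennreal (cmod (\<phi> t z - \<phi> t0 z))) < ennreal e) (at t0)"
      by (rule order_tendstoD[OF i[OF t0]]) (use e in simp)
    then show "eventually (\<lambda>t. \<forall>z. cmod z \<le> R \<longrightarrow> cmod (\<phi> t z - \<phi> t0 z) \<le> e) (at t0)"
    proof eventually_elim
      case (elim t)
      show ?case
      proof (intro allI impI)
        fix z assume "cmod z \<le> R"
        then have "z \<in> \<bbbD>" using R by simp
        then have "ennreal (cmod (\<phi> t z - \<phi> t0 z)) \<le> (SUP z\<in>\<bbbD>. ennreal (cmod (\<phi> t z - \<phi> t0 z)))"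
          by (rule SUP_upper)
        also note elim
        finally show "cmod (\<phi> t z - \<phi> t0 z) \<le> e" using e by (simp add: ennreal_less_iff)
      qed
    qed
  qed
  have cu: "continuous_on ({0<..<1} \<times> \<bbbD>) (\<lambda>(t, z). u t z)"
  proof (rule continuous_on_family)
    show "continuous_on \<bbbD> (u t)" if "t \<in> {0<..<1}" for t
      by (rule bergman_space_continuous[OF W(3)[OF that]])
    fix t0 R e :: real assume t0: "t0 \<in> {0<..<1}" and R: "0 \<le> R" "R < 1" and e: "e > 0"
    obtain C where C: "C \<ge> 0" "\<And>h z \<delta>. h holomorphic_on \<bbbD> \<Longrightarrow> cmod z \<le> R \<Longrightarrow> \<delta> > 0 \<Longrightarrow>
      ennreal (cmod (h z)) \<le> ennreal \<delta> + ennreal (\<delta> powr (1 - p) * C) *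
        (\<integral>\<^sup>+y. ennreal (cmod (h y) powr p) * indicator (ball z ((1 - R) / 2)) y \<partial>bergman_measure \<alpha>)"
      by (rule bergman_local_bound[OF R p a]) blast
    \<comment> \<open>For \<open>cmod z \<le> R\<close> the disc \<open>ball z \<rho>\<close> misses
      \<open>ball \<xi> \<rho>\<close>, since the centres are at distance at least
      \<open>1 - R = 2 * \<rho>\<close>.\<close>
    define \<rho> where "\<rho> = (1 - R) / 2"
    have rho: "\<rho> > 0" using R by (simp add: \<rho>_def)
    \<comment> \<open>The local bound is used with \<delta> equal to \<open>e / 2\<close>;
      \<open>A\<close> is the resulting factor of the integral, and \<kappa> makes
      \<open>A * \<kappa>\<close> at most \<open>e / 2\<close>.\<close>
    define A where "A = (e / 2) powr (1 - p) * C"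
    have A: "A \<ge> 0" using C by (simp add: A_def)
    define \<kappa> where "\<kappa> = e / 2 / (A + 1)"
    have kap: "\<kappa> > 0" using e A by (simp add: \<kappa>_def)
    have Ak: "A * \<kappa> \<le> e / 2"
    proof -
      have "A * \<kappa> \<le> (A + 1) * \<kappa>" using kap by (intro mult_right_mono) auto
      also have "\<dots> = \<kappa> * (A + 1)" by (rule mult.commute)
      also have "\<dots> = e / 2"
        unfolding \<kappa>_def using A by (intro nonzero_eq_divide_eq[THEN iffD1]) auto
      finally show ?thesis .
    qed
    have "eventually (\<lambda>t. (\<integral>\<^sup>+z\<in>\<bbbD> - ball \<xi> \<rho>. ennreal (cmod (u t z - u t0 z) powr p) \<partial>bergman_measure \<alpha>) < ennreal \<kappa>) (at t0)"
      by (rule order_tendstoD[OF ii[OF t0 rho]]) (use kap in simp)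
    moreover have "eventually (\<lambda>t. t \<in> {0<..<1}) (at t0)"
      using t0 by (intro eventually_at_in_open') auto
    ultimately show "eventually (\<lambda>t. \<forall>z. cmod z \<le> R \<longrightarrow> cmod (u t z - u t0 z) \<le> e) (at t0)"
    proof eventually_elim
      case (elim t)
      show ?case
      proof (intro allI impI)
        fix z assume z: "cmod z \<le> R"
        have "(\<lambda>z. u t z - u t0 z) holomorphic_on \<bbbD>"
          using W(3)[OF elim(2)] W(3)[OF t0] by (intro holomorphic_intros bergman_space_holomorphic)
        from C(2)[OF this z, of "e / 2"] e
        have "ennreal (cmod (u t z - u t0 z)) \<le> ennreal (e / 2) + ennreal A *
          (\<integral>\<^sup>+y. ennreal (cmod (u t y - u t0 y) powr p) * indicator (ball z \<rho>) y \<partial>bergman_measure \<alpha>)"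
          by (simp add: A_def \<rho>_def)
        also have "(\<integral>\<^sup>+y. ennreal (cmod (u t y - u t0 y) powr p) * indicator (ball z \<rho>) y \<partial>bergman_measure \<alpha>)
          \<le> (\<integral>\<^sup>+y\<in>\<bbbD> - ball \<xi> \<rho>. ennreal (cmod (u t y - u t0 y) powr p) \<partial>bergman_measure \<alpha>)"
        proof (rule nn_integral_mono)
          fix y assume y: "y \<in> space (bergman_measure \<alpha>)"
          have "y \<notin> ball \<xi> \<rho>" if "y \<in> ball z \<rho>"
          proof -
            have "1 \<le> dist \<xi> y + dist y z + cmod z"
              using norm_triangle_sub[of \<xi> z] xi dist_triangle[of \<xi> z y] by (simp add: dist_norm)
            then show ?thesis using that z by (simp add: \<rho>_def dist_commute field_simps)
          qed
          then show "ennreal (cmod (u t y - u t0 y) powr p) * indicator (ball z \<rho>) y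
            \<le> ennreal (cmod (u t y - u t0 y) powr p) * indicator (\<bbbD> - ball \<xi> \<rho>) y"
            using y by (auto simp: space_bergman_measure indicator_def)
        qed
        also have "\<dots> \<le> ennreal \<kappa>" using elim by simp
        finally have "ennreal (cmod (u t z - u t0 z)) \<le> ennreal (e / 2) + ennreal A * ennreal \<kappa>"
          by (simp add: add_left_mono mult_left_mono)
        also have "\<dots> = ennreal (e / 2 + A * \<kappa>)" using e A kap by (simp add: ennreal_mult)
        also have "\<dots> \<le> ennreal e" using Ak by (intro ennreal_leI) simp
        finally show "cmod (u t z - u t0 z) \<le> e" using e by simp
      qed
    qed
  qed
  have cf: "continuous_on ({0<..<1} \<times> \<bbbD>) (\<lambda>x. f ((\<lambda>(t, z). \<phi> t z) x))"
  proof (rule continuous_on_compose2[OF bergman_space_continuous[OF f] cphi], rule image_subsetI)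
    fix x :: "real \<times> complex" assume x: "x \<in> {0<..<1} \<times> \<bbbD>"
    then have "fst x \<in> {0<..<1}" "snd x \<in> \<bbbD>" by (simp_all add: mem_Times_iff)
    then have "\<phi> (fst x) (snd x) \<in> \<bbbD>" using W(2)[of "fst x"] by (simp add: image_subset_iff)
    then show "(\<lambda>(t, z). \<phi> t z) x \<in> \<bbbD>" by (simp add: case_prod_unfold)
  qed
  show ?thesis
    using continuous_on_mult[OF cu cf] by (simp add: weighted_comp_def case_prod_unfold)
qed

text \<open>Collects what holds at a single parameter. The boundary derivative is real and
  nonnegative because \<phi> maps the disc into itself, and nonzero by the lower bound on the
  derivatives near \<xi>; hence its real part \<open>d\<close> carries the whole value.\<close>

lemma admissible_pointwise:
  assumes wc: "weighted_comp_family p \<alpha> u \<phi>" and adm: "admissible p \<alpha> u \<phi> \<xi>" and t: "t \<in> {0<..<1}"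
  defines "d \<equiv> Re (boundary_value (deriv (\<phi> t)) \<xi>)"
  shows "cmod \<xi> = 1" "\<phi> t holomorphic_on \<bbbD>" "\<phi> t ` \<bbbD> \<subseteq> \<bbbD>" "u t \<in> bergman_space p \<alpha>"
    and "\<And>f. f \<in> bergman_space p \<alpha> \<Longrightarrow> weighted_comp (u t) (\<phi> t) f \<in> bergman_space p \<alpha>"
    and "(\<phi> t \<longlongrightarrow> \<xi>) (at \<xi> within \<bbbD>)" "(deriv (\<phi> t) \<longlongrightarrow> of_real d) (at \<xi> within \<bbbD>)" "d > 0"
    and "\<And>\<epsilon>. \<epsilon> > 0 \<Longrightarrow> closure (\<phi> t ` (\<bbbD> - ball \<xi> \<epsilon>)) \<inter> sphere 0 1 = {}"
    and "(u t \<longlongrightarrow> boundary_value (u t) \<xi>) (at \<xi> within \<bbbD>)"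
proof -
  show xi: "cmod \<xi> = 1" using adm by (auto simp: admissible_def has_direction_def)
  show hol: "\<phi> t holomorphic_on \<bbbD>" and im: "\<phi> t ` \<bbbD> \<subseteq> \<bbbD>" and "u t \<in> bergman_space p \<alpha>"
    and "\<And>f. f \<in> bergman_space p \<alpha> \<Longrightarrow> weighted_comp (u t) (\<phi> t) f \<in> bergman_space p \<alpha>"
    using wc t by (auto simp: weighted_comp_family_def bounded_on_bergman_def)
  have dir: "extends_continuously_near (deriv (\<phi> t)) \<xi>" "extends_continuously_near (u t) \<xi>"
      "(\<phi> t \<longlongrightarrow> \<xi>) (at \<xi> within \<bbbD>)" "\<And>\<epsilon>. \<epsilon> > 0 \<Longrightarrow> closure (\<phi> t ` (\<bbbD> - ball \<xi> \<epsilon>)) \<inter> sphere 0 1 = {}"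
    using adm t by (auto simp: admissible_def has_direction_def)
  show lim: "(\<phi> t \<longlongrightarrow> \<xi>) (at \<xi> within \<bbbD>)" and "\<And>\<epsilon>. \<epsilon> > 0 \<Longrightarrow> closure (\<phi> t ` (\<bbbD> - ball \<xi> \<epsilon>)) \<inter> sphere 0 1 = {}"
    by fact+
  show "(u t \<longlongrightarrow> boundary_value (u t) \<xi>) (at \<xi> within \<bbbD>)" by (rule tendsto_boundary_value[OF dir(2) xi])
  have der: "(deriv (\<phi> t) \<longlongrightarrow> boundary_value (deriv (\<phi> t)) \<xi>) (at \<xi> within \<bbbD>)"
    by (rule tendsto_boundary_value[OF dir(1) xi])
  note nn = boundary_derivative_nonneg_real[OF hol im xi lim der]
  have bv: "boundary_value (deriv (\<phi> t)) \<xi> = of_real d" using nn(1) by (simp add: d_def complex_eq_iff)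
  show "(deriv (\<phi> t) \<longlongrightarrow> of_real d) (at \<xi> within \<bbbD>)" using der by (simp add: bv)
  obtain \<epsilon> where eps: "\<epsilon> > 0" "(INF s\<in>{s\<in>{0<..<1}. \<bar>s - t\<bar> < \<epsilon>}. INF z\<in>ball \<xi> \<epsilon> \<inter> \<bbbD>. ennreal (cmod (deriv (\<phi> s) z))) > 0"
    using adm t unfolding admissible_def by blast
  define m where "m = (INF z\<in>ball \<xi> \<epsilon> \<inter> \<bbbD>. ennreal (cmod (deriv (\<phi> t) z)))"
  \<comment> \<open>The infimum over neighbouring parameters is at most the one at \<open>t\<close>
    itself.\<close>
  have "(INF s\<in>{s\<in>{0<..<1}. \<bar>s - t\<bar> < \<epsilon>}. INF z\<in>ball \<xi> \<epsilon> \<inter> \<bbbD>. ennreal (cmod (deriv (\<phi> s) z))) \<le> m"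
    unfolding m_def by (rule INF_lower) (use t eps in auto)
  then have m: "m > 0" using eps(2) by (rule less_le_trans[rotated])
  have "((\<lambda>z. ennreal (cmod (deriv (\<phi> t) z))) \<longlongrightarrow> ennreal (cmod (boundary_value (deriv (\<phi> t)) \<xi>))) (at \<xi> within \<bbbD>)"
    by (intro tendsto_ennrealI tendsto_norm der)
  moreover have "eventually (\<lambda>z. m \<le> ennreal (cmod (deriv (\<phi> t) z))) (at \<xi> within \<bbbD>)"
    unfolding eventually_at m_def using eps(1) by (auto intro!: exI[of _ \<epsilon>] INF_lower simp: dist_commute)
  ultimately have "m \<le> ennreal (cmod (boundary_value (deriv (\<phi> t)) \<xi>))"
    by (rule tendsto_lowerbound) (rule at_boundary_nontrivial[OF xi])
  with m have "boundary_value (deriv (\<phi> t)) \<xi> \<noteq> 0" by auto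
  then have "d \<noteq> 0" by (simp add: bv)
  with nn(2) show "d > 0" by (simp add: d_def)
qed

lemma limsup_ennreal_le:
  assumes "\<And>K. K > x \<Longrightarrow> eventually (\<lambda>n. X n \<le> K) sequentially" and "x \<ge> 0"
  shows "limsup (\<lambda>n. ennreal (X n)) \<le> ennreal x"
proof (rule ennreal_le_epsilon)
  fix e :: real assume e: "e > 0"
  have "eventually (\<lambda>n. ennreal (X n) \<le> ennreal (x + e)) sequentially"
    using assms(1)[of "x + e"] e by (auto elim!: eventually_mono intro: ennreal_leI)
  then have "limsup (\<lambda>n. ennreal (X n)) \<le> ennreal (x + e)" by (rule Limsup_bounded)
  then show "limsup (\<lambda>n. ennreal (X n)) \<le> ennreal x + ennreal e" using assms(2) e by simp
qed

theorem theorem2p6: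
  fixes p \<alpha> :: real and \<xi> :: complex
    and u \<phi> :: "real \<Rightarrow> complex \<Rightarrow> complex"
    and S :: "real \<Rightarrow> (complex \<Rightarrow> complex) \<Rightarrow> complex \<Rightarrow> complex"
    and fhat f :: "real \<Rightarrow> complex \<Rightarrow> complex"
  assumes "p > 1" and "\<alpha> \<ge> 0"
    and "weighted_comp_family p \<alpha> u \<phi>"
    and "admissible p \<alpha> u \<phi> \<xi>"
    and S_eq: "\<And>t. S t = weighted_comp (u t) (\<phi> t)"
    and arg_const: "\<exists>\<theta>. \<forall>t\<in>{0<..<1}. is_Arg (boundary_value (u t) \<xi>) \<theta>"
    and fhat_branch: "\<And>c. c < (2 + \<alpha>) / p \<Longrightarrow> power_branch \<xi> (- c) (fhat c)"
    and f_eq: "\<And>c. f c = bergman_normalize p \<alpha> (fhat c)"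
  shows "\<exists>L::ennreal.
    (SUP g\<in>approx_evals p \<alpha>.
       limsup (\<lambda>n. ennreal (bergman_norm p \<alpha> (bergman_integral p \<alpha> (\<lambda>t. S t (g n)))))) = L \<and>
    (SUP g\<in>approx_evals p \<alpha>.
       limsup (\<lambda>n. \<integral>\<^sup>+t. ennreal (bergman_norm p \<alpha> (S t (g n))) \<partial>lebesgue_on {0<..<1})) = L \<and>
    ((\<lambda>c. ennreal (bergman_norm p \<alpha> (bergman_integral p \<alpha> (\<lambda>t. S t (f c)))))
       \<longlongrightarrow> L) (at_left ((2 + \<alpha>) / p)) \<and>
    ((\<lambda>c. \<integral>\<^sup>+t. ennreal (bergman_norm p \<alpha> (S t (f c))) \<partial>lebesgue_on {0<..<1})
       \<longlongrightarrow> L) (at_left ((2 + \<alpha>) / p)) \<and>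
    (\<integral>\<^sup>+t. ennreal (cmod (boundary_value (u t) \<xi>)
       / Re (boundary_value (deriv (\<phi> t)) \<xi>) powr ((2 + \<alpha>) / p)) \<partial>lebesgue_on {0<..<1}) = L"
proof -
  note p = \<open>p > 1\<close> and a = \<open>\<alpha> \<ge> 0\<close> and wc = \<open>weighted_comp_family p \<alpha> u \<phi>\<close> and adm = \<open>admissible p \<alpha> u \<phi> \<xi>\<close>
  define \<gamma> where "\<gamma> = (2 + \<alpha>) / p"
  define d where "d t = Re (boundary_value (deriv (\<phi> t)) \<xi>)" for t
  define b where "b t = boundary_value (u t) \<xi>" for t
  define l where "l t = b t * of_real (d t powr (- \<gamma>))" for t
  have sp [simp]: "space \<L> = {0<..<1}" by (simp add: space_restrict_space)
  have half: "1 / 2 \<in> {0<..<1::real}" by simp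
  note pw = admissible_pointwise[OF wc adm, folded d_def b_def]
  have xi: "cmod \<xi> = 1" by (rule pw(1)[OF half])
  have lnorm: "cmod (l t) = cmod (b t) * d t powr (- \<gamma>)" for t by (simp add: l_def norm_mult)
  define L where "L = (\<integral>\<^sup>+t. ennreal (cmod (l t)) \<partial>\<L>)"
  have Sb: "S t g \<in> bergman_space p \<alpha>" if "t \<in> {0<..<1}" "g \<in> bergman_space p \<alpha>" for t g
    unfolding S_eq by (rule pw(5)[OF that])
  have Sc: "continuous_on ({0<..<1} \<times> \<bbbD>) (\<lambda>(t, z). S t g z)" if "g \<in> bergman_space p \<alpha>" for g
    unfolding S_eq by (rule admissible_joint_continuity[OF wc adm that p a])
  have Sm: "(\<lambda>(t, z). S t g z) \<in> borel_measurable (\<L> \<Otimes>\<^sub>M bergman_measure \<alpha>)" if "g \<in> bergman_space p \<alpha>" for g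
    by (rule borel_measurable_pair_bergman[OF Sc[OF that]])
  have Nm: "(\<lambda>t. bergman_norm p \<alpha> (S t g)) \<in> borel_measurable \<L>" if "g \<in> bergman_space p \<alpha>" for g
    by (rule borel_measurable_bergman_norm[OF Sm[OF that] a])
  have op: "(\<integral>\<^sup>+t. bergman_opnorm p \<alpha> (S t) \<partial>\<L>) < \<infinity>"
    using adm unfolding S_eq admissible_def by blast
  have sph: "g \<in> bergman_space p \<alpha>" "bergman_norm p \<alpha> g = 1" if "g \<in> bergman_sphere p \<alpha>" for g
    using that by (auto simp: bergman_sphere_def)
  define H where "H G t = (SUP n. ennreal (bergman_norm p \<alpha> (S t (G n))))" for G :: "nat \<Rightarrow> complex \<Rightarrow> complex" and t
  have Hm: "H G \<in> borel_measurable \<L>" and Hfin: "(\<integral>\<^sup>+t. H G t \<partial>\<L>) < \<infinity>" if G: "\<And>n. G n \<in> bergman_sphere p \<alpha>" for G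
  proof -
    note [measurable] = Nm[OF sph(1)[OF G]]
    show "H G \<in> borel_measurable \<L>" unfolding H_def by measurable
    \<comment> \<open>The nonnegative integral is monotone for arbitrary functions, so finiteness
      passes from the operator norm to its measurable minorant.\<close>
    have "(\<integral>\<^sup>+t. H G t \<partial>\<L>) \<le> (\<integral>\<^sup>+t. bergman_opnorm p \<alpha> (S t) \<partial>\<L>)"
      unfolding H_def bergman_opnorm_def using G by (intro nn_integral_mono SUP_least SUP_upper) auto
    then show "(\<integral>\<^sup>+t. H G t \<partial>\<L>) < \<infinity>" using op by (rule le_less_trans)
  qed
  have Hle: "ennreal (bergman_norm p \<alpha> (S t (G n))) \<le> H G t" for G n t
    unfolding H_def by (rule SUP_upper) simp

  \<comment> \<open>The upper bound along approximate evaluation maps\<close>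
  have upper: "limsup (\<lambda>n. \<integral>\<^sup>+t. ennreal (bergman_norm p \<alpha> (S t (G n))) \<partial>\<L>) \<le> L" if G: "G \<in> approx_evals p \<alpha>" for G
  proof -
    obtain \<eta> where eta: "cmod \<eta> = 1" "G \<in> AE_at p \<alpha> \<eta>" using G by (auto simp: approx_evals_def)
    have Gs: "G n \<in> bergman_sphere p \<alpha>" for n using eta(2) by (simp add: AE_at_def)
    note [measurable] = Nm[OF sph(1)[OF Gs]]
    have "limsup (\<lambda>n. \<integral>\<^sup>+t. ennreal (bergman_norm p \<alpha> (S t (G n))) \<partial>\<L>)
      \<le> (\<integral>\<^sup>+t. limsup (\<lambda>n. ennreal (bergman_norm p \<alpha> (S t (G n)))) \<partial>\<L>)"
      by (rule nn_integral_limsup[where w = "H G"]) (use Hm[OF Gs] Hfin[OF Gs] Hle in auto)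
    also have "\<dots> \<le> L"
      unfolding L_def
    proof (rule nn_integral_mono, rule limsup_ennreal_le)
      fix t K assume "t \<in> space \<L>" and K: "cmod (l t) < K"
      then have t: "t \<in> {0<..<1}" by simp
      show "eventually (\<lambda>n. bergman_norm p \<alpha> (S t (G n)) \<le> K) sequentially"
        unfolding S_eq
        by (rule weighted_comp_AE_upper[OF pw(2)[OF t] pw(3)[OF t] xi pw(6)[OF t] pw(7)[OF t] pw(8)[OF t] pw(9)[OF t]
             pw(4)[OF t] pw(10)[OF t] pw(5)[OF t] eta(2,1) p a])
           (use K in \<open>auto simp: lnorm \<gamma>_def\<close>)
    qed simp
    finally show ?thesis .
  qed
  have int_le: "ennreal (bergman_norm p \<alpha> (bergman_integral p \<alpha> (\<lambda>t. S t g)))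
    \<le> (\<integral>\<^sup>+t. ennreal (bergman_norm p \<alpha> (S t g)) \<partial>\<L>)" if "g \<in> bergman_space p \<alpha>" for g
    by (rule bergman_integral_norm_le[OF Sm[OF that] p a])

  \<comment> \<open>Limits along the power functions\<close>
  define good where "good c \<longleftrightarrow> (\<forall>n. \<alpha> / p < c n \<and> c n < \<gamma>) \<and> c \<longlonglongrightarrow> \<gamma>" for c :: "nat \<Rightarrow> real"
  have F_AE: "(\<lambda>n. f (c n)) \<in> AE_at p \<alpha> \<xi>" if c: "good c" for c
    unfolding f_eq using c unfolding good_def \<gamma>_def
    by (intro normalized_power_branch_AE_at[OF fhat_branch xi p a]) auto
  have F_sph: "f (c n) \<in> bergman_sphere p \<alpha>" if c: "good c" for c n
    using F_AE[OF c] by (simp add: AE_at_def)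
  have diff_lim: "(\<lambda>n. bergman_norm p \<alpha> (\<lambda>z. S t (f (c n)) z - l t * f (c n) z)) \<longlonglongrightarrow> 0"
    if c: "good c" and t: "t \<in> {0<..<1}" for c t
    unfolding S_eq f_eq l_def \<gamma>_def
    by (rule weighted_comp_power_branch_limit[OF pw(2)[OF t] pw(3)[OF t] xi pw(6)[OF t] pw(7)[OF t] pw(8)[OF t] pw(9)[OF t]
             pw(4)[OF t] pw(10)[OF t] pw(5)[OF t] fhat_branch p a])
       (use c in \<open>auto simp: good_def \<gamma>_def\<close>)
  have norm_lim: "(\<lambda>n. bergman_norm p \<alpha> (S t (f (c n)))) \<longlonglongrightarrow> cmod (l t)"
    if c: "good c" and t: "t \<in> {0<..<1}" for c t
  proof (rule LIM_zero_cancel, rule Lim_null_comparison[OF _ diff_lim[OF c t]], rule always_eventually, rule allI)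
    fix n
    have F: "f (c n) \<in> bergman_space p \<alpha>" "bergman_norm p \<alpha> (f (c n)) = 1" using sph[OF F_sph[OF c]] .
    have lF: "(\<lambda>z. l t * f (c n) z) \<in> bergman_space p \<alpha>" "bergman_norm p \<alpha> (\<lambda>z. l t * f (c n) z) = cmod (l t)"
      using bergman_scale[OF F(1) p, of "l t"] F(2) by auto
    show "norm (bergman_norm p \<alpha> (S t (f (c n))) - cmod (l t)) \<le> bergman_norm p \<alpha> (\<lambda>z. S t (f (c n)) z - l t * f (c n) z)"
      using bergman_diff(3)[OF Sb[OF t F(1)] lF(1) p a] bergman_diff(3)[OF lF(1) Sb[OF t F(1)] p a] lF(2)
        bergman_norm_diff_commute[of p \<alpha> "S t (f (c n))" "\<lambda>z. l t * f (c n) z"] by auto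
  qed
  \<comment> \<open>One concrete \<open>good\<close> sequence. It yields measurability and
    integrability of \<open>l\<close>, and an approximate evaluation map that attains both suprema.
    The 2 keeps \<open>c0 0\<close> strictly above \<open>\<alpha> / p\<close>.\<close>
  define c0 where "c0 n = \<gamma> - (\<gamma> - \<alpha> / p) / (real n + 2)" for n
  have gap: "\<alpha> / p < \<gamma>" using p by (simp add: \<gamma>_def divide_strict_right_mono)
  have c0: "good c0"
    unfolding good_def
  proof (intro conjI allI)
    have "(\<gamma> - \<alpha> / p) / (real n + 2) < (\<gamma> - \<alpha> / p) / 1" for n
      by (rule divide_strict_left_mono) (use gap in auto)
    then show "\<alpha> / p < c0 n" for n by (simp add: c0_def algebra_simps)
    show "c0 n < \<gamma>" for n using gap by (simp add: c0_def)
    have "(\<lambda>n. \<gamma> - (\<gamma> - \<alpha> / p) / (real n + 2)) \<longlonglongrightarrow> \<gamma>" by real_asymp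
    then show "c0 \<longlonglongrightarrow> \<gamma>" by (simp add: c0_def[abs_def])
  qed
  \<comment> \<open>The modulus of \<open>l t\<close> is a pointwise limit of measurable norms;
    measurability in \<open>t\<close> of the boundary values enters only in this
    combination.\<close>
  have lm [measurable]: "(\<lambda>t. cmod (l t)) \<in> borel_measurable \<L>"
    by (rule borel_measurable_LIMSEQ_real[OF _ Nm[OF sph(1)[OF F_sph[OF c0]]]]) (use norm_lim[OF c0] in simp)
  have l_le_H: "ennreal (cmod (l t)) \<le> H (\<lambda>n. f (c n)) t" if c: "good c" and t: "t \<in> {0<..<1}" for c t
    by (rule tendsto_upperbound[OF tendsto_ennrealI[OF norm_lim[OF c t]]])
       (use Hle[of t "\<lambda>n. f (c n)"] in auto)
  have Lfin: "L < \<infinity>"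
  proof -
    have "L \<le> (\<integral>\<^sup>+t. H (\<lambda>n. f (c0 n)) t \<partial>\<L>)"
      unfolding L_def by (intro nn_integral_mono l_le_H[OF c0]) simp
    also have "\<dots> < \<infinity>" by (rule Hfin[OF F_sph[OF c0]])
    finally show ?thesis .
  qed
  obtain \<theta> where theta: "\<And>t. t \<in> {0<..<1} \<Longrightarrow> is_Arg (b t) \<theta>" using arg_const unfolding b_def by blast
  \<comment> \<open>The power of \<open>d t\<close> is a nonnegative factor, so \<open>l t\<close>
    inherits the argument of \<open>b t\<close>. As a constant times its modulus, \<open>l\<close>
    is then integrable.\<close>
  have l_cis: "l t = cis \<theta> * of_real (cmod (l t))" if t: "t \<in> {0<..<1}" for t
  proof -
    have "b t = of_real (cmod (b t)) * cis \<theta>" using theta[OF t] by (simp add: is_Arg_def cis_conv_exp)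
    then show ?thesis unfolding lnorm by (simp add: l_def mult_ac)
  qed
  have nl_int: "integrable \<L> (\<lambda>t. cmod (l t))"
    by (rule integrableI_bounded[OF lm]) (use Lfin in \<open>simp add: L_def\<close>)
  have l_int: "integrable \<L> l"
    by (subst Bochner_Integration.integrable_cong[OF refl l_cis])
       (auto intro!: integrable_mult_right integrable_of_real nl_int)
  have l_eq: "(LINT t|\<L>. l t) = cis \<theta> * of_real (LINT t|\<L>. cmod (l t))"
    by (subst Bochner_Integration.integral_cong[OF refl l_cis]) (auto simp: nl_int)
  have Lreal: "L = ennreal (cmod (LINT t|\<L>. l t))"
    unfolding l_eq L_def by (subst nn_integral_eq_integral[OF nl_int]) (auto simp: norm_mult)
  have nn_lim: "(\<lambda>n. \<integral>\<^sup>+t. ennreal (bergman_norm p \<alpha> (S t (f (c n)))) \<partial>\<L>) \<longlonglongrightarrow> L" if c: "good c" for c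
    unfolding L_def
  proof (rule nn_integral_dominated_convergence[where w = "H (\<lambda>n. f (c n))"])
    show "(\<lambda>t. ennreal (bergman_norm p \<alpha> (S t (f (c n))))) \<in> borel_measurable \<L>" for n
      using Nm[OF sph(1)[OF F_sph[OF c]]] by measurable
    show "AE t in \<L>. (\<lambda>n. ennreal (bergman_norm p \<alpha> (S t (f (c n))))) \<longlonglongrightarrow> ennreal (cmod (l t))"
      by (intro AE_I2 tendsto_ennrealI norm_lim[OF c]) simp
    show "AE t in \<L>. ennreal (bergman_norm p \<alpha> (S t (f (c n)))) \<le> H (\<lambda>n. f (c n)) t" for n
      using Hle[of _ "\<lambda>n. f (c n)" n] by auto
  qed (use Hm[OF F_sph[OF c]] Hfin[OF F_sph[OF c]] in auto)
  have int_lim: "(\<lambda>n. ennreal (bergman_norm p \<alpha> (bergman_integral p \<alpha> (\<lambda>t. S t (f (c n)))))) \<longlonglongrightarrow> L"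
    if c: "good c" for c
  proof -
    define J where "J n = bergman_integral p \<alpha> (\<lambda>t. S t (f (c n)))" for n
    define E where "E n = (\<integral>\<^sup>+t. ennreal (bergman_norm p \<alpha> (\<lambda>z. S t (f (c n)) z - l t * f (c n) z)) \<partial>\<L>)" for n
    define \<Lambda> where "\<Lambda> = (LINT t|\<L>. l t)"
    note Fs = sph[OF F_sph[OF c]]
    have lF: "(\<lambda>z. w * f (c n) z) \<in> bergman_space p \<alpha>" "bergman_norm p \<alpha> (\<lambda>z. w * f (c n) z) = cmod w" for w n
      using bergman_scale[OF Fs(1) p, of w] Fs(2) by auto
    have J: "has_bergman_integral p \<alpha> (\<lambda>t. S t (f (c n))) (J n)" for n
    proof -
      have "(\<integral>\<^sup>+t. ennreal (bergman_norm p \<alpha> (S t (f (c n)))) \<partial>\<L>) \<le> (\<integral>\<^sup>+t. H (\<lambda>n. f (c n)) t \<partial>\<L>)"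
        using Hle[of _ "\<lambda>n. f (c n)" n] by (intro nn_integral_mono)
      also have "\<dots> < \<infinity>" by (rule Hfin[OF F_sph[OF c]])
      finally obtain g where "has_bergman_integral p \<alpha> (\<lambda>t. S t (f (c n))) g"
        using has_bergman_integral_exists[OF Sc[OF Fs(1)] Sb[OF _ Fs(1)] _ p a] by blast
      then show ?thesis unfolding J_def by (rule bergman_integral_works)
    qed
    have Jb: "J n \<in> bergman_space p \<alpha>" for n using J[of n] by (simp add: has_bergman_integral_def)
    \<comment> \<open>The comparison lemma with \<open>h = f (c n)\<close>, which is fixed while
      \<open>t\<close> varies.\<close>
    have E: "ennreal (bergman_norm p \<alpha> (\<lambda>z. J n z - \<Lambda> * f (c n) z)) \<le> E n" for n
      unfolding E_def \<Lambda>_def by (rule has_bergman_integral_norm_diff_le[OF J Sm[OF Fs(1)] l_int Fs(1) p a])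
    \<comment> \<open>Dominated by twice \<open>H\<close>: one copy bounds the operator term, the
      other bounds \<open>cmod (l t)\<close>, itself a limit of such norms.\<close>
    have "E \<longlonglongrightarrow> (\<integral>\<^sup>+t. 0 \<partial>\<L>)"
      unfolding E_def
    proof (rule nn_integral_dominated_convergence[where w = "\<lambda>t. 2 * H (\<lambda>n. f (c n)) t"])
      note [measurable] = Hm[OF F_sph[OF c]] borel_measurable_integrable[OF l_int] bergman_space_measurable[OF Fs(1)]
      have [measurable]: "(\<lambda>x. S (fst x) (f (c n)) (snd x)) \<in> borel_measurable (\<L> \<Otimes>\<^sub>M bergman_measure \<alpha>)" for n
        using Sm[OF Fs(1)] by (simp add: case_prod_unfold)
      have "(\<lambda>t. bergman_norm p \<alpha> (\<lambda>z. S t (f (c n)) z - l t * f (c n) z)) \<in> borel_measurable \<L>" for n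
        by (rule borel_measurable_bergman_norm[OF _ a]) (simp add: case_prod_unfold)
      then show "(\<lambda>t. ennreal (bergman_norm p \<alpha> (\<lambda>z. S t (f (c n)) z - l t * f (c n) z))) \<in> borel_measurable \<L>" for n
        by measurable
      show "(\<lambda>t. 2 * H (\<lambda>n. f (c n)) t) \<in> borel_measurable \<L>" by measurable
      show "(\<integral>\<^sup>+t. 2 * H (\<lambda>n. f (c n)) t \<partial>\<L>) < \<infinity>"
        using Hfin[OF F_sph[OF c]] by (subst nn_integral_cmult) (auto simp: ennreal_mult_less_top)
      show "AE t in \<L>. (\<lambda>n. ennreal (bergman_norm p \<alpha> (\<lambda>z. S t (f (c n)) z - l t * f (c n) z))) \<longlonglongrightarrow> 0"
        using tendsto_ennrealI[OF diff_lim[OF c]] by (intro AE_I2) simp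
      show "AE t in \<L>. ennreal (bergman_norm p \<alpha> (\<lambda>z. S t (f (c n)) z - l t * f (c n) z)) \<le> 2 * H (\<lambda>n. f (c n)) t" for n
      proof (rule AE_I2)
        fix t assume "t \<in> space \<L>"
        then have t: "t \<in> {0<..<1}" by simp
        have "ennreal (bergman_norm p \<alpha> (\<lambda>z. S t (f (c n)) z - l t * f (c n) z))
          \<le> ennreal (bergman_norm p \<alpha> (S t (f (c n))) + cmod (l t))"
          using bergman_diff(2)[OF Sb[OF t Fs(1)[of n]] lF(1)[of "l t" n] p a] lF(2) by (intro ennreal_leI) simp
        also have "\<dots> = ennreal (bergman_norm p \<alpha> (S t (f (c n)))) + ennreal (cmod (l t))"
          by (simp add: bergman_norm_nonneg)
        also have "\<dots> \<le> H (\<lambda>n. f (c n)) t + H (\<lambda>n. f (c n)) t"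
          by (intro add_mono l_le_H[OF c t] Hle[of t "\<lambda>n. f (c n)" n])
        finally show "ennreal (bergman_norm p \<alpha> (\<lambda>z. S t (f (c n)) z - l t * f (c n) z)) \<le> 2 * H (\<lambda>n. f (c n)) t"
          by (simp add: mult_2)
      qed
    qed simp
    then have E0: "E \<longlonglongrightarrow> 0" by simp
    have "(\<lambda>n. ennreal (bergman_norm p \<alpha> (\<lambda>z. J n z - \<Lambda> * f (c n) z))) \<longlonglongrightarrow> 0"
      by (rule tendsto_sandwich[OF _ _ tendsto_const E0]) (auto intro!: always_eventually E)
    then have D0: "(\<lambda>n. bergman_norm p \<alpha> (\<lambda>z. J n z - \<Lambda> * f (c n) z)) \<longlonglongrightarrow> 0"
      by (subst (asm) ennreal_tendsto_0_iff) (auto simp: bergman_norm_nonneg)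
    have "(\<lambda>n. bergman_norm p \<alpha> (J n)) \<longlonglongrightarrow> cmod \<Lambda>"
    proof (rule LIM_zero_cancel, rule Lim_null_comparison[OF _ D0], rule always_eventually, rule allI)
      fix n
      show "norm (bergman_norm p \<alpha> (J n) - cmod \<Lambda>) \<le> bergman_norm p \<alpha> (\<lambda>z. J n z - \<Lambda> * f (c n) z)"
        using bergman_diff(3)[OF Jb[of n] lF(1)[of \<Lambda> n] p a] bergman_diff(3)[OF lF(1)[of \<Lambda> n] Jb[of n] p a] lF(2)[of \<Lambda> n]
          bergman_norm_diff_commute[of p \<alpha> "J n" "\<lambda>z. \<Lambda> * f (c n) z"] by auto
    qed
    then show ?thesis unfolding Lreal J_def \<Lambda>_def by (rule tendsto_ennrealI)
  qed
  \<comment> \<open>A limit from the left is tested on sequences between \<open>\<alpha> / p\<close>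
    and \<gamma> converging to \<gamma>, all of which are \<open>good\<close>.\<close>
  have seq: "(X \<longlongrightarrow> L) (at_left \<gamma>)" if X: "\<And>c. good c \<Longrightarrow> (\<lambda>n. X (c n)) \<longlonglongrightarrow> L" for X :: "real \<Rightarrow> ennreal"
    by (rule tendsto_at_left_sequentially[OF gap]) (use X in \<open>auto simp: good_def\<close>)

  \<comment> \<open>Equality of the two suprema with the integral\<close>
  have F0: "(\<lambda>n. f (c0 n)) \<in> approx_evals p \<alpha>"
    unfolding approx_evals_def using F_AE[OF c0] xi by (intro UN_I[of \<xi>]) auto
  have AEb: "G n \<in> bergman_space p \<alpha>" if "G \<in> approx_evals p \<alpha>" for G n
    using that by (auto simp: approx_evals_def AE_at_def bergman_sphere_def)
  have sup1: "(SUP g\<in>approx_evals p \<alpha>. limsup (\<lambda>n. ennreal (bergman_norm p \<alpha> (bergman_integral p \<alpha> (\<lambda>t. S t (g n)))))) = L"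
  proof (rule antisym)
    show "(SUP g\<in>approx_evals p \<alpha>. limsup (\<lambda>n. ennreal (bergman_norm p \<alpha> (bergman_integral p \<alpha> (\<lambda>t. S t (g n)))))) \<le> L"
    proof (rule SUP_least)
      fix g assume g: "g \<in> approx_evals p \<alpha>"
      \<comment> \<open>The norm of an integral is at most the integral of the norms, so the bound
        for the second supremum covers the first.\<close>
      have "limsup (\<lambda>n. ennreal (bergman_norm p \<alpha> (bergman_integral p \<alpha> (\<lambda>t. S t (g n)))))
        \<le> limsup (\<lambda>n. \<integral>\<^sup>+t. ennreal (bergman_norm p \<alpha> (S t (g n))) \<partial>\<L>)"
        by (intro Limsup_mono always_eventually allI int_le AEb[OF g])
      also have "\<dots> \<le> L" by (rule upper[OF g])
      finally show "limsup (\<lambda>n. ennreal (bergman_norm p \<alpha> (bergman_integral p \<alpha> (\<lambda>t. S t (g n))))) \<le> L" .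
    qed
    have "L = limsup (\<lambda>n. ennreal (bergman_norm p \<alpha> (bergman_integral p \<alpha> (\<lambda>t. S t (f (c0 n))))))"
      using lim_imp_Limsup[OF _ int_lim[OF c0]] by simp
    also have "\<dots> \<le> (SUP g\<in>approx_evals p \<alpha>. limsup (\<lambda>n. ennreal (bergman_norm p \<alpha> (bergman_integral p \<alpha> (\<lambda>t. S t (g n))))))"
      by (rule SUP_upper2[OF F0]) simp
    finally show "L \<le> (SUP g\<in>approx_evals p \<alpha>. limsup (\<lambda>n. ennreal (bergman_norm p \<alpha> (bergman_integral p \<alpha> (\<lambda>t. S t (g n))))))" .
  qed
  have sup2: "(SUP g\<in>approx_evals p \<alpha>. limsup (\<lambda>n. \<integral>\<^sup>+t. ennreal (bergman_norm p \<alpha> (S t (g n))) \<partial>\<L>)) = L"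
  proof (rule antisym)
    show "(SUP g\<in>approx_evals p \<alpha>. limsup (\<lambda>n. \<integral>\<^sup>+t. ennreal (bergman_norm p \<alpha> (S t (g n))) \<partial>\<L>)) \<le> L"
      by (rule SUP_least) (rule upper)
    have "L = limsup (\<lambda>n. \<integral>\<^sup>+t. ennreal (bergman_norm p \<alpha> (S t (f (c0 n)))) \<partial>\<L>)"
      using lim_imp_Limsup[OF _ nn_lim[OF c0]] by simp
    also have "\<dots> \<le> (SUP g\<in>approx_evals p \<alpha>. limsup (\<lambda>n. \<integral>\<^sup>+t. ennreal (bergman_norm p \<alpha> (S t (g n))) \<partial>\<L>))"
      by (rule SUP_upper2[OF F0]) simp
    finally show "L \<le> (SUP g\<in>approx_evals p \<alpha>. limsup (\<lambda>n. \<integral>\<^sup>+t. ennreal (bergman_norm p \<alpha> (S t (g n))) \<partial>\<L>))" .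
  qed
  have "(\<integral>\<^sup>+t. ennreal (cmod (b t) / d t powr \<gamma>) \<partial>\<L>) = L"
    unfolding L_def lnorm by (intro nn_integral_cong) (simp add: powr_minus divide_inverse)
  then show ?thesis
    unfolding b_def d_def \<gamma>_def
    using sup1 sup2 seq[OF int_lim] seq[OF nn_lim] unfolding \<gamma>_def by (intro exI[of _ L]) simp
qed

end
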